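(* Let $a,b,c,d$ be natural numbers with $(a+b-c+1)(d-c)=3$, and let $V_a,V_b\subseteq\mathbb{C}[s,t]_d$ be general vector subspaces of dimension $a+1$ and $b+1$ respectively. Then the set $\{\sigma\in\mathrm{PGL}(2,\mathbb{C}) : \dim(V_a+V_b^{\sigma})\le c+1\}$ is finite, and its cardinality is $\frac{1}{6}\,ab(a^2-1)(b^2-1)$ if $a+b+1-c=3$ and $d-c=1$, and $6\binom{a+3}{3}\binom{b+3}{3}$ if $a+b+1-c=1$ and $d-c=3$.
   Context: $\mathbb{C}[s,t]_d$ denotes the space of binary homogeneous polynomials of degree $d$. For $\sigma\in\mathrm{PGL}(2,\mathbb{C})$ and a subspace $V$, $V^{\sigma}$ is the image of $V$ under the change of variables $(s,t)\mapsto$ the linear substitution determined by $\sigma$ (this is well defined on subspaces).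
   Formalization: The hypothesis c ≤ d is added: if c > d (e.g. a=b=0, c=4, d=3, where both factors are negative with product 3), the condition dim ≤ c+1 always holds, the set is all of PGL(2,C), and finiteness fails. *)

theory Defs
  imports "HOL-Computational_Algebra.Polynomial" Complex_Main
begin

text \<open>Binary forms of degree d in C[s,t]_d are represented by their dehomogenisation
  f(x,1), i.e. by complex univariate polynomials of degree at most d:
  the form sum_i c_i s^i t^(d-i) corresponds to the polynomial sum_i c_i x^i.\<close>

definition forms :: "nat \<Rightarrow> complex poly set" where
  "forms d = {p. degree p \<le> d}"

definition pspan :: "complex poly set \<Rightarrow> complex poly set" where
  "pspan S = module.span smult S"

definition pdim :: "complex poly set \<Rightarrow> nat" where
  "pdim S = vector_space.dim smult S"

definition subspace_sum :: "complex poly set \<Rightarrow> complex poly set \<Rightarrow> complex poly set" where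
  "subspace_sum U W = {u + w | u w. u \<in> U \<and> w \<in> W}"

text \<open>2x2 complex matrices (alpha, beta, gamma, delta) = [[alpha, beta],[gamma, delta]].\<close>

type_synonym mat2 = "complex \<times> complex \<times> complex \<times> complex"

definition mdet :: "mat2 \<Rightarrow> complex" where
  "mdet m = (case m of (\<alpha>, \<beta>, \<gamma>, \<delta>) \<Rightarrow> \<alpha> * \<delta> - \<beta> * \<gamma>)"

definition mscale :: "complex \<Rightarrow> mat2 \<Rightarrow> mat2" where
  "mscale k m = (case m of (\<alpha>, \<beta>, \<gamma>, \<delta>) \<Rightarrow> (k * \<alpha>, k * \<beta>, k * \<gamma>, k * \<delta>))"

definition pgl_class :: "mat2 \<Rightarrow> mat2 set" where
  "pgl_class m = {mscale k m | k. k \<noteq> 0}"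

definition PGL2 :: "mat2 set set" where
  "PGL2 = pgl_class ` {m. mdet m \<noteq> 0}"

text \<open>Linear change of variables (s,t) |-> (alpha s + beta t, gamma s + delta t) on a
  binary form of degree d, in the dehomogenised representation:
  s^i t^(d-i) |-> (alpha x + beta)^i (gamma x + delta)^(d-i).\<close>

definition form_act :: "nat \<Rightarrow> mat2 \<Rightarrow> complex poly \<Rightarrow> complex poly" where
  "form_act d m p = (case m of (\<alpha>, \<beta>, \<gamma>, \<delta>) \<Rightarrow>
     (\<Sum>i\<le>d. smult (coeff p i) ([:\<beta>, \<alpha>:] ^ i * [:\<delta>, \<gamma>:] ^ (d - i))))"

definition subspace_act :: "nat \<Rightarrow> mat2 \<Rightarrow> complex poly set \<Rightarrow> complex poly set" where
  "subspace_act d m V = form_act d m ` V"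

inductive polyfun :: "(('i \<Rightarrow> complex) \<Rightarrow> complex) \<Rightarrow> bool" where
  const: "polyfun (\<lambda>_. c)"
| var: "polyfun (\<lambda>x. x i)"
| add: "polyfun f \<Longrightarrow> polyfun g \<Longrightarrow> polyfun (\<lambda>x. f x + g x)"
| mult: "polyfun f \<Longrightarrow> polyfun g \<Longrightarrow> polyfun (\<lambda>x. f x * g x)"

definition row_span :: "nat \<Rightarrow> nat \<Rightarrow> (nat \<Rightarrow> nat \<Rightarrow> complex) \<Rightarrow> complex poly set" where
  "row_span d n A = pspan {(\<Sum>j\<le>d. monom (A i j) j) | i. i \<le> n}"

text \<open>A property P of pairs of subspaces (V, W) of C[s,t]_d holds for general V, W of
  dimensions n+1 and m+1: there is a nonzero polynomial F in the coordinates of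
  spanning matrices (x (False,i,j) = A i j, x (True,i,j) = B i j) such that P holds for
  every pair of such subspaces spanned by matrices with F nonzero (a dense Zariski-open
  condition on the pair of Grassmannians).\<close>

definition general_pair ::
  "nat \<Rightarrow> nat \<Rightarrow> nat \<Rightarrow> (complex poly set \<Rightarrow> complex poly set \<Rightarrow> bool) \<Rightarrow> bool" where
  "general_pair d n m P \<longleftrightarrow>
     (\<exists>F :: ((bool \<times> nat \<times> nat) \<Rightarrow> complex) \<Rightarrow> complex.
        polyfun F \<and> (\<exists>x. F x \<noteq> 0) \<and>
        (\<forall>x. F x \<noteq> 0 \<longrightarrow>
           (let V = row_span d n (\<lambda>i j. x (False, i, j));
                W = row_span d m (\<lambda>i j. x (True, i, j))
            in pdim V = n + 1 \<longrightarrow> pdim W = m + 1 \<longrightarrow> P V W)))"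

end

theory Submission
  imports Defs "HOL-Computational_Algebra.Fundamental_Theorem_Algebra" "HOL-Analysis.Analysis"
    "Jordan_Normal_Form.Determinant"
begin

text \<open>Passing to annihilators under the \<open>SL\<^sub>2\<close>-invariant pairing of binary forms, both counts ask
  for the classes of \<open>\<sigma>\<close> such that some nonzero \<open>g\<close> in a general space \<open>W\<close> of dimension \<open>q + 1\<close> is
  carried into a general space \<open>V\<close> of dimension \<open>p + 1\<close>, where both spaces consist of forms of degree
  \<open>d = p + q + 3\<close>. For the special choice \<open>V = h \<cdot> C[s,t]\<^sub>p\<close>, \<open>W = k \<cdot> C[s,t]\<^sub>q\<close> with
  \<open>deg h = q + 3\<close>, \<open>deg k = p + 3\<close>, degree reasons force \<open>\<sigma>\<close> to map three roots of \<open>h\<close> to roots of \<open>k\<close>;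
  if no Moebius transformation matches four of them, this gives exactly
  \<open>6 \<cdot> (q+3 choose 3) \<cdot> (p+3 choose 3)\<close> classes. On a complex line of pairs through the special one this number
  does not change near the special pair: each solution is nondegenerate (contraction principle in the
  coordinates \<open>(\<sigma> z\<^sub>1, \<sigma> z\<^sub>2, \<sigma> z\<^sub>3)\<close>), and no solution can tend to a singular matrix, because a nonzero element
  of \<open>V\<close> vanishes at any point to order at most \<open>p + 1\<close>, one of \<open>W\<close> to order at most \<open>q + 1\<close>, and these orders
  add up to less than \<open>d\<close>. Finally, having exactly \<open>N\<close> solutions is a constructible condition on the
  pair, by quantifier elimination over the complex numbers, so it either holds or fails generically; it cannot fail
  generically, since it holds near the special pair on every line through it.\<close>

text \<open>Both cases are square problems: three parameters for \<open>\<sigma>\<close> against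
  three conditions. If \<open>d = a + b + 3\<close>, the two spaces usually meet only in 0 and the
  condition is a nonzero intersection, with \<open>p = a\<close> and \<open>q = b\<close>. If
  \<open>d = a + b - 1\<close>, the sum is usually everything; annihilators turn this into the same
  question with \<open>p = b - 2\<close> and \<open>q = a - 2\<close>. There the special pair is
  spanned by d-th powers of linear forms, since annihilating \<open>(x - z)^d\<close> means
  vanishing at \<open>z\<close>. The indices \<open>a \<le> 1\<close> or \<open>b \<le> 1\<close>,
  for which \<open>p\<close> or \<open>q\<close> would be negative, give the count 0 by dimension.
  The factor 6 counts the bijections between three chosen roots of \<open>h\<close> and three chosen
  roots of \<open>k\<close>. What could spoil constancy of the count is that PGL(2) is not compact:
  normalised matrices form a compact set, whose additional points are the matrices of rank one. The
  neighbourhood of the special pair may depend on the line, because a polynomial that is nonzero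
  somewhere on a line has only finitely many zeros there.\<close>

hide_const (open) Module.smult

section \<open>Constructible predicates and quantifier elimination\<close>

lemma polyfun_cmult: "polyfun f \<Longrightarrow> polyfun (\<lambda>x. c * f x)"
  by (rule polyfun.mult[OF polyfun.const])

lemma polyfun_uminus: "polyfun f \<Longrightarrow> polyfun (\<lambda>x. - f x)"
  using polyfun_cmult[of f "-1"] by simp

lemma polyfun_diff:
  assumes "polyfun f" "polyfun g"
  shows "polyfun (\<lambda>x. f x - g x)"
proof -
  have "polyfun (\<lambda>x. f x + - g x)"
    by (rule polyfun.add[OF assms(1) polyfun_uminus[OF assms(2)]])
  then show ?thesis by (simp only: add_uminus_conv_diff)
qed

lemma polyfun_sum: "(\<And>a. a \<in> A \<Longrightarrow> polyfun (f a)) \<Longrightarrow> polyfun (\<lambda>x. \<Sum>a\<in>A. f a x)"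
  by (induction A rule: infinite_finite_induct) (auto intro: polyfun.intros)

lemma polyfun_prod: "(\<And>a. a \<in> A \<Longrightarrow> polyfun (f a)) \<Longrightarrow> polyfun (\<lambda>x. \<Prod>a\<in>A. f a x)"
  by (induction A rule: infinite_finite_induct) (auto intro: polyfun.intros)

lemma polyfun_power: "polyfun f \<Longrightarrow> polyfun (\<lambda>x. f x ^ n)"
  by (induction n) (auto intro: polyfun.intros)

lemmas polyfun_intros = polyfun.intros polyfun_uminus polyfun_diff polyfun_sum
  polyfun_prod polyfun_power

lemma polyfun_subst:
  "polyfun f \<Longrightarrow> (\<And>i. polyfun (h i)) \<Longrightarrow> polyfun (\<lambda>x. f (\<lambda>i. h i x))"
  by (induction rule: polyfun.induct) (auto intro: polyfun.intros)

text \<open>Polynomials in one distinguished variable with the remaining variables as parameters.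
  Uniform degree bounds travel as separate hypotheses; with a fixed bound, evaluation and zero tests
  become finite combinations of coefficients.\<close>

definition polyfunp :: "(('i \<Rightarrow> complex) \<Rightarrow> complex poly) \<Rightarrow> bool" where
  "polyfunp P \<longleftrightarrow> (\<forall>k. polyfun (\<lambda>x. coeff (P x) k))"

lemma polyfunp_coeff: "polyfunp P \<Longrightarrow> polyfun (\<lambda>x. coeff (P x) k)"
  by (simp add: polyfunp_def)

lemma polyfunp_const: "polyfunp (\<lambda>_. p)"
  by (simp add: polyfunp_def polyfun.const)

lemma polyfunp_add: "polyfunp P \<Longrightarrow> polyfunp Q \<Longrightarrow> polyfunp (\<lambda>x. P x + Q x)"
  by (simp add: polyfunp_def polyfun.add)

lemma polyfunp_diff: "polyfunp P \<Longrightarrow> polyfunp Q \<Longrightarrow> polyfunp (\<lambda>x. P x - Q x)"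
  by (simp add: polyfunp_def polyfun_diff)

lemma polyfunp_mult: "polyfunp P \<Longrightarrow> polyfunp Q \<Longrightarrow> polyfunp (\<lambda>x. P x * Q x)"
  unfolding polyfunp_def coeff_mult by (intro allI polyfun_sum polyfun.mult) auto

lemma polyfunp_smult: "polyfun f \<Longrightarrow> polyfunp Q \<Longrightarrow> polyfunp (\<lambda>x. smult (f x) (Q x))"
  unfolding polyfunp_def coeff_smult by (auto intro: polyfun_intros)

lemma polyfunp_pCons: "polyfun f \<Longrightarrow> polyfunp Q \<Longrightarrow> polyfunp (\<lambda>x. pCons (f x) (Q x))"
  unfolding polyfunp_def coeff_pCons
proof
  fix k assume "polyfun f" "\<forall>k. polyfun (\<lambda>x. coeff (Q x) k)"
  then show "polyfun (\<lambda>x. case k of 0 \<Rightarrow> f x | Suc k \<Rightarrow> coeff (Q x) k)" by (cases k) auto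
qed

lemma polyfunp_monom: "polyfun f \<Longrightarrow> polyfunp (\<lambda>x. monom (f x) n)"
  unfolding polyfunp_def
proof
  fix k assume "polyfun f"
  then show "polyfun (\<lambda>x. coeff (monom (f x) n) k)" by (cases "n = k") (auto intro: polyfun.const)
qed

lemma polyfunp_sum: "(\<And>a. a \<in> A \<Longrightarrow> polyfunp (f a)) \<Longrightarrow> polyfunp (\<lambda>x. \<Sum>a\<in>A. f a x)"
  unfolding polyfunp_def coeff_sum by (auto intro!: polyfun_sum)

lemma polyfunp_power: "polyfunp P \<Longrightarrow> polyfunp (\<lambda>x. P x ^ n)"
  by (induction n) (auto intro: polyfunp_mult polyfunp_const)

lemmas polyfunp_intros = polyfunp_const polyfunp_add polyfunp_diff polyfunp_mult
  polyfunp_smult polyfunp_pCons polyfunp_monom polyfunp_sum polyfunp_power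

lemma polyfun_poly:
  assumes "polyfunp P" "\<And>x. degree (P x) \<le> n" "polyfun f"
  shows "polyfun (\<lambda>x. poly (P x) (f x))"
proof -
  have "poly (P x) (f x) = (\<Sum>i\<le>n. coeff (P x) i * f x ^ i)" for x
    unfolding poly_altdef
    using assms(2)[of x] by (intro sum.mono_neutral_left) (auto simp: coeff_eq_0)
  then show ?thesis using assms by (auto intro!: polyfun_intros polyfunp_coeff)
qed

lemma polyfun_on_line:
  assumes "polyfun f"
  shows "\<exists>p. \<forall>t. f (\<lambda>i. x i + t * y i) = poly p t"
  using assms
proof (induction rule: polyfun.induct)
  case (const c) show ?case by (rule exI[of _ "[:c:]"]) simp
next
  case (var i) show ?case by (rule exI[of _ "[:x i, y i:]"]) simp
next
  case (add f g) then show ?case by (metis poly_add)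
next
  case (mult f g) then show ?case by (metis poly_mult)
qed

text \<open>Absence of zero divisors, reduced to one variable: on the line joining a point where
  \<open>f\<close> is nonzero to one where \<open>g\<close> is nonzero, both restrictions are
  nonzero polynomials.\<close>

lemma polyfun_mult_nonzero:
  assumes "polyfun f" "polyfun g" "f x \<noteq> 0" "g y \<noteq> 0"
  shows "\<exists>z. f z * g z \<noteq> 0"
proof -
  obtain p where p: "\<And>t. f (\<lambda>i. x i + t * (y i - x i)) = poly p t"
    using polyfun_on_line[OF assms(1), of x "\<lambda>i. y i - x i"] by metis
  obtain q where q: "\<And>t. g (\<lambda>i. x i + t * (y i - x i)) = poly q t"
    using polyfun_on_line[OF assms(2), of x "\<lambda>i. y i - x i"] by metis
  have "poly p 0 \<noteq> 0" "poly q 1 \<noteq> 0" using assms(3,4) p[of 0] q[of 1] by simp_all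
  then have "p * q \<noteq> 0" by auto
  then obtain t where "poly (p * q) t \<noteq> 0" using poly_all_0_iff_0 by blast
  then show ?thesis using p q by (metis poly_mult)
qed

section \<open>Boolean combinations of polynomial equations\<close>

inductive constr :: "(('i \<Rightarrow> complex) \<Rightarrow> bool) \<Rightarrow> bool" where
  zero: "polyfun f \<Longrightarrow> constr (\<lambda>x. f x = 0)"
| neg: "constr P \<Longrightarrow> constr (\<lambda>x. \<not> P x)"
| conj: "constr P \<Longrightarrow> constr Q \<Longrightarrow> constr (\<lambda>x. P x \<and> Q x)"

lemma constr_True: "constr (\<lambda>_. True)"
  using constr.zero[OF polyfun.const, of 0] by simp

lemma constr_disj: "constr P \<Longrightarrow> constr Q \<Longrightarrow> constr (\<lambda>x. P x \<or> Q x)"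
  using constr.neg[OF constr.conj[OF constr.neg constr.neg], of P Q] by simp

lemma constr_eq: "polyfun f \<Longrightarrow> polyfun g \<Longrightarrow> constr (\<lambda>x. f x = g x)"
  using constr.zero[OF polyfun_diff, of f g] by simp

lemma constr_ball:
  "finite A \<Longrightarrow> (\<And>a. a \<in> A \<Longrightarrow> constr (P a)) \<Longrightarrow> constr (\<lambda>x. \<forall>a\<in>A. P a x)"
  by (induction A rule: finite_induct) (auto intro: constr_True constr.conj)

lemma constr_bex:
  "finite A \<Longrightarrow> (\<And>a. a \<in> A \<Longrightarrow> constr (P a)) \<Longrightarrow> constr (\<lambda>x. \<exists>a\<in>A. P a x)"
  using constr.neg[OF constr_ball, of A "\<lambda>a x. \<not> P a x"] by (simp add: constr.neg)

lemma constr_eq_zero_poly: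
  assumes "polyfunp Q" "\<And>x. degree (Q x) \<le> m"
  shows "constr (\<lambda>x. Q x = 0)"
proof -
  have "Q x = 0 \<longleftrightarrow> (\<forall>k\<in>{..m}. coeff (Q x) k = 0)" for x
    using assms(2)[of x] by (metis atMost_iff coeff_0 le_degree leading_coeff_0_iff)
  then show ?thesis
    using assms(1) by (auto intro!: constr_ball constr.zero polyfunp_coeff)
qed

text \<open>One step of pseudo-division. Scaling by \<open>coeff p n\<close> replaces division by
  it, so that coefficients stay polynomial in the parameters; \<open>n\<close> is a formal degree,
  and the true one may drop.\<close>

lemma degree_cancel_lead:
  fixes p r :: "complex poly"
  assumes "degree p \<le> n" "degree r \<le> Suc m" "n \<le> Suc m"
  shows "degree (smult (coeff p n) r - monom (coeff r (Suc m)) (Suc m - n) * p) \<le> m"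
proof (rule degree_le, intro allI impI)
  fix i assume "m < i"
  then consider "i = Suc m" | "i > Suc m" by linarith
  then show "coeff (smult (coeff p n) r - monom (coeff r (Suc m)) (Suc m - n) * p) i = 0"
  proof cases
    case 1
    then show ?thesis using assms by (simp add: coeff_monom_mult)
  next
    case 2
    then have "coeff r i = 0" "coeff p (i - (Suc m - n)) = 0"
      using assms by (auto intro!: coeff_eq_0)
    then show ?thesis by (simp add: coeff_monom_mult)
  qed
qed

text \<open>The guard makes the formal leading coefficient a unit, so pseudo-division by
  \<open>p x\<close> preserves divisibility; repeated steps lower the bound on \<open>Q x\<close>
  until the answer is immediate.\<close>

lemma constr_dvd:
  assumes p: "polyfunp p" "\<And>x. degree (p x) \<le> n"
  shows "polyfunp Q \<Longrightarrow> (\<And>x. degree (Q x) \<le> m) \<Longrightarrow>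
    constr (\<lambda>x. coeff (p x) n \<noteq> 0 \<and> p x dvd Q x)"
proof (induction m arbitrary: Q)
  case 0
  show ?case
  proof (cases n)
    case 0
    have "coeff (p x) n \<noteq> 0 \<Longrightarrow> p x dvd Q x" for x
      using p(2)[of x] 0 by (metis coeff_0 is_unit_iff_degree le_zero_eq unit_imp_dvd)
    then have "(\<lambda>x. coeff (p x) n \<noteq> 0 \<and> p x dvd Q x) = (\<lambda>x. \<not> coeff (p x) n = 0)" by auto
    then show ?thesis using p(1) by (simp only:) (intro constr.neg constr.zero polyfunp_coeff)
  next
    case (Suc n')
    have "coeff (p x) n \<noteq> 0 \<Longrightarrow> p x dvd Q x \<longleftrightarrow> Q x = 0" for x
      using p(2)[of x] 0(2)[of x] Suc le_degree[of "p x" n] dvd_imp_degree_le[of "p x" "Q x"] by auto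
    then have "(\<lambda>x. coeff (p x) n \<noteq> 0 \<and> p x dvd Q x) = (\<lambda>x. (\<not> coeff (p x) n = 0) \<and> Q x = 0)" by auto
    then show ?thesis using p(1) 0
      by (auto intro!: constr.intros polyfunp_coeff constr_eq_zero_poly[of _ 0])
  qed
next
  case (Suc m)
  show ?case
  proof (cases "n \<le> Suc m")
    case True
    let ?Q = "\<lambda>x. smult (coeff (p x) n) (Q x) - monom (coeff (Q x) (Suc m)) (Suc m - n) * p x"
    have "coeff (p x) n \<noteq> 0 \<Longrightarrow> p x dvd Q x \<longleftrightarrow> p x dvd ?Q x" for x
      by (simp add: dvd_diff_left_iff dvd_smult_iff)
    then have "(\<lambda>x. coeff (p x) n \<noteq> 0 \<and> p x dvd Q x) = (\<lambda>x. coeff (p x) n \<noteq> 0 \<and> p x dvd ?Q x)"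
      by blast
    moreover have "constr (\<lambda>x. coeff (p x) n \<noteq> 0 \<and> p x dvd ?Q x)"
      using p Suc.prems True
      by (intro Suc.IH degree_cancel_lead polyfunp_intros polyfunp_coeff) auto
    ultimately show ?thesis by simp
  next
    case False
    have "coeff (p x) n \<noteq> 0 \<Longrightarrow> p x dvd Q x \<longleftrightarrow> Q x = 0" for x
      using Suc.prems(2)[of x] False le_degree[of "p x" n] dvd_imp_degree_le[of "p x" "Q x"] by auto
    then have "(\<lambda>x. coeff (p x) n \<noteq> 0 \<and> p x dvd Q x) = (\<lambda>x. (\<not> coeff (p x) n = 0) \<and> Q x = 0)" by auto
    then show ?thesis using p(1) Suc.prems
      by (auto intro!: constr.intros polyfunp_coeff constr_eq_zero_poly[of _ "Suc m"])
  qed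
qed

text \<open>Euclid's algorithm with parameters. Wherever its course depends on the vanishing of a
  leading coefficient, the predicate splits into two constructible cases. The measure contains
  \<open>Suc\<close> so that discarding a polynomial of formal degree 0 also decreases it.\<close>

lemma constr_common_root:
  assumes q: "polyfunp q" "\<And>x. degree (q x) \<le> k"
  shows "(\<And>p n. (p, n) \<in> set ps \<Longrightarrow> polyfunp p \<and> (\<forall>x. degree (p x) \<le> n)) \<Longrightarrow>
    constr (\<lambda>x. \<exists>y. (\<forall>(p, n) \<in> set ps. poly (p x) y = 0) \<and> poly (q x) y \<noteq> 0)"
proof (induction "sum_list (map (Suc \<circ> snd) ps)" arbitrary: ps rule: less_induct)
  case less
  note IH = less.hyps and ps = less.prems
  have aux1: "(C \<noteq> 0 \<Longrightarrow> A = (\<not> D)) \<Longrightarrow> (C \<noteq> 0 \<and> A) = ((\<not> C = 0) \<and> \<not> (C \<noteq> 0 \<and> D))"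
    for C :: complex and A D by blast
  have aux2: "(\<And>y. C \<noteq> 0 \<Longrightarrow> A y = B y) \<Longrightarrow> (C \<noteq> 0 \<and> (\<exists>y. A y)) = ((\<not> C = 0) \<and> (\<exists>y. B y))"
    for C :: complex and A B :: "complex \<Rightarrow> bool" by blast
  have aux3: "(\<And>y. C = 0 \<Longrightarrow> A y = B y) \<Longrightarrow>
      (\<exists>y. A y) = ((C = 0 \<and> (\<exists>y. B y)) \<or> (C \<noteq> 0 \<and> (\<exists>y. A y)))"
    for C :: complex and A B :: "complex \<Rightarrow> bool" by blast
  let ?P = "\<lambda>ps x y. (\<forall>(p, n) \<in> set ps. poly (p x) y = 0) \<and> poly (q x) y \<noteq> 0"
  consider "ps = []" | p where "(p, 0) \<in> set ps" | "ps \<noteq> []" "\<And>p. (p, 0) \<notin> set ps" by fast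
  then show ?case
  proof cases
    case 1
    have "(\<lambda>x. \<exists>y. poly (q x) y \<noteq> 0) = (\<lambda>x. \<not> q x = 0)"
      by (auto simp: fun_eq_iff) (use poly_all_0_iff_0 in blast)
    then show ?thesis using q 1 by (auto intro!: constr.neg constr_eq_zero_poly)
  next
    \<comment> \<open>Formal degree 0: the equation does not involve \<open>y\<close> and becomes a
      condition on the parameters.\<close>
    case (2 p)
    then obtain as bs where ab: "ps = as @ (p, 0) # bs" by (meson split_list)
    have d: "poly (p x) y = coeff (p x) 0" for x y
    proof -
      have "degree (p x) = 0" using ps[of p 0] ab by simp
      then show ?thesis by (auto elim: degree_eq_zeroE)
    qed
    have "(\<lambda>x. \<exists>y. ?P ps x y) = (\<lambda>x. coeff (p x) 0 = 0 \<and> (\<exists>y. ?P (as @ bs) x y))"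
      unfolding ab by (auto simp: d fun_eq_iff)
    moreover have "constr (\<lambda>x. \<exists>y. ?P (as @ bs) x y)"
      using ps by (intro IH) (auto simp: ab)
    ultimately show ?thesis using ps[of p 0] ab
      by (auto intro!: constr.conj constr.zero polyfunp_coeff)
  next
    case 3
    \<comment> \<open>A polynomial of least formal degree can serve as divisor for every other
      member of the list.\<close>
    define n where "n = Min (snd ` set ps)"
    have "n \<in> snd ` set ps" unfolding n_def using 3 by (intro Min_in) auto
    then obtain p where pn: "(p, n) \<in> set ps" by auto
    have nmin: "\<And>r m. (r, m) \<in> set ps \<Longrightarrow> n \<le> m" unfolding n_def by (auto intro!: Min_le) force
    obtain as bs where ab: "ps = as @ (p, n) # bs" using pn by (meson split_list)
    have n0: "n \<noteq> 0" using pn 3 by metis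
    have pp: "polyfunp p" "\<And>x. degree (p x) \<le> n" using ps pn by auto
    let ?c = "\<lambda>x. coeff (p x) n"
    \<comment> \<open>Where the formal leading coefficient vanishes, \<open>p\<close> coincides with
      this truncation of smaller formal degree.\<close>
    let ?p' = "\<lambda>x. p x - monom (?c x) n"
    have deg': "degree (?p' x) \<le> n - 1" for x
    proof (rule degree_le, intro allI impI)
      fix i assume "n - 1 < i"
      then show "coeff (?p' x) i = 0"
        using coeff_eq_0[of "p x" i] pp(2)[of x] n0 by (cases "i = n") auto
    qed
    have c1: "constr (\<lambda>x. \<exists>y. ?P (as @ (?p', n - 1) # bs) x y)"
      using ps n0 pp deg' by (intro IH) (auto simp: ab intro!: polyfunp_intros polyfunp_coeff)
    have c2: "constr (\<lambda>x. ?c x \<noteq> 0 \<and> (\<exists>y. ?P ps x y))"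
    proof (cases "as @ bs")
      case Nil
      then have psn: "ps = [(p, n)]" using ab by simp
      \<comment> \<open>With one equation left, a root of \<open>p x\<close> outside the zeros of
        \<open>q x\<close> is missing exactly when \<open>p x\<close> divides a power of
        \<open>q x\<close>; the exponent \<open>n\<close> is the degree of \<open>p x\<close>, its
        leading coefficient being nonzero.\<close>
      have *: "?c x \<noteq> 0 \<Longrightarrow> (\<exists>y. ?P ps x y) \<longleftrightarrow> \<not> p x dvd q x ^ n" for x
        using nullstellensatz_univariate[of "p x" "q x"] le_degree[of "p x" n] pp(2)[of x] psn by auto
      have "(\<lambda>x. ?c x \<noteq> 0 \<and> (\<exists>y. ?P ps x y)) =
          (\<lambda>x. (\<not> ?c x = 0) \<and> \<not> (?c x \<noteq> 0 \<and> p x dvd q x ^ n))"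
        by (intro ext aux1 *)
      moreover have dq: "degree (q x ^ n) \<le> k * n" for x
        using degree_power_le[of "q x" n] q(2)[of x] by (meson le_trans mult_le_mono1)
      have "constr (\<lambda>x. (\<not> ?c x = 0) \<and> \<not> (?c x \<noteq> 0 \<and> p x dvd q x ^ n))"
        by (rule constr.conj[OF constr.neg[OF constr.zero[OF polyfunp_coeff[OF pp(1)]]]
              constr.neg[OF constr_dvd[OF pp polyfunp_power[OF q(1)] dq]]])
      ultimately show ?thesis by (simp only:)
    next
      case (Cons rm _)
      obtain r m where rm: "rm = (r, m)" by force
      then have rin: "(r, m) \<in> set (as @ bs)" using Cons by (metis list.set_intros(1))
      have m: "n \<le> m" using nmin rin ab by auto
      obtain as' bs' where ab': "as @ bs = as' @ (r, m) # bs'" using rin by (meson split_list)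
      obtain m' where m': "m = Suc m'" using m n0 by (cases m) auto
      have rr: "polyfunp r" "\<And>x. degree (r x) \<le> m" using ps[of r m] rin ab by auto
      \<comment> \<open>Replacing \<open>r\<close> by its pseudo-remainder keeps the common zeros
        with \<open>p\<close>, as \<open>?c x\<close> is invertible, and lowers the formal degree by
        one.\<close>
      let ?r = "\<lambda>x. smult (?c x) (r x) - monom (coeff (r x) m) (m - n) * p x"
      let ?ps = "(p, n) # as' @ (?r, m') # bs'"
      have e: "set ps = insert (p, n) (insert (r, m) (set (as' @ bs')))"
        using ab ab' by (metis (no_types, lifting) Un_insert_right list.simps(15) set_append)
      have sl: "sum_list (map (Suc \<circ> snd) ps) = Suc n + sum_list (map (Suc \<circ> snd) (as @ bs))"
        unfolding ab by simp
      have *: "?c x \<noteq> 0 \<Longrightarrow> ?P ps x y \<longleftrightarrow> ?P ?ps x y" for x y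
        unfolding e by auto
      have "(\<lambda>x. ?c x \<noteq> 0 \<and> (\<exists>y. ?P ps x y)) = (\<lambda>x. (\<not> ?c x = 0) \<and> (\<exists>y. ?P ?ps x y))"
        by (intro ext aux2 *)
      moreover have "constr (\<lambda>x. \<exists>y. ?P ?ps x y)"
      proof (rule IH)
        show "sum_list (map (Suc \<circ> snd) ?ps) < sum_list (map (Suc \<circ> snd) ps)"
          unfolding sl ab' by (simp add: m')
        have "polyfunp ?r" using rr pp by (intro polyfunp_intros polyfunp_coeff)
        moreover have "degree (?r x) \<le> m'" for x
          using degree_cancel_lead[of "p x" n "r x" m'] pp(2)[of x] rr(2)[of x] m m' by simp
        moreover have "polyfunp p' \<and> (\<forall>x. degree (p' x) \<le> n')"
          if "(p', n') \<in> set (as' @ bs')" for p' n'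
          using ps that e by auto
        ultimately show "polyfunp p' \<and> (\<forall>x. degree (p' x) \<le> n')" if "(p', n') \<in> set ?ps" for p' n'
          using that pp by auto
      qed
      ultimately show ?thesis
        using constr.conj[OF constr.neg[OF constr.zero[OF polyfunp_coeff[OF pp(1)]]]] by (simp only:)
    qed
    have *: "?c x = 0 \<Longrightarrow> ?P ps x y \<longleftrightarrow> ?P (as @ (?p', n - 1) # bs) x y" for x y
      unfolding ab by auto
    have "(\<lambda>x. \<exists>y. ?P ps x y) = (\<lambda>x. (?c x = 0 \<and> (\<exists>y. ?P (as @ (?p', n - 1) # bs) x y))
        \<or> (?c x \<noteq> 0 \<and> (\<exists>y. ?P ps x y)))"
      by (intro ext aux3 *)
    then show ?thesis
      using constr_disj[OF constr.conj[OF constr.zero[OF polyfunp_coeff[OF pp(1)]] c1] c2] by (simp only:)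
  qed
qed

section \<open>Normal forms and elimination of existential quantifiers\<close>

definition dnf :: "((('i \<Rightarrow> complex) \<Rightarrow> complex) list \<times> (('i \<Rightarrow> complex) \<Rightarrow> complex)) list \<Rightarrow> ('i \<Rightarrow> complex) \<Rightarrow> bool" where
  "dnf L x \<longleftrightarrow> (\<exists>(fs, g) \<in> set L. (\<forall>f\<in>set fs. f x = 0) \<and> g x \<noteq> 0)"

definition dnf_ok :: "((('i \<Rightarrow> complex) \<Rightarrow> complex) list \<times> (('i \<Rightarrow> complex) \<Rightarrow> complex)) list \<Rightarrow> bool" where
  "dnf_ok L \<longleftrightarrow> (\<forall>(fs, g) \<in> set L. (\<forall>f\<in>set fs. polyfun f) \<and> polyfun g)"

text \<open>A disjunct carries a single inequation, which suffices because inequations combine by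
  multiplication.\<close>

lemma dnf_conj:
  assumes "dnf_ok L" "dnf_ok M"
  shows "\<exists>N. dnf_ok N \<and> dnf N = (\<lambda>x. dnf L x \<and> dnf M x)"
proof -
  let ?N = "map (\<lambda>((fs, g), (fs', g')). (fs @ fs', \<lambda>x. g x * g' x)) (List.product L M)"
  have "dnf_ok ?N" using assms by (fastforce simp: dnf_ok_def intro: polyfun.intros)
  moreover have "dnf ?N x \<longleftrightarrow> dnf L x \<and> dnf M x" for x
  proof -
    have "dnf ?N x \<longleftrightarrow> (\<exists>b\<in>set L. \<exists>b'\<in>set M. ((\<forall>f\<in>set (fst b). f x = 0) \<and> (\<forall>f\<in>set (fst b'). f x = 0)) \<and>
        snd b x \<noteq> 0 \<and> snd b' x \<noteq> 0)"
      unfolding dnf_def by (simp add: split_beta ball_Un)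
    also have "\<dots> \<longleftrightarrow> dnf L x \<and> dnf M x"
      unfolding dnf_def case_prod_unfold by blast
    finally show ?thesis .
  qed
  ultimately show ?thesis by (intro exI[of _ ?N]) auto
qed

text \<open>The negation of a disjunct is the disjunction of \<open>g = 0\<close> with all
  \<open>f \<noteq> 0\<close>, again in normal form; these are then joined by
  \<open>dnf_conj\<close>.\<close>

lemma dnf_neg:
  assumes "dnf_ok L"
  shows "\<exists>N. dnf_ok N \<and> dnf N = (\<lambda>x. \<not> dnf L x)"
  using assms
proof (induction L)
  case Nil
  show ?case by (rule exI[of _ "[([], \<lambda>_. 1)]"]) (auto simp: dnf_def dnf_ok_def polyfun.const)
next
  case (Cons b L)
  obtain fs g where b: "b = (fs, g)" by force
  have "dnf_ok L" using Cons.prems by (simp add: dnf_ok_def)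
  then obtain N where N: "dnf_ok N" "dnf N = (\<lambda>x. \<not> dnf L x)" using Cons.IH by blast
  let ?M = "([g], \<lambda>_. 1) # map (\<lambda>f. ([], f)) fs"
  have M: "dnf_ok ?M" "dnf ?M = (\<lambda>x. \<not> dnf [b] x)"
    using Cons.prems b by (auto simp: dnf_ok_def dnf_def polyfun.const fun_eq_iff)
  obtain K where "dnf_ok K" "dnf K = (\<lambda>x. dnf ?M x \<and> dnf N x)"
    using dnf_conj[OF M(1) N(1)] by blast
  moreover have "(\<lambda>x. dnf ?M x \<and> dnf N x) = (\<lambda>x. \<not> dnf (b # L) x)"
    unfolding M(2) N(2) by (auto simp: dnf_def)
  ultimately show ?case by metis
qed

lemma constr_imp_dnf: "constr P \<Longrightarrow> \<exists>L. dnf_ok L \<and> dnf L = P"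
proof (induction rule: constr.induct)
  case (zero f)
  show ?case by (rule exI[of _ "[([f], \<lambda>_. 1)]"]) (auto simp: dnf_def dnf_ok_def polyfun.const zero)
next
  case (neg P)
  then show ?case using dnf_neg by blast
next
  case (conj P Q)
  then show ?case using dnf_conj by blast
qed

lemma polyfun_as_poly:
  assumes "polyfun f"
  shows "\<exists>p n. polyfunp p \<and> (\<forall>x. degree (p x) \<le> n) \<and> (\<forall>x y. f (x(i := y)) = poly (p x) y)"
  using assms
proof (induction rule: polyfun.induct)
  case (const c)
  show ?case by (rule exI[of _ "\<lambda>_. [:c:]"], rule exI[of _ 0]) (auto intro: polyfunp_intros)
next
  case (var j)
  show ?case
    by (cases "j = i", rule exI[of _ "\<lambda>_. [:0, 1:]"], rule exI[of _ 1], force intro: polyfunp_intros,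
      rule exI[of _ "\<lambda>x. [:x j:]"], rule exI[of _ 0], auto intro!: polyfunp_intros polyfun_intros)
next
  case (add f g)
  then obtain p n q m where "polyfunp p" "\<forall>x. degree (p x) \<le> n" "\<forall>x y. f (x(i := y)) = poly (p x) y"
    "polyfunp q" "\<forall>x. degree (q x) \<le> m" "\<forall>x y. g (x(i := y)) = poly (q x) y" by blast
  then show ?case
    by (intro exI[of _ "\<lambda>x. p x + q x"] exI[of _ "n + m"])
      (auto intro!: polyfunp_intros degree_add_le intro: trans_le_add1 trans_le_add2 simp del: fun_upd_apply)
next
  case (mult f g)
  then obtain p n q m where "polyfunp p" "\<forall>x. degree (p x) \<le> n" "\<forall>x y. f (x(i := y)) = poly (p x) y"
    "polyfunp q" "\<forall>x. degree (q x) \<le> m" "\<forall>x y. g (x(i := y)) = poly (q x) y" by blast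
  then show ?case
    by (intro exI[of _ "\<lambda>x. p x * q x"] exI[of _ "n + m"])
      (auto intro!: polyfunp_intros degree_mult_le[THEN order_trans] add_mono simp del: fun_upd_apply)
qed

text \<open>Projections of constructible sets are constructible: the quantifier passes through the
  disjunction, and each disjunct asks for a common root outside the zeros of one polynomial.\<close>

lemma constr_ex:
  assumes "constr P"
  shows "constr (\<lambda>x. \<exists>y. P (x(i := y)))"
proof -
  obtain L where L: "dnf_ok L" "dnf L = P" using constr_imp_dnf[OF assms] by blast
  have basic: "constr (\<lambda>x. \<exists>y. (\<forall>f\<in>set fs. f (x(i := y)) = 0) \<and> g (x(i := y)) \<noteq> 0)"
    if fg: "(fs, g) \<in> set L" for fs g
  proof -
    have pf: "\<And>f. f \<in> set fs \<Longrightarrow> polyfun f" "polyfun g" using L(1) fg by (auto simp: dnf_ok_def)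
    obtain q k where q: "polyfunp q" "\<And>x. degree (q x) \<le> k" "\<And>x y. g (x(i := y)) = poly (q x) y"
      using polyfun_as_poly[OF pf(2), of i] by metis
    have "\<forall>f\<in>set fs. \<exists>pn. polyfunp (fst pn) \<and> (\<forall>x. degree (fst pn x) \<le> snd pn) \<and>
        (\<forall>x y. f (x(i := y)) = poly (fst pn x) y)"
      using polyfun_as_poly[OF pf(1), of _ i] by simp
    then obtain c where c: "\<And>f. f \<in> set fs \<Longrightarrow> polyfunp (fst (c f)) \<and>
        (\<forall>x. degree (fst (c f) x) \<le> snd (c f)) \<and> (\<forall>x y. f (x(i := y)) = poly (fst (c f) x) y)"
      by metis
    have "(\<lambda>x. \<exists>y. (\<forall>f\<in>set fs. f (x(i := y)) = 0) \<and> g (x(i := y)) \<noteq> 0) =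
      (\<lambda>x. \<exists>y. (\<forall>(p, n) \<in> set (map c fs). poly (p x) y = 0) \<and> poly (q x) y \<noteq> 0)"
      using c q(3) by (simp add: split_beta del: fun_upd_apply)
    moreover have "constr \<dots>"
    proof (rule constr_common_root[OF q(1,2)])
      fix p n assume "(p, n) \<in> set (map c fs)"
      then obtain f where "f \<in> set fs" "c f = (p, n)" by auto
      then show "polyfunp p \<and> (\<forall>x. degree (p x) \<le> n)" using c by force
    qed
    ultimately show ?thesis by simp
  qed
  have "(\<lambda>x. \<exists>y. P (x(i := y))) = (\<lambda>x. \<exists>b\<in>set L. \<exists>y. (\<forall>f\<in>set (fst b). f (x(i := y)) = 0) \<and> snd b (x(i := y)) \<noteq> 0)"
    unfolding L(2)[symmetric] dnf_def by (auto simp: split_beta)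
  then show ?thesis using basic by (auto intro!: constr_bex)
qed

lemma constr_ex_block:
  assumes "finite J" "constr P"
  shows "constr (\<lambda>x. \<exists>y. P (\<lambda>i. if i \<in> J then y i else x i))"
  using assms(1)
proof (induction J rule: finite_induct)
  case empty
  then show ?case using assms(2) by simp
next
  case (insert j J)
  have "(\<exists>y. P (\<lambda>i. if i \<in> insert j J then y i else x i)) \<longleftrightarrow>
    (\<exists>v y. P (\<lambda>i. if i \<in> J then y i else (x(j := v)) i))" (is "?l \<longleftrightarrow> ?r") for x
  proof
    assume ?l
    then obtain y where y: "P (\<lambda>i. if i \<in> insert j J then y i else x i)" by blast
    have "(\<lambda>i. if i \<in> insert j J then y i else x i) = (\<lambda>i. if i \<in> J then y i else (x(j := y j)) i)"
      by auto
    then show ?r using y by metis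
  next
    assume ?r
    then obtain v y where y: "P (\<lambda>i. if i \<in> J then y i else (x(j := v)) i)" by blast
    have "(\<lambda>i. if i \<in> insert j J then (y(j := v)) i else x i) = (\<lambda>i. if i \<in> J then y i else (x(j := v)) i)"
      using insert.hyps by auto
    then show ?l using y by metis
  qed
  then show ?case using constr_ex[OF insert.IH, of j] by simp
qed

text \<open>Irreducibility of affine space. In the conjunction case both members have constant truth
  value where the product of the two polynomials is nonzero, and such points exist by
  \<open>polyfun_mult_nonzero\<close>.\<close>

lemma constr_generic_dichotomy:
  assumes "constr P"
  shows "\<exists>F. polyfun F \<and> (\<exists>x. F x \<noteq> 0) \<and> ((\<forall>x. F x \<noteq> 0 \<longrightarrow> P x) \<or> (\<forall>x. F x \<noteq> 0 \<longrightarrow> \<not> P x))"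
  using assms
proof (induction rule: constr.induct)
  case (zero f)
  show ?case
  proof (cases "\<exists>x. f x \<noteq> 0")
    case True
    then show ?thesis using zero by blast
  next
    case False
    then show ?thesis by (intro exI[of _ "\<lambda>_. 1"]) (auto intro: polyfun_intros)
  qed
next
  case (neg P)
  then show ?case by blast
next
  case (conj P Q)
  then obtain F G where F: "polyfun F" "\<exists>x. F x \<noteq> 0" "(\<forall>x. F x \<noteq> 0 \<longrightarrow> P x) \<or> (\<forall>x. F x \<noteq> 0 \<longrightarrow> \<not> P x)"
    and G: "polyfun G" "\<exists>x. G x \<noteq> 0" "(\<forall>x. G x \<noteq> 0 \<longrightarrow> Q x) \<or> (\<forall>x. G x \<noteq> 0 \<longrightarrow> \<not> Q x)" by auto
  have "\<exists>x. F x * G x \<noteq> 0" using polyfun_mult_nonzero F G by blast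
  then show ?case using F(1,3) G(1,3)
    by (intro exI[of _ "\<lambda>x. F x * G x"]) (auto intro: polyfun_intros)
qed

section \<open>Polynomial systems near a nondegenerate zero\<close>

type_synonym triple = "complex \<times> complex \<times> complex"

definition proj :: "nat \<Rightarrow> triple \<Rightarrow> complex" where
  "proj k y = (if k = 0 then fst y else if k = 1 then fst (snd y) else snd (snd y))"

text \<open>Indices 0, 1, 2 carry the point \<open>y\<close>, and every further index carries the
  parameter \<open>t\<close>, so polynomial functions of an assignment become functions of
  \<open>(y, t)\<close>.\<close>

definition pt :: "triple \<Rightarrow> complex \<Rightarrow> nat \<Rightarrow> complex" where
  "pt y t = (\<lambda>i. if i < 3 then proj i y else t)"

lemma continuous_on_proj [continuous_intros]:
  "continuous_on A f \<Longrightarrow> continuous_on A (\<lambda>x. proj k (f x))"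
  unfolding proj_def by (cases "k = 0"; cases "k = 1") (auto intro!: continuous_intros)

lemma proj_simps [simp]: "proj 0 (a, b, c) = a" "proj (Suc 0) (a, b, c) = b" "proj 2 (a, b, c) = c"
  by (auto simp: proj_def)

lemma less_3_cases: "k < (3::nat) \<Longrightarrow> k = 0 \<or> k = 1 \<or> k = 2" by linarith

lemma triple_eqI: "(\<And>k. k < 3 \<Longrightarrow> proj k y = proj k y') \<Longrightarrow> y = y'"
proof -
  assume "\<And>k. k < 3 \<Longrightarrow> proj k y = proj k y'"
  from this[of 0] this[of 1] this[of 2] show ?thesis by (auto simp: proj_def prod_eq_iff)
qed

lemma norm_proj_le: "norm (proj k y) \<le> norm y"
proof -
  have "norm (fst y) \<le> norm y" "norm (snd y) \<le> norm y" "norm (fst (snd y)) \<le> norm (snd y)"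
    "norm (snd (snd y)) \<le> norm (snd y)"
    by (metis norm_fst_le norm_snd_le prod.collapse)+
  then show ?thesis unfolding proj_def by auto
qed

lemma norm_triple_le: "norm (y::triple) \<le> (\<Sum>k<3. norm (proj k y))"
proof -
  have "norm y \<le> norm (fst y) + norm (snd y)" by (metis norm_Pair_le prod.collapse)
  also have "norm (snd y) \<le> norm (fst (snd y)) + norm (snd (snd y))" by (metis norm_Pair_le prod.collapse)
  finally show ?thesis by (simp add: proj_def eval_nat_numeral)
qed

lemma proj_diff: "proj k (y - y') = proj k y - proj k y'"
  by (simp add: proj_def)

section \<open>Difference quotients and a contraction principle\<close>

lemma continuous_on_polyfun [continuous_intros]:
  assumes "polyfun f" "continuous_on A g" "continuous_on A h"
  shows "continuous_on A (\<lambda>x. f (pt (g x) (h x)))"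
  using assms(1)
proof (induction rule: polyfun.induct)
  case (var i)
  show ?case using assms unfolding pt_def by (cases "i < 3") (auto intro!: continuous_intros)
qed (auto intro!: continuous_intros)

text \<open>Hadamard's lemma for polynomials: on the diagonal \<open>D l\<close> is the partial
  derivative in direction \<open>l\<close>, and its continuity replaces differential calculus below.
  The product case is the discrete Leibniz rule.\<close>

lemma polyfun_hadamard:
  assumes "polyfun f"
  shows "\<exists>D. (\<forall>l. continuous_on UNIV (D l)) \<and>
    (\<forall>y y' t. f (pt y t) - f (pt y' t) = (\<Sum>l<3. D l (y, y', t) * (proj l y - proj l y')))"
  using assms
proof (induction rule: polyfun.induct)
  case (const c)
  show ?case by (rule exI[of _ "\<lambda>_ _. 0"]) auto
next
  case (var i)
  show ?case
    by (rule exI[of _ "\<lambda>l _. if l = i then 1 else 0"])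
      (auto simp: pt_def if_distrib[of "\<lambda>a. a * _"] cong: if_cong)
next
  case (add f g)
  obtain D where D1: "\<forall>l. continuous_on UNIV (D l)"
    "\<forall>y y' t. f (pt y t) - f (pt y' t) = (\<Sum>l<3. D l (y, y', t) * (proj l y - proj l y'))"
    using add.IH(1) by (elim exE conjE)
  obtain D' where D2: "\<forall>l. continuous_on UNIV (D' l)"
    "\<forall>y y' t. g (pt y t) - g (pt y' t) = (\<Sum>l<3. D' l (y, y', t) * (proj l y - proj l y'))"
    using add.IH(2) by (elim exE conjE)
  note D = D1(1)[rule_format] D2(1)[rule_format] D1(2)[rule_format] D2(2)[rule_format]
  show ?case
  proof (rule exI[of _ "\<lambda>l z. D l z + D' l z"], intro conjI allI)
    show "continuous_on UNIV (\<lambda>z. D l z + D' l z)" for l using D by (intro continuous_intros) auto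
    show "f (pt y t) + g (pt y t) - (f (pt y' t) + g (pt y' t)) =
       (\<Sum>l<3. (D l (y, y', t) + D' l (y, y', t)) * (proj l y - proj l y'))" for y y' t
      unfolding add_diff_add D(3) D(4) sum.distrib[symmetric] by (simp add: distrib_right)
  qed
next
  case (mult f g)
  obtain D where D1: "\<forall>l. continuous_on UNIV (D l)"
    "\<forall>y y' t. f (pt y t) - f (pt y' t) = (\<Sum>l<3. D l (y, y', t) * (proj l y - proj l y'))"
    using mult.IH(1) by (elim exE conjE)
  obtain D' where D2: "\<forall>l. continuous_on UNIV (D' l)"
    "\<forall>y y' t. g (pt y t) - g (pt y' t) = (\<Sum>l<3. D' l (y, y', t) * (proj l y - proj l y'))"
    using mult.IH(2) by (elim exE conjE)
  note D = D1(1)[rule_format] D2(1)[rule_format] D1(2)[rule_format] D2(2)[rule_format]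
  show ?case
  proof (rule exI[of _ "\<lambda>l z. D l z * g (pt (fst z) (snd (snd z))) + f (pt (fst (snd z)) (snd (snd z))) * D' l z"],
      intro conjI allI)
    show "continuous_on UNIV (\<lambda>z. D l z * g (pt (fst z) (snd (snd z))) + f (pt (fst (snd z)) (snd (snd z))) * D' l z)" for l
      using D mult.hyps by (intro continuous_intros) auto
    fix y y' t
    have "f (pt y t) * g (pt y t) - f (pt y' t) * g (pt y' t) =
      (f (pt y t) - f (pt y' t)) * g (pt y t) + f (pt y' t) * (g (pt y t) - g (pt y' t))"
      by (simp add: algebra_simps)
    then show "f (pt y t) * g (pt y t) - f (pt y' t) * g (pt y' t) =
       (\<Sum>l<3. (D l (y, y', t) * g (pt (fst (y, y', t)) (snd (snd (y, y', t)))) +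
          f (pt (fst (snd (y, y', t))) (snd (snd (y, y', t)))) * D' l (y, y', t)) * (proj l y - proj l y'))"
      unfolding D(3) D(4) sum_distrib_left sum_distrib_right sum.distrib[symmetric]
      by (auto intro!: sum.cong simp: algebra_simps)
  qed
qed

lemma continuous_eventually_close:
  assumes f: "continuous_on UNIV (f :: triple \<times> triple \<times> complex \<Rightarrow> complex)" and "e > 0"
  shows "\<exists>r>0. \<forall>y y' t. dist y w < r \<longrightarrow> dist y' w < r \<longrightarrow> cmod t < r \<longrightarrow>
    cmod (f (y, y', t) - f (w, w, 0)) < e"
proof -
  obtain d where d: "d > 0" "\<And>z. dist z (w, w, 0) < d \<Longrightarrow> dist (f z) (f (w, w, 0)) < e"
    using f assms(2) unfolding continuous_on_iff by (metis UNIV_I)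
  show ?thesis
  proof (rule exI[of _ "d / 3"], intro conjI allI impI)
    fix y y' t assume a: "dist y w < d / 3" "dist y' w < d / 3" "cmod t < d / 3"
    have "norm ((y, y', t) - (w, w, 0)) \<le> norm (y - w) + (norm (y' - w) + norm t)"
      using norm_Pair_le[of "y - w" "(y' - w, t)"] norm_Pair_le[of "y' - w" t] by simp
    then have "dist (y, y', t) (w, w, 0) < d" using a by (simp add: dist_norm)
    then show "cmod (f (y, y', t) - f (w, w, 0)) < e" using d by (simp add: dist_norm)
  qed (use d in auto)
qed

text \<open>By \<open>GE\<close> the Jacobian at \<open>w\<close> for \<open>t = 0\<close> is
  diagonal with the nonzero entries \<open>E k (pt w 0)\<close>. The simplified Newton map, which
  divides by these fixed entries, is therefore a contraction near \<open>w\<close> for small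
  \<open>t\<close>. Every radius below \<open>\<epsilon>0\<close> is allowed, so that the balls can
  be shrunk later to separate solutions.\<close>

lemma local_unique_zero:
  fixes G E :: "nat \<Rightarrow> (nat \<Rightarrow> complex) \<Rightarrow> complex" and w :: triple
  assumes G: "\<And>k. k < 3 \<Longrightarrow> polyfun (G k)" and E: "\<And>k. k < 3 \<Longrightarrow> polyfun (E k)"
    and GE: "\<And>k y. k < 3 \<Longrightarrow> G k (pt y 0) = (proj k y - proj k w) * E k (pt y 0)"
    and nz: "\<And>k. k < 3 \<Longrightarrow> E k (pt w 0) \<noteq> 0"
  shows "\<exists>\<epsilon>0>0. \<forall>\<epsilon>. 0 < \<epsilon> \<longrightarrow> \<epsilon> \<le> \<epsilon>0 \<longrightarrow>
    (\<exists>\<delta>>0. \<forall>t. cmod t < \<delta> \<longrightarrow> (\<exists>!y. y \<in> cball w \<epsilon> \<and> (\<forall>k<3. G k (pt y t) = 0)))"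
proof -
  define D where "D k = (SOME D. (\<forall>l. continuous_on UNIV (D l)) \<and>
    (\<forall>y y' t. G k (pt y t) - G k (pt y' t) = (\<Sum>l<3. D l (y, y', t) * (proj l y - proj l y'))))" for k
  have D: "continuous_on UNIV (D k l)"
    "G k (pt y t) - G k (pt y' t) = (\<Sum>l<3. D k l (y, y', t) * (proj l y - proj l y'))"
    if "k < 3" for k l y y' t
    using someI_ex[OF polyfun_hadamard[OF G[OF that]], folded D_def] by blast+
  define e where "e k = E k (pt w 0)" for k
  define u :: "nat \<Rightarrow> complex \<Rightarrow> triple" where
    "u l s = (if l = 0 then (s, 0, 0) else if l = 1 then (0, s, 0) else (0, 0, s))" for l s
  have pu: "proj k (u l s) = (if k = l then s else 0)" if "k < 3" "l < 3" for k l s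
    using less_3_cases[OF that(1)] less_3_cases[OF that(2)] by (auto simp: u_def)
  have pa: "proj k (y + y') = proj k y + proj k y'" for k y y' by (simp add: proj_def)
  \<comment> \<open>Along the \<open>l\<close>-th axis the difference identity can be divided by
    \<open>s\<close>, which determines \<open>D k l\<close> for \<open>s \<noteq> 0\<close>;
    continuity then gives the value at \<open>s = 0\<close>.\<close>
  have Dw: "D k l (w, w, 0) = (if k = l then e k else 0)" if k: "k < 3" and l: "l < 3" for k l
  proof -
    have uc: "continuous_on UNIV (u l)"
      unfolding u_def by (cases "l = 0"; cases "l = 1") (auto intro!: continuous_intros)
    have eq: "D k l (w + u l s, w, 0) = (if k = l then E k (pt (w + u l s) 0) else 0)" if "s \<noteq> 0" for s
    proof -
      have "(\<Sum>m<3. D k m (w + u l s, w, 0) * (proj m (w + u l s) - proj m w)) = D k l (w + u l s, w, 0) * s"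
        using l by (simp add: pa pu if_distrib[of "\<lambda>a. _ * a"] sum.delta cong: if_cong)
      moreover have "G k (pt (w + u l s) 0) - G k (pt w 0) = (if k = l then E k (pt (w + u l s) 0) else 0) * s"
        using GE[OF k, of "w + u l s"] GE[OF k, of w] by (simp add: pa pu k l)
      ultimately show ?thesis using D(2)[OF k, of "w + u l s" 0 w] that by simp
    qed
    have c1: "isCont (\<lambda>s. D k l (w + u l s, w, 0)) 0"
      using continuous_on_compose2[OF D(1)[OF k, of l], of UNIV "\<lambda>s. (w + u l s, w, 0)"] uc
      by (auto intro!: continuous_intros simp: continuous_on_eq_continuous_at)
    have c2: "isCont (\<lambda>s. if k = l then E k (pt (w + u l s) 0) else 0) 0"
      using continuous_on_polyfun[OF E[OF k], of UNIV "\<lambda>s. w + u l s" "\<lambda>_. 0"] uc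
      by (cases "k = l") (auto intro!: continuous_intros simp: continuous_on_eq_continuous_at)
    have u0: "u l 0 = 0" by (auto simp: u_def zero_prod_def)
    have "((\<lambda>s. D k l (w + u l s, w, 0)) \<longlongrightarrow> D k l (w, w, 0)) (at 0)"
      using c1 u0 by (simp add: isCont_def)
    moreover have "((\<lambda>s. D k l (w + u l s, w, 0)) \<longlongrightarrow> (if k = l then e k else 0)) (at 0)"
    proof (rule Lim_transform_eventually)
      show "((\<lambda>s. if k = l then E k (pt (w + u l s) 0) else 0) \<longlongrightarrow> (if k = l then e k else 0)) (at 0)"
        using c2 u0 by (simp add: isCont_def e_def cong: if_cong)
      show "\<forall>\<^sub>F s in at 0. (if k = l then E k (pt (w + u l s) 0) else 0) = D k l (w + u l s, w, 0)"
        using eq by (auto simp: eventually_at_filter)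
    qed
    ultimately show ?thesis using LIM_unique by blast
  qed
  have en: "e k \<noteq> 0" if "k < 3" for k using nz that by (simp add: e_def)
  \<comment> \<open>The constant 18 is 3 * 3 * 2: three terms in each coordinate, three coordinates
    in the bound of the norm, and the contraction factor 1/2.\<close>
  have "\<exists>r>0. \<forall>y y' t. dist y w < r \<longrightarrow> dist y' w < r \<longrightarrow> cmod t < r \<longrightarrow>
      cmod (D k l (y, y', t) - D k l (w, w, 0)) < cmod (e k) / 18" if "k < 3" for k l
    using continuous_eventually_close[OF D(1)[OF that], of "cmod (e k) / 18" w] en[OF that] by auto
  then obtain r where r: "\<And>k l. k < 3 \<Longrightarrow> r k l > 0"
    "\<And>k l y y' t. k < 3 \<Longrightarrow> dist y w < r k l \<Longrightarrow> dist y' w < r k l \<Longrightarrow> cmod t < r k l \<Longrightarrow>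
      cmod (D k l (y, y', t) - D k l (w, w, 0)) < cmod (e k) / 18"
    by metis
  define r0 where "r0 = Min ((\<lambda>(k, l). r k l) ` ({..<3} \<times> {..<3}))"
  have r0: "r0 > 0" unfolding r0_def using r(1) by (subst Min_gr_iff) (auto simp: lessThan_empty_iff)
  have r0': "r0 \<le> r k l" if "k < 3" "l < 3" for k l unfolding r0_def using that by (intro Min_le) auto
  define \<epsilon>0 where "\<epsilon>0 = r0 / 2"
  define P where "P t y = (proj 0 y - G 0 (pt y t) / e 0, proj 1 y - G 1 (pt y t) / e 1,
    proj 2 y - G 2 (pt y t) / e 2)" for t y
  have pP: "proj k (P t y) = proj k y - G k (pt y t) / e k" if "k < 3" for k t y
    using less_3_cases[OF that] by (auto simp: P_def)
  have contr: "dist (P t y) (P t y') \<le> 1 / 2 * dist y y'"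
    if y: "y \<in> cball w \<epsilon>" "y' \<in> cball w \<epsilon>" and t: "cmod t < r0" and "\<epsilon> \<le> \<epsilon>0" for y y' t \<epsilon>
  proof -
    have dy: "dist y w < r0" "dist y' w < r0" using y that(4) r0 by (auto simp: \<epsilon>0_def dist_commute)
    have k1: "cmod (proj k (P t y - P t y')) \<le> 1 / 6 * dist y y'" if k: "k < 3" for k
    proof -
      have "proj k (P t y - P t y') = (proj k y - proj k y') - (G k (pt y t) - G k (pt y' t)) / e k"
        using k by (simp add: proj_diff pP diff_divide_distrib)
      also have "\<dots> = (\<Sum>l<3. (if k = l then 1 else 0) * (proj l y - proj l y')) -
          (\<Sum>l<3. D k l (y, y', t) * (proj l y - proj l y')) / e k"
        unfolding D(2)[OF k] using k by (simp add: if_distrib[of "\<lambda>a. a * _"] sum.delta cong: if_cong)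
      also have "\<dots> = (\<Sum>l<3. ((if k = l then 1 else 0) - D k l (y, y', t) / e k) * (proj l y - proj l y'))"
        unfolding sum_divide_distrib sum_subtractf[symmetric]
        by (intro sum.cong refl) (simp add: left_diff_distrib)
      finally have eq: "proj k (P t y - P t y') =
        (\<Sum>l<3. ((if k = l then 1 else 0) - D k l (y, y', t) / e k) * (proj l y - proj l y'))" .
      have "cmod (proj k (P t y - P t y')) \<le>
        (\<Sum>l<3. cmod (((if k = l then 1 else 0) - D k l (y, y', t) / e k) * (proj l y - proj l y')))"
        unfolding eq by (rule norm_sum)
      also have "\<dots> \<le> (\<Sum>l<(3::nat). 1 / 18 * dist y y')"
      proof (rule sum_mono)
        fix l :: nat assume "l \<in> {..<3}"
        then have l: "l < 3" by simp
        have "(if k = l then 1 else 0) - D k l (y, y', t) / e k = - ((D k l (y, y', t) - D k l (w, w, 0)) / e k)"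
          using en[OF k] by (cases "k = l") (simp_all add: Dw k l diff_divide_distrib)
        then have "cmod ((if k = l then 1 else 0) - D k l (y, y', t) / e k) = cmod (D k l (y, y', t) - D k l (w, w, 0)) / cmod (e k)"
          by (simp add: norm_divide)
        also have "\<dots> \<le> 1 / 18"
          using r(2)[OF k, of y l y' t] dy t r0'[OF k l] en[OF k] by (simp add: divide_simps)
        finally have "cmod ((if k = l then 1 else 0) - D k l (y, y', t) / e k) \<le> 1 / 18" .
        moreover have "cmod (proj l y - proj l y') \<le> dist y y'"
          using norm_proj_le[of l "y - y'"] by (simp add: proj_diff dist_norm)
        ultimately show "cmod (((if k = l then 1 else 0) - D k l (y, y', t) / e k) * (proj l y - proj l y')) \<le> 1 / 18 * dist y y'"
          unfolding norm_mult by (intro mult_mono) auto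
      qed
      finally show ?thesis by simp
    qed
    have "dist (P t y) (P t y') \<le> (\<Sum>k<3. cmod (proj k (P t y - P t y')))"
      unfolding dist_norm by (rule norm_triple_le)
    also have "\<dots> \<le> (\<Sum>k<(3::nat). 1 / 6 * dist y y')" using k1 by (intro sum_mono) auto
    finally show ?thesis by simp
  qed
  show ?thesis
  proof (rule exI[of _ \<epsilon>0], intro conjI allI impI)
    show "\<epsilon>0 > 0" using r0 by (simp add: \<epsilon>0_def)
    fix \<epsilon> :: real assume \<epsilon>: "0 < \<epsilon>" "\<epsilon> \<le> \<epsilon>0"
    \<comment> \<open>Three coordinates moved by less than \<open>\<epsilon> / 6\<close> displace
      the centre by at most \<open>\<epsilon> / 2\<close>; with the contraction factor 1/2 the ball
      is mapped into itself.\<close>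
    have "\<exists>d>0. \<forall>t. cmod t < d \<longrightarrow> cmod (G k (pt w t) / e k) < \<epsilon> / 6" if k: "k < 3" for k
    proof -
      have "isCont (\<lambda>t. G k (pt w t) / e k) 0"
        using continuous_on_polyfun[OF G[OF k], of UNIV "\<lambda>_. w" "\<lambda>t. t"] en[OF k]
        by (auto intro!: continuous_intros simp: continuous_on_eq_continuous_at)
      moreover have "G k (pt w 0) / e k = 0" using GE[OF k, of w] by simp
      ultimately show ?thesis using \<epsilon>(1) unfolding continuous_at_eps_delta
        by (metis diff_zero dist_norm half_gt_zero_iff divide_pos_pos zero_less_numeral)
    qed
    then obtain d where d: "\<And>k. k < 3 \<Longrightarrow> d k > 0"
      "\<And>k t. k < 3 \<Longrightarrow> cmod t < d k \<Longrightarrow> cmod (G k (pt w t) / e k) < \<epsilon> / 6" by metis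
    define \<delta> where "\<delta> = min r0 (Min (d ` {..<3}))"
    have \<delta>: "\<delta> > 0" unfolding \<delta>_def 
    proof -
      have "0 < Min (d ` {..<3})" using d(1) by (subst Min_gr_iff) (auto simp: lessThan_empty_iff)
      then show "min r0 (Min (d ` {..<3})) > 0" using r0 by simp
    qed
    have \<delta>d: "\<delta> \<le> d k" if "k < 3" for k unfolding \<delta>_def using that by (intro min.coboundedI2 Min_le) auto
    show "\<exists>\<delta>>0. \<forall>t. cmod t < \<delta> \<longrightarrow> (\<exists>!y. y \<in> cball w \<epsilon> \<and> (\<forall>k<3. G k (pt y t) = 0))"
    proof (rule exI[of _ \<delta>], intro conjI allI impI \<delta>)
      fix t assume t: "cmod t < \<delta>"
      have tr: "cmod t < r0" using t by (simp add: \<delta>_def)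
      have Pw: "dist (P t w) w \<le> \<epsilon> / 2"
      proof -
        have "dist (P t w) w \<le> (\<Sum>k<3. cmod (proj k (P t w - w)))" unfolding dist_norm by (rule norm_triple_le)
        also have "\<dots> \<le> (\<Sum>k<(3::nat). \<epsilon> / 6)"
          using d(2)[of _ t] \<delta>d t by (intro sum_mono) (force simp: proj_diff pP)
        finally show ?thesis by simp
      qed
      have "\<exists>!y\<in>cball w \<epsilon>. P t y = y"
      proof (rule Banach_fix[where c = "1/2"])
        show "complete (cball w \<epsilon>)" by (simp add: complete_eq_closed)
        show "P t ` cball w \<epsilon> \<subseteq> cball w \<epsilon>"
        proof
          fix z assume "z \<in> P t ` cball w \<epsilon>"
          then obtain y where y: "y \<in> cball w \<epsilon>" "z = P t y" by auto
          have "dist (P t y) w \<le> dist (P t y) (P t w) + dist (P t w) w" by (rule dist_triangle)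
          also have "\<dots> \<le> 1 / 2 * dist y w + \<epsilon> / 2"
            using contr[OF y(1), of w t] tr \<epsilon> Pw by simp
          also have "\<dots> \<le> \<epsilon>" using y(1) by (simp add: dist_commute)
          finally show "z \<in> cball w \<epsilon>" using y by (simp add: dist_commute)
        qed
        show "dist (P t y) (P t y') \<le> 1 / 2 * dist y y'" if "y \<in> cball w \<epsilon>" "y' \<in> cball w \<epsilon>" for y y'
          using contr[OF that tr \<epsilon>(2)] .
      qed (use \<epsilon> in auto)
      moreover have "P t y = y \<longleftrightarrow> (\<forall>k<3. G k (pt y t) = 0)" for y
      proof
        assume "P t y = y"
        then show "\<forall>k<3. G k (pt y t) = 0" using pP en by (metis diff_0_right diff_left_imp_eq divide_eq_0_iff)
      next
        assume "\<forall>k<3. G k (pt y t) = 0"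
        then show "P t y = y" by (intro triple_eqI) (simp add: pP)
      qed
      ultimately show "\<exists>!y. y \<in> cball w \<epsilon> \<and> (\<forall>k<3. G k (pt y t) = 0)" by simp
    qed
  qed
qed

section \<open>Minors and degeneracy of linear systems\<close>

lemma polyfun_det:
  assumes "\<And>i j. i < n \<Longrightarrow> j < n \<Longrightarrow> polyfun (f i j)"
  shows "polyfun (\<lambda>x. Determinant.det (Matrix.mat n n (\<lambda>(i, j). f i j x)))"
proof -
  have "Determinant.det (Matrix.mat n n (\<lambda>(i, j). f i j x)) =
    (\<Sum>p \<in> {p. p permutes {0..<n}}. signof p * (\<Prod>i = 0..<n. f i (p i) x))" for x
    by (subst Determinant.det_def'[of _ n]) (auto intro!: sum.cong prod.cong dest: permutes_in_image)
  then show ?thesis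
    using assms by (auto intro!: polyfun_intros dest: permutes_in_image)
qed

text \<open>\<open>W\<close> is the generalised cross product of the rows, i.e. the vector of signed maximal minors.\<close>

lemma polyfun_cross_product:
  fixes R :: "nat \<Rightarrow> nat \<Rightarrow> ('i \<Rightarrow> complex) \<Rightarrow> complex"
  assumes R: "\<And>r c. r < n \<Longrightarrow> c \<le> n \<Longrightarrow> polyfun (R r c)"
  shows "\<exists>W. (\<forall>c\<le>n. polyfun (W c)) \<and> (\<forall>x b. (\<Sum>c\<le>n. b c * W c x) = 0 \<longleftrightarrow>
    (\<exists>v. (\<exists>c\<le>n. v c \<noteq> 0) \<and> (\<forall>r<n. (\<Sum>c\<le>n. R r c x * v c) = 0) \<and> (\<Sum>c\<le>n. b c * v c) = 0))"
proof -
  define A where "A x b = Matrix.mat (Suc n) (Suc n) (\<lambda>(r, c). if r < n then R r c x else b c)" for x b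
  define W where "W c x = (-1) ^ (n + c) * Determinant.det (Matrix.mat n n (\<lambda>(i, j). R i (if j < c then j else Suc j) x))" for c x
  have AC: "A x b \<in> carrier_mat (Suc n) (Suc n)" for x b by (simp add: A_def)
  have cof: "cofactor (A x b) n c = W c x" if "c \<le> n" for x b c
  proof -
    have "mat_delete (A x b) n c = Matrix.mat n n (\<lambda>(i, j). R i (if j < c then j else Suc j) x)"
      by (rule eq_matI) (use that in \<open>auto simp: mat_delete_def A_def\<close>)
    then show ?thesis by (simp add: cofactor_def W_def)
  qed
  have det: "Determinant.det (A x b) = (\<Sum>c\<le>n. b c * W c x)" for x b
  proof -
    have "Determinant.det (A x b) = (\<Sum>c\<le>n. A x b $$ (n, c) * cofactor (A x b) n c)"
      using laplace_expansion_row[OF AC, of n x b] by (simp add: lessThan_Suc_atMost)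
    also have "\<dots> = (\<Sum>c\<le>n. b c * W c x)"
      by (intro sum.cong refl) (simp add: cof, simp add: A_def)
    finally show ?thesis .
  qed
  have rows: "vec_index (A x b *\<^sub>v v) r = (\<Sum>c\<le>n. (if r < n then R r c x else b c) * (vec_index v c))"
    if "v \<in> carrier_vec (Suc n)" "r \<le> n" for x b v r
    using that by (auto simp: A_def mult_mat_vec_def scalar_prod_def atLeast0LessThan lessThan_Suc_atMost
      simp del: sum.op_ivl_Suc intro!: sum.cong)
  have "(\<Sum>c\<le>n. b c * W c x) = 0 \<longleftrightarrow>
    (\<exists>v. (\<exists>c\<le>n. v c \<noteq> 0) \<and> (\<forall>r<n. (\<Sum>c\<le>n. R r c x * v c) = 0) \<and> (\<Sum>c\<le>n. b c * v c) = 0)" (is "?l \<longleftrightarrow> ?r") for x b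
  proof -
    have "?l \<longleftrightarrow> (\<exists>v. v \<in> carrier_vec (Suc n) \<and> v \<noteq> 0\<^sub>v (Suc n) \<and> A x b *\<^sub>v v = 0\<^sub>v (Suc n))"
      unfolding det[symmetric] by (rule det_0_iff_vec_prod_zero_field[OF AC])
    also have "\<dots> \<longleftrightarrow> ?r"
    proof
      assume "\<exists>v. v \<in> carrier_vec (Suc n) \<and> v \<noteq> 0\<^sub>v (Suc n) \<and> A x b *\<^sub>v v = 0\<^sub>v (Suc n)"
      then obtain v where v: "v \<in> carrier_vec (Suc n)" "v \<noteq> 0\<^sub>v (Suc n)" "A x b *\<^sub>v v = 0\<^sub>v (Suc n)" by blast
      have "vec_index (A x b *\<^sub>v v) r = 0" if "r \<le> n" for r using v(3) that by simp
      then have e: "(\<Sum>c\<le>n. (if r < n then R r c x else b c) * (vec_index v c)) = 0" if "r \<le> n" for r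
        using rows[OF v(1) that] that by metis
      have "\<exists>c\<le>n. vec_index v c \<noteq> 0"
      proof (rule ccontr)
        assume "\<not> ?thesis"
        then have z: "vec_index v c = 0" if "c \<le> n" for c using that by blast
        have "v = 0\<^sub>v (Suc n)"
        proof (rule eq_vecI)
          show "dim_vec v = dim_vec (0\<^sub>v (Suc n) :: complex Matrix.vec)"
            using carrier_vecD[OF v(1)] by simp
          fix i assume "i < dim_vec (0\<^sub>v (Suc n) :: complex Matrix.vec)"
          then show "vec_index v i = vec_index (0\<^sub>v (Suc n)) i" using z[of i] by simp
        qed
        then show False using v(2) by simp
      qed
      moreover have "\<forall>r<n. (\<Sum>c\<le>n. R r c x * (vec_index v c)) = 0" 
      proof (intro allI impI)
        fix r assume "r < n"
        then show "(\<Sum>c\<le>n. R r c x * (vec_index v c)) = 0" using e[of r] by simp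
      qed
      moreover have "(\<Sum>c\<le>n. b c * (vec_index v c)) = 0" using e[of n] by simp
      ultimately show ?r by (intro exI[of _ "\<lambda>c. vec_index v c"]) simp
    next
      assume ?r
      then obtain v where v: "\<exists>c\<le>n. v c \<noteq> 0" "\<forall>r<n. (\<Sum>c\<le>n. R r c x * v c) = 0" "(\<Sum>c\<le>n. b c * v c) = 0" by blast
      let ?v = "Matrix.vec (Suc n) v"
      have "A x b *\<^sub>v ?v = 0\<^sub>v (Suc n)"
      proof (rule eq_vecI)
        fix r assume "r < dim_vec (0\<^sub>v (Suc n) :: complex Matrix.vec)"
        then have r: "r \<le> n" by simp
        have "vec_index (A x b *\<^sub>v ?v) r = (\<Sum>c\<le>n. (if r < n then R r c x else b c) * v c)"
          using rows[of ?v r] r by simp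
        also have "\<dots> = 0" using v(3) v(2)[rule_format, of r] by (cases "r < n") simp_all
        finally show "vec_index (A x b *\<^sub>v ?v) r = vec_index (0\<^sub>v (Suc n)) r" using r by simp
      qed (simp add: A_def)
      moreover have "?v \<noteq> 0\<^sub>v (Suc n)" using v(1) by (metis index_vec index_zero_vec(1) le_imp_less_Suc)
      ultimately show "\<exists>v. v \<in> carrier_vec (Suc n) \<and> v \<noteq> 0\<^sub>v (Suc n) \<and> A x b *\<^sub>v v = 0\<^sub>v (Suc n)"
        by (intro exI[of _ ?v]) simp
    qed
    finally show ?thesis .
  qed
  moreover have "polyfun (W c)" if "c \<le> n" for c
    unfolding W_def using that by (intro polyfun.mult polyfun.const polyfun_det R) auto
  ultimately show ?thesis by blast
qed

text \<open>There are \<open>n + 3\<close> equations in \<open>n + 1\<close> unknowns. Where the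
  \<open>n\<close> rows \<open>R\<close> have rank \<open>n\<close>, their kernel is spanned by the
  vector of maximal minors, and a nonzero solution exists exactly when the three forms
  \<open>\<beta> k\<close> vanish on it. By \<open>\<beta>\<rho>\<close> these values factor at
  \<open>t = 0\<close>, and \<open>nonsing\<close> says that the remaining factors are nonzero at
  \<open>w\<close>.\<close>

lemma local_unique_degeneracy:
  fixes R \<beta> \<rho> :: "nat \<Rightarrow> nat \<Rightarrow> (nat \<Rightarrow> complex) \<Rightarrow> complex" and w :: triple
  assumes R: "\<And>r c. r < n \<Longrightarrow> c \<le> n \<Longrightarrow> polyfun (R r c)"
    and \<beta>: "\<And>k c. k < 3 \<Longrightarrow> c \<le> n \<Longrightarrow> polyfun (\<beta> k c)"
    and \<rho>: "\<And>k c. k < 3 \<Longrightarrow> c \<le> n \<Longrightarrow> polyfun (\<rho> k c)"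
    and \<beta>\<rho>: "\<And>k c y. k < 3 \<Longrightarrow> c \<le> n \<Longrightarrow> \<beta> k c (pt y 0) = (proj k y - proj k w) * \<rho> k c (pt y 0)"
    and nonsing: "\<And>k v. k < 3 \<Longrightarrow> \<forall>r<n. (\<Sum>c\<le>n. R r c (pt w 0) * v c) = 0 \<Longrightarrow>
      (\<Sum>c\<le>n. \<rho> k c (pt w 0) * v c) = 0 \<Longrightarrow> \<forall>c\<le>n. v c = 0"
  shows "\<exists>\<epsilon>0>0. \<forall>\<epsilon>. 0 < \<epsilon> \<longrightarrow> \<epsilon> \<le> \<epsilon>0 \<longrightarrow>
    (\<exists>\<delta>>0. \<forall>t. cmod t < \<delta> \<longrightarrow> (\<exists>!y. y \<in> cball w \<epsilon> \<and>
      (\<exists>v. (\<exists>c\<le>n. v c \<noteq> 0) \<and> (\<forall>r<n. (\<Sum>c\<le>n. R r c (pt y t) * v c) = 0) \<and>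
        (\<forall>k<3. (\<Sum>c\<le>n. \<beta> k c (pt y t) * v c) = 0))))"
proof -
  have "\<exists>W. (\<forall>c\<le>n. polyfun (W c)) \<and> (\<forall>x b. (\<Sum>c\<le>n. b c * W c x) = 0 \<longleftrightarrow>
    (\<exists>v. (\<exists>c\<le>n. v c \<noteq> 0) \<and> (\<forall>r<n. (\<Sum>c\<le>n. R r c x * v c) = 0) \<and> (\<Sum>c\<le>n. b c * v c) = 0))"
    by (rule polyfun_cross_product[OF R])
  then obtain W where W0: "\<forall>c\<le>n. polyfun (W c)"
    "\<forall>x b. (\<Sum>c\<le>n. b c * W c x) = 0 \<longleftrightarrow>
    (\<exists>v. (\<exists>c\<le>n. v c \<noteq> 0) \<and> (\<forall>r<n. (\<Sum>c\<le>n. R r c x * v c) = 0) \<and> (\<Sum>c\<le>n. b c * v c) = 0)"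
    by (elim exE conjE)
  have W: "\<And>c. c \<le> n \<Longrightarrow> polyfun (W c)"
    "\<And>x b. (\<Sum>c\<le>n. b c * W c x) = 0 \<longleftrightarrow>
    (\<exists>v. (\<exists>c\<le>n. v c \<noteq> 0) \<and> (\<forall>r<n. (\<Sum>c\<le>n. R r c x * v c) = 0) \<and> (\<Sum>c\<le>n. b c * v c) = 0)"
    using W0(1) apply blast using W0(2) by (elim allE)
  define G where "G k x = (\<Sum>c\<le>n. \<beta> k c x * W c x)" for k x
  define E where "E k x = (\<Sum>c\<le>n. \<rho> k c x * W c x)" for k x
  have pG: "polyfun (G k)" and pE: "polyfun (E k)" if "k < 3" for k
    unfolding G_def E_def using that by (auto intro!: polyfun_sum polyfun.mult \<beta> \<rho> W)
  have GE: "G k (pt y 0) = (proj k y - proj k w) * E k (pt y 0)" if "k < 3" for k y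
    unfolding G_def E_def sum_distrib_left using that by (intro sum.cong) (auto simp: \<beta>\<rho>)
  have nz: "E k (pt w 0) \<noteq> 0" if "k < 3" for k
    unfolding E_def W(2) using nonsing[OF that] by blast
  obtain \<epsilon>1 where \<epsilon>1: "\<epsilon>1 > 0" "\<And>\<epsilon>. 0 < \<epsilon> \<Longrightarrow> \<epsilon> \<le> \<epsilon>1 \<Longrightarrow>
    (\<exists>\<delta>>0. \<forall>t. cmod t < \<delta> \<longrightarrow> (\<exists>!y. y \<in> cball w \<epsilon> \<and> (\<forall>k<3. G k (pt y t) = 0)))"
    using local_unique_zero[of G E w, OF pG pE GE nz] by blast
  \<comment> \<open>Near \<open>w\<close> the value of \<open>\<rho> 0\<close> on the minors stays
    nonzero, which keeps the kernel of the rows \<open>R\<close> one-dimensional.\<close>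
  obtain r where r: "r > 0" "\<And>y t. dist y w < r \<Longrightarrow> cmod t < r \<Longrightarrow> E 0 (pt y t) \<noteq> 0"
  proof -
    have "continuous_on UNIV (\<lambda>z :: triple \<times> triple \<times> complex. E 0 (pt (fst z) (snd (snd z))))"
      using pE by (intro continuous_intros) auto
    then have "\<exists>r>0. \<forall>y y' t. dist y w < r \<longrightarrow> dist y' w < r \<longrightarrow> cmod t < r \<longrightarrow>
      cmod (E 0 (pt (fst (y, y', t)) (snd (snd (y, y', t)))) - E 0 (pt (fst (w, w, 0::complex)) (snd (snd (w, w, 0::complex))))) < cmod (E 0 (pt w 0))"
      by (rule continuous_eventually_close) (use nz[of 0] in simp)
    then obtain r where r: "r > 0" "\<And>y y' t. dist y w < r \<Longrightarrow> dist y' w < r \<Longrightarrow> cmod t < r \<Longrightarrow>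
      cmod (E 0 (pt y t) - E 0 (pt w 0)) < cmod (E 0 (pt w 0))" unfolding fst_conv snd_conv by blast
    have "E 0 (pt y t) \<noteq> 0" if "dist y w < r" "cmod t < r" for y t using r(2)[OF that(1,1,2)] by auto
    then show ?thesis using r(1) that by blast
  qed
  have iff: "(\<forall>k<3. G k (pt y t) = 0) \<longleftrightarrow> (\<exists>v. (\<exists>c\<le>n. v c \<noteq> 0) \<and>
    (\<forall>r<n. (\<Sum>c\<le>n. R r c (pt y t) * v c) = 0) \<and> (\<forall>k<3. (\<Sum>c\<le>n. \<beta> k c (pt y t) * v c) = 0))" (is "?l \<longleftrightarrow> ?r")
    if "dist y w < r" "cmod t < r" for y t
  proof
    let ?ker = "\<lambda>v. \<forall>r<n. (\<Sum>c\<le>n. R r c (pt y t) * v c) = 0"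
    let ?rho = "\<lambda>v. \<Sum>c\<le>n. \<rho> 0 c (pt y t) * v c"
    assume ?l
    then have "\<forall>k. \<exists>v. k < 3 \<longrightarrow> (\<exists>c\<le>n. v c \<noteq> 0) \<and> ?ker v \<and> (\<Sum>c\<le>n. \<beta> k c (pt y t) * v c) = 0"
      unfolding G_def W(2) by blast
    from choice[OF this] obtain v where "\<forall>k. k < 3 \<longrightarrow>
      (\<exists>c\<le>n. v k c \<noteq> 0) \<and> ?ker (v k) \<and> (\<Sum>c\<le>n. \<beta> k c (pt y t) * v k c) = 0"
      by (elim exE)
    then have v: "\<And>k. k < 3 \<Longrightarrow> \<exists>c\<le>n. v k c \<noteq> 0" "\<And>k. k < 3 \<Longrightarrow> ?ker (v k)"
      "\<And>k. k < 3 \<Longrightarrow> (\<Sum>c\<le>n. \<beta> k c (pt y t) * v k c) = 0" by blast+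
    have zero: "\<forall>c\<le>n. u c = 0" if "?ker u" "?rho u = 0" for u
      using r(2)[of y t] \<open>dist y w < r\<close> \<open>cmod t < r\<close> that unfolding E_def W(2) by blast
    have s: "?rho (v k) \<noteq> 0" if "k < 3" for k using zero[OF v(2)[OF that]] v(1)[OF that] by blast
    \<comment> \<open>Each equation \<open>G k = 0\<close> yields a kernel vector of its own. This
      combination of two of them is also annihilated by \<open>\<rho> 0\<close>, hence zero, so all
      of them are proportional to \<open>v 0\<close>.\<close>
    have par: "\<forall>c\<le>n. ?rho (v k) * v 0 c - ?rho (v 0) * v k c = 0" if k: "k < 3" for k
    proof (rule zero)
      show "?ker (\<lambda>c. ?rho (v k) * v 0 c - ?rho (v 0) * v k c)"
      proof (intro allI impI)
        fix r assume "r < n"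
        have "(\<Sum>c\<le>n. R r c (pt y t) * (?rho (v k) * v 0 c - ?rho (v 0) * v k c)) =
          ?rho (v k) * (\<Sum>c\<le>n. R r c (pt y t) * v 0 c) - ?rho (v 0) * (\<Sum>c\<le>n. R r c (pt y t) * v k c)"
          by (simp add: right_diff_distrib sum_subtractf sum_distrib_left mult.left_commute)
        then show "(\<Sum>c\<le>n. R r c (pt y t) * (?rho (v k) * v 0 c - ?rho (v 0) * v k c)) = 0"
          using v(2)[of 0] v(2)[OF k] \<open>r < n\<close> by simp
      qed
      have "?rho (\<lambda>c. a * v 0 c - b * v k c) = a * ?rho (v 0) - b * ?rho (v k)" for a b
        by (simp add: right_diff_distrib sum_subtractf sum_distrib_left mult.left_commute)
      then show "?rho (\<lambda>c. ?rho (v k) * v 0 c - ?rho (v 0) * v k c) = 0" by simp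
    qed
    have "(\<Sum>c\<le>n. \<beta> k c (pt y t) * v 0 c) = 0" if k: "k < 3" for k
    proof -
      have "?rho (v k) * (\<Sum>c\<le>n. \<beta> k c (pt y t) * v 0 c) = (\<Sum>c\<le>n. \<beta> k c (pt y t) * (?rho (v k) * v 0 c))"
        by (simp add: sum_distrib_left mult.left_commute)
      also have "\<dots> = (\<Sum>c\<le>n. \<beta> k c (pt y t) * (?rho (v 0) * v k c))"
        using par[OF k] by (intro sum.cong) auto
      also have "\<dots> = ?rho (v 0) * (\<Sum>c\<le>n. \<beta> k c (pt y t) * v k c)"
        by (simp add: sum_distrib_left mult.left_commute)
      finally show ?thesis using v(3)[OF k] s[OF k] by simp
    qed
    then show ?r using v(1,2)[of 0] by (intro exI[of _ "v 0"]) auto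
  next
    assume ?r
    then show ?l unfolding G_def W(2) by blast
  qed
  show ?thesis
  proof (rule exI[of _ "min \<epsilon>1 (r / 2)"], intro conjI allI impI)
    fix \<epsilon> :: real assume \<epsilon>: "0 < \<epsilon>" "\<epsilon> \<le> min \<epsilon>1 (r / 2)"
    then obtain \<delta> where \<delta>: "\<delta> > 0" "\<And>t. cmod t < \<delta> \<Longrightarrow> \<exists>!y. y \<in> cball w \<epsilon> \<and> (\<forall>k<3. G k (pt y t) = 0)"
      using \<epsilon>1(2)[of \<epsilon>] by auto
    have ie: "(y \<in> cball w \<epsilon> \<and> (\<forall>k<3. G k (pt y t) = 0)) \<longleftrightarrow> (y \<in> cball w \<epsilon> \<and> (\<exists>v. (\<exists>c\<le>n. v c \<noteq> 0) \<and>
      (\<forall>r<n. (\<Sum>c\<le>n. R r c (pt y t) * v c) = 0) \<and> (\<forall>k<3. (\<Sum>c\<le>n. \<beta> k c (pt y t) * v c) = 0)))"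
      if "cmod t < r" for y t
      using iff[of y t] that \<epsilon> r(1) by (intro conj_cong refl) (auto simp: dist_commute)
    show "\<exists>\<delta>>0. \<forall>t. cmod t < \<delta> \<longrightarrow> (\<exists>!y. y \<in> cball w \<epsilon> \<and> (\<exists>v. (\<exists>c\<le>n. v c \<noteq> 0) \<and>
      (\<forall>r<n. (\<Sum>c\<le>n. R r c (pt y t) * v c) = 0) \<and> (\<forall>k<3. (\<Sum>c\<le>n. \<beta> k c (pt y t) * v c) = 0)))"
    proof (intro exI[of _ "min \<delta> r"] conjI allI impI)
      fix t assume t: "cmod t < min \<delta> r"
      then have "\<exists>!y. y \<in> cball w \<epsilon> \<and> (\<forall>k<3. G k (pt y t) = 0)" using \<delta>(2)[of t] by simp
      moreover have "cmod t < r" using t by simp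
      ultimately show "\<exists>!y. y \<in> cball w \<epsilon> \<and> (\<exists>v. (\<exists>c\<le>n. v c \<noteq> 0) \<and>
        (\<forall>r<n. (\<Sum>c\<le>n. R r c (pt y t) * v c) = 0) \<and> (\<forall>k<3. (\<Sum>c\<le>n. \<beta> k c (pt y t) * v c) = 0))"
        by (simp only: ie)
    qed (use \<delta> r in auto)
  qed (use \<epsilon>1 r in auto)
qed

section \<open>Linear substitutions in binary forms\<close>

text \<open>Undoes the dehomogenisation: a polynomial of degree below \<open>d\<close> stands for a
  form that also vanishes at infinity.\<close>

definition heval :: "nat \<Rightarrow> complex poly \<Rightarrow> complex \<Rightarrow> complex \<Rightarrow> complex" where
  "heval d p s t = (\<Sum>i\<le>d. coeff p i * s ^ i * t ^ (d - i))"

fun mmul :: "mat2 \<Rightarrow> mat2 \<Rightarrow> mat2" where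
  "mmul (a, b, c, e) (a', b', c', e') = (a * a' + b * c', a * b' + b * e', c * a' + e * c', c * b' + e * e')"

lemma mdet_simp [simp]: "mdet (a, b, c, e) = a * e - b * c" by (simp add: mdet_def)

lemma mscale_simp [simp]: "mscale k (a, b, c, e) = (k * a, k * b, k * c, k * e)" by (simp add: mscale_def)

lemma form_act_simp:
  "form_act d (a, b, c, e) p = (\<Sum>i\<le>d. smult (coeff p i) ([:b, a:] ^ i * [:e, c:] ^ (d - i)))"
  by (simp add: form_act_def)

lemma heval_scale: "heval d p (k * s) (k * t) = k ^ d * heval d p s t"
  unfolding heval_def sum_distrib_left
proof (intro sum.cong refl)
  fix i assume "i \<in> {..d}"
  then have "k ^ d = k ^ i * k ^ (d - i)" by (simp flip: power_add)
  then show "coeff p i * (k * s) ^ i * (k * t) ^ (d - i) = k ^ d * (coeff p i * s ^ i * t ^ (d - i))"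
    by (simp add: power_mult_distrib)
qed

lemma heval_1: "degree p \<le> d \<Longrightarrow> heval d p x 1 = poly p x"
  unfolding heval_def poly_altdef by (simp, intro sum.mono_neutral_right) (auto simp: coeff_eq_0)

lemma heval_nonzero: "degree p \<le> d \<Longrightarrow> t \<noteq> 0 \<Longrightarrow> heval d p s t = t ^ d * poly p (s / t)"
  using heval_scale[of d p t "s / t" 1] by (simp add: heval_1)

lemma poly_form_act: "poly (form_act d (a, b, c, e) p) x = heval d p (a * x + b) (c * x + e)"
  unfolding form_act_simp heval_def by (simp add: poly_sum algebra_simps)

lemma degree_form_act: "degree (form_act d m p) \<le> d"
proof -
  obtain a b c e where m: "m = (a, b, c, e)" by (cases m)
  have "degree (smult (coeff p i) ([:b, a:] ^ i * [:e, c:] ^ (d - i))) \<le> d" if "i \<le> d" for i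
  proof -
    have "degree ([:b, a:] ^ i) \<le> 1 * i" "degree ([:e, c:] ^ (d - i)) \<le> 1 * (d - i)"
      by (rule order_trans[OF degree_power_le], rule mult_le_mono1, simp)+
    then have "degree ([:b, a:] ^ i * [:e, c:] ^ (d - i)) \<le> d"
      using degree_mult_le[of "[:b, a:] ^ i" "[:e, c:] ^ (d - i)"] that by linarith
    then show ?thesis using degree_smult_le order_trans by blast
  qed
  then show ?thesis unfolding m form_act_simp by (intro degree_sum_le) auto
qed

lemma form_act_add: "form_act d m (p + q) = form_act d m p + form_act d m q"
  by (cases m) (simp add: form_act_simp smult_add_left sum.distrib)

lemma form_act_smult: "form_act d m (smult k p) = smult k (form_act d m p)"
proof -
  obtain a b c e where m: "m = (a, b, c, e)" by (cases m)
  have "smult k (\<Sum>i\<in>A. f i) = (\<Sum>i\<in>A. smult k (f i))" for A and f :: "nat \<Rightarrow> complex poly"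
    by (induction A rule: infinite_finite_induct) (simp_all add: smult_add_right)
  then show ?thesis unfolding m form_act_simp by simp
qed

lemma form_act_0: "form_act d m 0 = 0"
  by (cases m) (simp add: form_act_simp)

lemma form_act_sum: "form_act d m (\<Sum>i\<in>A. f i) = (\<Sum>i\<in>A. form_act d m (f i))"
  by (induction A rule: infinite_finite_induct) (simp_all add: form_act_add form_act_0)

text \<open>Identities between transformed forms can thus be checked away from the zero of
  \<open>c * x + e\<close>, where one may divide by the denominator.\<close>

lemma poly_eq_cofinite:
  assumes "c \<noteq> 0 \<or> e \<noteq> 0" "\<And>x. c * x + e \<noteq> 0 \<Longrightarrow> poly p x = poly q x"
  shows "p = (q :: complex poly)"
proof (rule ccontr)
  assume "p \<noteq> q"
  then have "finite {x. poly (p - q) x = 0}" by (intro poly_roots_finite) simp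
  moreover have "[:e, c:] \<noteq> 0" using assms(1) by auto
  then have "finite {x. poly [:e, c:] x = 0}" by (rule poly_roots_finite)
  ultimately have "finite ({x. poly (p - q) x = 0} \<union> {x. poly [:e, c:] x = 0})" by simp
  moreover have "{x. poly (p - q) x = 0} \<union> {x. poly [:e, c:] x = 0} = UNIV"
    using assms(2) by (auto simp: algebra_simps)
  ultimately show False using infinite_UNIV_char_0 by metis
qed

text \<open>Substitution is composition on the inside, so the matrix product appears in reversed
  order.\<close>

lemma form_act_mmul:
  assumes "mdet m \<noteq> 0" "degree p \<le> d"
  shows "form_act d m (form_act d m' p) = form_act d (mmul m' m) p"
proof -
  obtain a b c e where m: "m = (a, b, c, e)" by (cases m)
  obtain a' b' c' e' where m': "m' = (a', b', c', e')" by (cases m')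
  show ?thesis unfolding m m'
  proof (rule poly_eq_cofinite[of c e])
    show "c \<noteq> 0 \<or> e \<noteq> 0" using assms m by auto
    fix x assume nz: "c * x + e \<noteq> 0"
    let ?t = "c * x + e" and ?s = "a * x + b"
    have aux: "?t * (u * (?s / ?t) + v) = u * ?s + v * ?t" for u v
    proof -
      have "?t * (u * (?s / ?t) + v) = u * (?t * (?s / ?t)) + v * ?t" by (simp only: algebra_simps)
      also have "?t * (?s / ?t) = ?s" using nz by (rule nonzero_mult_div_cancel_left[of ?t ?s, unfolded times_divide_eq_right[symmetric]])
      finally show ?thesis .
    qed
    have "poly (form_act d (a, b, c, e) (form_act d (a', b', c', e') p)) x =
      ?t ^ d * heval d p (a' * (?s / ?t) + b') (c' * (?s / ?t) + e')"
      using nz by (simp add: poly_form_act heval_nonzero degree_form_act)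
    also have "\<dots> = heval d p (?t * (a' * (?s / ?t) + b')) (?t * (c' * (?s / ?t) + e'))"
      by (rule heval_scale[symmetric])
    also have "?t * (a' * (?s / ?t) + b') = (a' * a + b' * c) * x + (a' * b + b' * e)"
      unfolding aux by (simp add: algebra_simps)
    also have "?t * (c' * (?s / ?t) + e') = (c' * a + e' * c) * x + (c' * b + e' * e)"
      unfolding aux by (simp add: algebra_simps)
    finally show "poly (form_act d (a, b, c, e) (form_act d (a', b', c', e') p)) x =
      poly (form_act d (mmul (a', b', c', e') (a, b, c, e)) p) x"
      by (simp add: poly_form_act)
  qed
qed

lemma form_act_mult:
  assumes "mdet m \<noteq> 0" "degree p \<le> n" "degree q \<le> k"
  shows "form_act (n + k) m (p * q) = form_act n m p * form_act k m q"
proof -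
  obtain a b c e where m: "m = (a, b, c, e)" by (cases m)
  have d: "degree (p * q) \<le> n + k" using assms(2,3) degree_mult_le[of p q] by linarith
  show ?thesis unfolding m
  proof (rule poly_eq_cofinite[of c e])
    show "c \<noteq> 0 \<or> e \<noteq> 0" using assms m by auto
    fix x assume nz: "c * x + e \<noteq> 0"
    show "poly (form_act (n + k) (a, b, c, e) (p * q)) x = poly (form_act n (a, b, c, e) p * form_act k (a, b, c, e) q) x"
      using nz assms(2,3) d by (simp add: poly_form_act heval_nonzero power_add)
  qed
qed

lemma form_act_mscale: "form_act d (mscale k m) p = smult (k ^ d) (form_act d m p)"
proof -
  obtain a b c e where m: "m = (a, b, c, e)" by (cases m)
  have "poly (form_act d (mscale k m) p) x = poly (smult (k ^ d) (form_act d m p)) x" for x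
    using heval_scale[of d p k "a * x + b" "c * x + e"] by (simp add: m poly_form_act distrib_left mult.assoc)
  then show ?thesis by (metis poly_eqI poly_eq_poly_eq_iff ext)
qed

lemma form_act_id: "degree p \<le> d \<Longrightarrow> form_act d (1, 0, 0, 1) p = p"
  by (rule poly_eq_cofinite[of 0 1]) (simp_all add: poly_form_act heval_1)

text \<open>The adjugate: an inverse up to the scalar \<open>mdet m\<close>, free of division. For
  invertible \<open>m\<close> the scalar does not change the class in PGL(2).\<close>

definition madj :: "mat2 \<Rightarrow> mat2" where
  "madj m = (case m of (a, b, c, e) \<Rightarrow> (e, - b, - c, a))"

lemma madj_simp [simp]: "madj (a, b, c, e) = (e, - b, - c, a)" by (simp add: madj_def)

lemma mdet_madj [simp]: "mdet (madj m) = mdet m" by (cases m) simp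

lemma mmul_madj: "mmul m (madj m) = mscale (mdet m) (1, 0, 0, 1)" "mmul (madj m) m = mscale (mdet m) (1, 0, 0, 1)"
  by (cases m, simp add: algebra_simps)+

lemma mdet_mscale: "mdet (mscale k m) = k ^ 2 * mdet m"
  by (cases m) (simp add: power2_eq_square algebra_simps)

lemma mdet_mmul: "mdet (mmul m m') = mdet m * mdet m'"
  by (cases m; cases m') (simp add: algebra_simps)

lemma form_act_madj:
  assumes "mdet m \<noteq> 0" "degree p \<le> d"
  shows "form_act d (madj m) (form_act d m p) = smult (mdet m ^ d) p"
  using assms by (simp add: form_act_mmul mmul_madj form_act_mscale form_act_id del: mscale_simp)

lemma form_act_eq_0_iff:
  assumes "mdet m \<noteq> 0" "degree p \<le> d"
  shows "form_act d m p = 0 \<longleftrightarrow> p = 0"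
  using form_act_madj[OF assms] assms(1) by (auto simp: form_act_0)

text \<open>A root \<open>f i\<close> contributes \<open>(a * x + b) - f i * (c * x + e)\<close>,
  which is constant exactly when the matrix maps infinity to that root.\<close>

lemma form_act_prod_roots:
  assumes "mdet (a, b, c, e) \<noteq> 0"
  shows "form_act n (a, b, c, e) (\<Prod>i<n. [:- f i, 1:]) = (\<Prod>i<n. [:b - f i * e, a - f i * c:])"
proof (induction n)
  case 0
  show ?case by (simp add: form_act_simp)
next
  case (Suc n)
  have "degree (\<Prod>i<n. [:- f i, 1:]) \<le> n"
    using degree_prod_sum_le[of "{..<n}" "\<lambda>i. [:- f i, 1:]"] by simp
  moreover have "form_act 1 (a, b, c, e) [:- f n, 1:] = [:b - f n * e, a - f n * c:]"
    by (simp add: form_act_simp)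
  ultimately show ?case
    using form_act_mult[OF assms, of "\<Prod>i<n. [:- f i, 1:]" n "[:- f n, 1:]" 1] Suc by simp
qed

lemma degree_prod_roots: "degree (\<Prod>i<n. [:- f i, 1:] :: complex poly) = n"
  by (subst degree_prod_eq_sum_degree) auto

lemma poly_prod_roots: "poly (\<Prod>i<n. [:- f i, 1:]) x = (\<Prod>i<n. x - f i :: complex)"
  by (simp add: poly_prod)

lemma polyfunp_form_act:
  assumes "polyfun a" "polyfun b" "polyfun c" "polyfun e" "\<And>i. i \<le> d \<Longrightarrow> polyfun (\<lambda>x. coeff (P x) i)"
  shows "polyfunp (\<lambda>x. form_act d (a x, b x, c x, e x) (P x))"
  unfolding form_act_simp
  by (intro polyfunp_sum polyfunp_smult polyfunp_mult polyfunp_power polyfunp_pCons polyfunp_const assms) auto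

lemma tendsto_polyfun:
  assumes "polyfun f" "\<And>i. ((\<lambda>n. X n i) \<longlongrightarrow> x i) F"
  shows "((\<lambda>n. f (X n)) \<longlongrightarrow> f x) F"
  using assms(1) by (induction rule: polyfun.induct) (auto intro!: tendsto_intros assms)

lemma tendsto_form_act:
  assumes "(a \<longlongrightarrow> a') F" "(b \<longlongrightarrow> b') F" "(c \<longlongrightarrow> c') F" "(e \<longlongrightarrow> e') F"
    and "\<And>i. ((\<lambda>n. coeff (P n) i) \<longlongrightarrow> coeff P' i) F"
  shows "((\<lambda>n. coeff (form_act d (a n, b n, c n, e n) (P n)) k) \<longlongrightarrow> coeff (form_act d (a', b', c', e') P') k) F"
proof -
  \<comment> \<open>All data are packed into one assignment, matrix entries at 0 to 3 and
    coefficients from 4 on, so that continuity of a single polynomial function suffices.\<close>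
  define X where "X a b c e P i = (if i = 0 then a else if i = 1 then b else if i = 2 then c else if i = 3 then e else coeff P (i - 4))"
    for a b c e :: complex and P :: "complex poly" and i :: nat
  define f where "f x = coeff (form_act d (x 0, x 1, x 2, x 3) (\<Sum>i\<le>d. monom (x (4 + i)) i)) k" for x :: "nat \<Rightarrow> complex"
  have "polyfun f" unfolding f_def
    by (intro polyfunp_coeff polyfunp_form_act polyfun.var polyfunp_sum polyfunp_monom)
  moreover have "((\<lambda>n. X (a n) (b n) (c n) (e n) (P n) i) \<longlongrightarrow> X a' b' c' e' P' i) F" for i
    unfolding X_def using assms by auto
  ultimately have "((\<lambda>n. f (X (a n) (b n) (c n) (e n) (P n))) \<longlongrightarrow> f (X a' b' c' e' P')) F"
    by (rule tendsto_polyfun)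
  moreover have "f (X a b c e P) = coeff (form_act d (a, b, c, e) P) k" for a b c e P
    unfolding f_def X_def form_act_simp by (simp add: coeff_sum sum.delta' cong: if_cong)
  ultimately show ?thesis by simp
qed

section \<open>Representatives of elements of PGL(2)\<close>

lemma pgl_class_mscale: "k \<noteq> 0 \<Longrightarrow> pgl_class (mscale k m) = pgl_class m"
proof -
  assume k: "k \<noteq> 0"
  have s: "mscale a (mscale b m) = mscale (a * b) m" for a b by (cases m) (simp add: mult.assoc)
  show ?thesis
  proof (rule Set.set_eqI)
    fix x
    have "x \<in> pgl_class (mscale k m) \<longleftrightarrow> (\<exists>j. x = mscale (j * k) m \<and> j \<noteq> 0)"
      by (auto simp: pgl_class_def s)
    also have "\<dots> \<longleftrightarrow> (\<exists>j. x = mscale j m \<and> j \<noteq> 0)"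
      using k by (metis mult_eq_0_iff nonzero_divide_eq_eq)
    finally show "x \<in> pgl_class (mscale k m) \<longleftrightarrow> x \<in> pgl_class m" by (simp add: pgl_class_def)
  qed
qed

lemma pgl_class_self: "m \<in> pgl_class m"
proof -
  have "m = mscale 1 m" by (cases m) simp
  then show ?thesis unfolding pgl_class_def by (metis (mono_tags, lifting) mem_Collect_eq zero_neq_one)
qed

lemma pgl_class_eq_iff: "pgl_class m = pgl_class m' \<longleftrightarrow> (\<exists>k. k \<noteq> 0 \<and> m' = mscale k m)"
proof
  assume "pgl_class m = pgl_class m'"
  then have "m' \<in> pgl_class m" using pgl_class_self by blast
  then show "\<exists>k. k \<noteq> 0 \<and> m' = mscale k m" by (auto simp: pgl_class_def)
next
  assume "\<exists>k. k \<noteq> 0 \<and> m' = mscale k m"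
  then show "pgl_class m = pgl_class m'" using pgl_class_mscale by metis
qed

lemma PGL2_memD: "\<sigma> \<in> PGL2 \<Longrightarrow> m \<in> \<sigma> \<Longrightarrow> mdet m \<noteq> 0 \<and> \<sigma> = pgl_class m"
proof -
  assume s: "\<sigma> \<in> PGL2" and m: "m \<in> \<sigma>"
  obtain m0 where m0: "mdet m0 \<noteq> 0" "\<sigma> = pgl_class m0" using s by (auto simp: PGL2_def)
  then obtain k where k: "k \<noteq> 0" "m = mscale k m0" using m by (auto simp: pgl_class_def)
  then show ?thesis using m0 pgl_class_mscale[of k m0] by (simp add: mdet_mscale)
qed

text \<open>The six 2 x 2 minors of the matrix whose rows are the entries of \<open>m\<close> and
  \<open>m'\<close>. Equality in PGL(2) thereby becomes polynomial, which serves both the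
  topological separation of classes and quantifier elimination.\<close>

definition mprop :: "mat2 \<Rightarrow> mat2 \<Rightarrow> bool" where
  "mprop m m' = (case (m, m') of ((a, b, c, e), (a', b', c', e')) \<Rightarrow>
    a * b' = b * a' \<and> a * c' = c * a' \<and> a * e' = e * a' \<and> b * c' = c * b' \<and> b * e' = e * b' \<and> c * e' = e * c')"

lemma mprop_iff:
  assumes "mdet m \<noteq> 0" "mdet m' \<noteq> 0"
  shows "pgl_class m = pgl_class m' \<longleftrightarrow> mprop m m'"
proof -
  obtain a b c e where m: "m = (a, b, c, e)" by (cases m)
  obtain a' b' c' e' where m': "m' = (a', b', c', e')" by (cases m')
  show ?thesis
  proof
    assume "pgl_class m = pgl_class m'"
    then show "mprop m m'" unfolding pgl_class_eq_iff by (auto simp: m m' mprop_def)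
  next
    assume p: "mprop m m'"
    show "pgl_class m = pgl_class m'" unfolding pgl_class_eq_iff
    proof (cases "a = 0")
      case True
      then have b: "b \<noteq> 0" using assms m by auto
      have e: "m' = mscale (b' / b) m" using p b True
        by (auto simp: mprop_def m m' field_simps)
      then have "b' / b \<noteq> 0" using assms(2) by (auto simp: mdet_mscale)
      then show "\<exists>k. k \<noteq> 0 \<and> m' = mscale k m" using e by blast
    next
      case False
      have e: "m' = mscale (a' / a) m" using p False
        by (auto simp: mprop_def m m' field_simps)
      then have "a' / a \<noteq> 0" using assms(2) by (auto simp: mdet_mscale)
      then show "\<exists>k. k \<noteq> 0 \<and> m' = mscale k m" using e by blast
    qed
  qed
qed

section \<open>Points in special position\<close>

text \<open>Real numbers: a Moebius map carries them into one circle or line, and four points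
  \<open>wp j\<close> on a common circle or line do not exist.\<close>

definition zp :: "nat \<Rightarrow> complex" where "zp i = of_nat i"

text \<open>Points on the parabola \<open>Im w = (Re w)\<^sup>2\<close> with positive real part: no four of them lie on a circle or line,
  since the sum of the abscissae of the intersection of a circle with the parabola vanishes.\<close>

definition wp :: "nat \<Rightarrow> complex" where "wp j = Complex (real j + 1) ((real j + 1) ^ 2)"

text \<open>The Moebius map of \<open>m\<close> sends \<open>zp i\<close> to \<open>wp j\<close>,
  with the denominator cleared.\<close>

definition matched :: "mat2 \<Rightarrow> nat \<Rightarrow> nat \<Rightarrow> bool" where
  "matched m i j \<longleftrightarrow> (case m of (a, b, c, e) \<Rightarrow> a * zp i + b = wp j * (c * zp i + e))"

lemma zp_inj: "zp i = zp j \<longleftrightarrow> i = j" by (simp add: zp_def)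

lemma wp_inj: "wp i = wp j \<longleftrightarrow> i = j" by (auto simp: wp_def)

lemma matched_simp: "matched (a, b, c, e) i j \<longleftrightarrow> a * zp i + b = wp j * (c * zp i + e)"
  by (simp add: matched_def)

lemma matched_denominator:
  assumes "mdet (a, b, c, e) \<noteq> 0" "matched (a, b, c, e) i j"
  shows "c * zp i + e \<noteq> 0"
proof
  assume z: "c * zp i + e = 0"
  then have "a * zp i + b = 0" using assms(2) by (simp add: matched_simp)
  moreover have "a * e - b * c = a * (c * zp i + e) - c * (a * zp i + b)" by (simp add: algebra_simps)
  ultimately show False using assms(1) z by simp
qed

lemma matched_fun: "mdet m \<noteq> 0 \<Longrightarrow> matched m i j \<Longrightarrow> matched m i j' \<Longrightarrow> j = j'"
proof (cases m)
  case (fields a b c e)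
  assume "mdet m \<noteq> 0" "matched m i j" "matched m i j'"
  then show ?thesis using matched_denominator[of a b c e i j] fields
    by (auto simp: matched_simp wp_inj)
qed

lemma matched_inj:
  assumes "mdet m \<noteq> 0" "matched m i j" "matched m i' j"
  shows "i = i'"
proof (rule ccontr)
  obtain a b c e where m: "m = (a, b, c, e)" by (cases m)
  assume "i \<noteq> i'"
  then have ne: "zp i - zp i' \<noteq> 0" by (simp add: zp_inj)
  have e1: "a * zp i + b = wp j * (c * zp i + e)" "a * zp i' + b = wp j * (c * zp i' + e)"
    using assms m by (auto simp: matched_simp)
  have "(a - wp j * c) * (zp i - zp i') = (a * zp i + b - wp j * (c * zp i + e)) - (a * zp i' + b - wp j * (c * zp i' + e))"
    by (simp add: algebra_simps)
  also have "\<dots> = 0" using e1 by simp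
  finally have a: "a = wp j * c" using ne by simp
  have "b = wp j * e" using e1(1) a by (simp add: algebra_simps)
  then show False using assms(1) m a by (simp add: algebra_simps)
qed

text \<open>The four roots of a quartic without cubic term have sum 0, which is impossible for
  positive roots. Divided differences yield this without factoring and without presupposing that the
  degree is 4.\<close>

lemma quartic_no_cubic_term:
  fixes x1 x2 x3 x4 c4 c2 c1 c0 :: real
  assumes eq: "\<And>x. x \<in> {x1, x2, x3, x4} \<Longrightarrow> c4 * x^4 + c2 * x^2 + c1 * x + c0 = 0"
    and d: "x1 \<noteq> x2" "x1 \<noteq> x3" "x1 \<noteq> x4" "x2 \<noteq> x3" "x2 \<noteq> x4" "x3 \<noteq> x4"
    and p: "x1 > 0" "x2 > 0" "x3 > 0" "x4 > 0"
  shows "c4 = 0 \<and> c2 = 0 \<and> c1 = 0 \<and> c0 = 0"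
proof -
  have two: "c4 * (x^3 + x^2*y + x*y^2 + y^3) + c2 * (x + y) + c1 = 0"
    if "x \<in> {x1, x2, x3, x4}" "y \<in> {x1, x2, x3, x4}" "x \<noteq> y" for x y
  proof -
    have "(x - y) * (c4 * (x^3 + x^2*y + x*y^2 + y^3) + c2 * (x + y) + c1) =
      (c4 * x^4 + c2 * x^2 + c1 * x + c0) - (c4 * y^4 + c2 * y^2 + c1 * y + c0)"
      by (simp add: algebra_simps power2_eq_square power3_eq_cube power4_eq_xxxx)
    then show ?thesis using eq[OF that(1)] eq[OF that(2)] that(3) by simp
  qed
  have three: "c4 * (x1^2 + x2^2 + y^2 + x1*x2 + x1*y + x2*y) + c2 = 0" if "y \<in> {x3, x4}" for y
  proof -
    have "x2 \<noteq> y" "x1 \<noteq> y" using that d by auto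
    have "(x2 - y) * (c4 * (x1^2 + x2^2 + y^2 + x1*x2 + x1*y + x2*y) + c2) =
      (c4 * (x1^3 + x1^2*x2 + x1*x2^2 + x2^3) + c2 * (x1 + x2) + c1) - (c4 * (x1^3 + x1^2*y + x1*y^2 + y^3) + c2 * (x1 + y) + c1)"
      by (simp add: algebra_simps power2_eq_square power3_eq_cube)
    also have "\<dots> = 0"
    proof -
      have m: "x1 \<in> {x1, x2, x3, x4}" "x2 \<in> {x1, x2, x3, x4}" "y \<in> {x1, x2, x3, x4}" using that by auto
      show ?thesis unfolding two[OF m(1,2) d(1)] two[OF m(1,3) \<open>x1 \<noteq> y\<close>] by simp
    qed
    finally show ?thesis using \<open>x2 \<noteq> y\<close> by simp
  qed
  \<comment> \<open>The third divided difference leaves only \<open>c4\<close> times the sum of the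
    roots.\<close>
  have "(x3 - x4) * (c4 * (x1 + x2 + x3 + x4)) =
    (c4 * (x1^2 + x2^2 + x3^2 + x1*x2 + x1*x3 + x2*x3) + c2) - (c4 * (x1^2 + x2^2 + x4^2 + x1*x2 + x1*x4 + x2*x4) + c2)"
    by (simp add: algebra_simps power2_eq_square)
  then have "c4 * (x1 + x2 + x3 + x4) = 0" using three[of x3] three[of x4] d by simp
  then have c4: "c4 = 0" using p by simp
  then have c2: "c2 = 0" using three[of x3] by simp
  then have c1: "c1 = 0" using two[of x1 x2] c4 d by simp
  then show ?thesis using eq[of x1] c4 c2 by simp
qed

text \<open>The preimage \<open>(w * e - b) / (a - w * c)\<close> of each matched point is real. For
  \<open>w\<close> on the parabola this is a quartic equation without cubic term in the abscissa of
  \<open>w\<close>. Four solutions make all its coefficients vanish, and that forces determinant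
  0.\<close>

lemma no_four_matched:
  assumes det: "mdet m \<noteq> 0" and m: "matched m i1 j1" "matched m i2 j2" "matched m i3 j3" "matched m i4 j4"
    and d: "i1 \<noteq> i2" "i1 \<noteq> i3" "i1 \<noteq> i4" "i2 \<noteq> i3" "i2 \<noteq> i4" "i3 \<noteq> i4"
  shows False
proof -
  obtain a b c e where me: "m = (a, b, c, e)" by (cases m)
  have dj: "j1 \<noteq> j2" "j1 \<noteq> j3" "j1 \<noteq> j4" "j2 \<noteq> j3" "j2 \<noteq> j4" "j3 \<noteq> j4"
    using matched_inj[OF det] m d by metis+
  define A where "A = e * cnj a"
  define B where "B = b * cnj c"
  have Q: "- Im (e * cnj c) * x^4 + (Re A - Re B - Im (e * cnj c)) * x^2 + (Im A + Im B) * x + - Im (b * cnj a) = 0"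
    if mt: "matched m i j" and x: "x = real j + 1" for i j x
  proof -
    define w where "w = wp j"
    have w: "Re w = x" "Im w = x^2" by (simp_all add: w_def wp_def x)
    have "zp i * (a - w * c) = w * e - b" using mt me by (simp add: matched_simp w_def algebra_simps)
    then have "(w * e - b) * cnj (a - w * c) = of_real (real i) * ((a - w * c) * cnj (a - w * c))"
      by (simp only: zp_def of_real_of_nat_eq mult.assoc[symmetric])
    then have "(w * e - b) * cnj (a - w * c) = of_real (real i * (cmod (a - w * c))\<^sup>2)"
      by (simp only: complex_norm_square[symmetric] of_real_mult)
    then have "Im ((w * e - b) * cnj (a - w * c)) = 0" by (simp only: Im_complex_of_real)
    moreover have "Im ((w * e - b) * cnj (a - w * c)) =
      - Im (e * cnj c) * x^4 + (Re A - Re B - Im (e * cnj c)) * x^2 + (Im A + Im B) * x + - Im (b * cnj a)"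
      by (simp add: A_def B_def w algebra_simps power2_eq_square power4_eq_xxxx)
    ultimately show ?thesis by simp
  qed
  have "- Im (e * cnj c) = 0 \<and> Re A - Re B - Im (e * cnj c) = 0 \<and> Im A + Im B = 0 \<and> - Im (b * cnj a) = 0"
  proof (rule quartic_no_cubic_term[of "real j1 + 1" "real j2 + 1" "real j3 + 1" "real j4 + 1"])
    fix x assume "x \<in> {real j1 + 1, real j2 + 1, real j3 + 1, real j4 + 1}"
    then consider "x = real j1 + 1" | "x = real j2 + 1" | "x = real j3 + 1" | "x = real j4 + 1" by blast
    then show "- Im (e * cnj c) * x^4 + (Re A - Re B - Im (e * cnj c)) * x^2 + (Im A + Im B) * x + - Im (b * cnj a) = 0"
      using Q m by cases blast+
  qed (use dj in auto)
  then have c0: "Re A = Re B" "Im A = - Im B" "Im (b * cnj a) = 0" by auto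
  have AB: "e * cnj a = cnj b * c"
    using c0(1,2) unfolding A_def B_def by (simp add: complex_eq_iff algebra_simps)
  have ba: "cnj b * a = b * cnj a" using c0(3) by (simp add: complex_eq_iff algebra_simps)
  \<comment> \<open>The vanishing coefficients amount to \<open>e * cnj a = cnj b * c\<close>
    together with reality of \<open>b * cnj a\<close>; from these the determinant is
    eliminated.\<close>
  have "cnj a * (a * e - b * c) = a * (e * cnj a) - cnj a * b * c" by (simp add: algebra_simps)
  also have "\<dots> = c * (cnj b * a - b * cnj a)" unfolding AB by (simp add: algebra_simps)
  also have "\<dots> = 0" by (simp add: ba)
  finally have "a = 0 \<or> a * e - b * c = 0" by simp
  then have "a = 0" using det me by auto
  then have "cnj b * c = 0" using AB by simp
  then show False using det me \<open>a = 0\<close> by simp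
qed

section \<open>Forms with prescribed roots and their partial matchings\<close>

definition hpoly :: "nat \<Rightarrow> complex poly" where "hpoly n = (\<Prod>i<n. [:- zp i, 1:])"
definition kpoly :: "nat \<Rightarrow> complex poly" where "kpoly n = (\<Prod>i<n. [:- wp i, 1:])"

lemma degree_hpoly [simp]: "degree (hpoly n) = n" unfolding hpoly_def by (rule degree_prod_roots)
lemma degree_kpoly [simp]: "degree (kpoly n) = n" unfolding kpoly_def by (rule degree_prod_roots)

lemma hpoly_nz [simp]: "hpoly n \<noteq> 0" unfolding hpoly_def by simp
lemma kpoly_nz [simp]: "kpoly n \<noteq> 0" unfolding kpoly_def by simp

lemma poly_hpoly: "poly (hpoly n) x = (\<Prod>i<n. x - zp i)" unfolding hpoly_def by (rule poly_prod_roots)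
lemma poly_kpoly: "poly (kpoly n) x = (\<Prod>i<n. x - wp i)" unfolding kpoly_def by (rule poly_prod_roots)

lemma poly_form_act_kpoly_eq_0:
  assumes "mdet m \<noteq> 0"
  shows "poly (form_act n m (kpoly n)) (zp i) = 0 \<longleftrightarrow> (\<exists>j<n. matched m i j)"
proof -
  obtain a b c e where m: "m = (a, b, c, e)" by (cases m)
  have "(b - wp j * e) + zp i * (a - wp j * c) = 0 \<longleftrightarrow> matched m i j" for j
    unfolding m matched_simp by (simp add: algebra_simps)
  then show ?thesis using assms unfolding m kpoly_def
    by (subst form_act_prod_roots) (auto simp: poly_prod prod_zero_iff)
qed

text \<open>At each of the \<open>q + 3\<close> roots of \<open>hpoly (q + 3)\<close> the transform
  of \<open>kpoly (p + 3)\<close> or that of \<open>s\<close> vanishes. The latter is nonzero of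
  degree at most \<open>q\<close>, so at least three roots are left to the former.\<close>

lemma three_matched:
  assumes det: "mdet m \<noteq> 0" and s: "s \<noteq> 0" "degree s \<le> q"
    and eq: "form_act (p + q + 3) m (kpoly (p + 3) * s) = hpoly (q + 3) * r"
  shows "card {i. i < q + 3 \<and> (\<exists>j<p+3. matched m i j)} \<ge> 3"
proof -
  let ?M = "{i. i < q + 3 \<and> (\<exists>j<p+3. matched m i j)}"
  let ?U = "{i. i < q + 3 \<and> \<not> (\<exists>j<p+3. matched m i j)}"
  have fa: "form_act (p + q + 3) m (kpoly (p + 3) * s) = form_act (p + 3) m (kpoly (p + 3)) * form_act q m s"
  proof -
    have "p + q + 3 = (p + 3) + q" by simp
    then show ?thesis using form_act_mult[OF det, of "kpoly (p + 3)" "p + 3" s q] s(2) by (simp only: degree_kpoly)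
  qed
  have s0: "form_act q m s \<noteq> 0" using form_act_eq_0_iff[OF det s(2)] s(1) by simp
  have "poly (form_act q m s) (zp i) = 0" if "i \<in> ?U" for i
  proof -
    have "poly (hpoly (q + 3) * r) (zp i) = 0" using that by (auto simp: poly_hpoly prod_zero_iff)
    then have "poly (form_act (p + 3) m (kpoly (p + 3))) (zp i) * poly (form_act q m s) (zp i) = 0"
      using eq fa by (metis poly_mult)
    then show ?thesis using that poly_form_act_kpoly_eq_0[OF det, of "p + 3" i] by auto
  qed
  then have "zp ` ?U \<subseteq> {x. poly (form_act q m s) x = 0}" by auto
  then have "card (zp ` ?U) \<le> card {x. poly (form_act q m s) x = 0}"
    using poly_roots_finite[OF s0] by (rule card_mono[rotated])
  also have "\<dots> \<le> degree (form_act q m s)" by (rule card_poly_roots_bound[OF s0])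
  also have "\<dots> \<le> q" by (rule degree_form_act)
  finally have "card ?U \<le> q" by (subst (asm) card_image) (auto simp: inj_on_def zp_inj)
  moreover have "card ?M + card ?U = card {..<q + 3}"
  proof -
    have "?M \<union> ?U = {..<q + 3}" by auto
    then show ?thesis by (subst card_Un_disjoint[symmetric]) auto
  qed
  ultimately show ?thesis by simp
qed

definition tsel :: "nat \<Rightarrow> nat \<times> nat \<times> nat \<Rightarrow> nat" where
  "tsel k x = (if k = 0 then fst x else if k = 1 then fst (snd x) else snd (snd x))"

text \<open>A partial matching of three roots: the sources are listed increasingly, the targets in
  any order, so that every injection of a 3-subset is recorded once. The orders of the targets
  account for the factor 6.\<close>

definition matchings :: "nat \<Rightarrow> nat \<Rightarrow> ((nat \<times> nat \<times> nat) \<times> (nat \<times> nat \<times> nat)) set" where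
  "matchings q p = {(i1, i2, i3). i1 < i2 \<and> i2 < i3 \<and> i3 < q + 3} \<times>
    {(j1, j2, j3). j1 < p + 3 \<and> j2 < p + 3 \<and> j3 < p + 3 \<and> j1 \<noteq> j2 \<and> j1 \<noteq> j3 \<and> j2 \<noteq> j3}"

text \<open>Splitting off the pairs with largest entry \<open>n\<close> reproduces Pascal's
  rule.\<close>

lemma card_increasing_pairs: "card {(i1, i2). i1 < i2 \<and> i2 < (n::nat)} = n choose 2"
  and finite_increasing_pairs: "finite {(i1, i2). i1 < i2 \<and> i2 < (n::nat)}"
proof (induction n)
  case (Suc n)
  have e: "{(i1, i2). i1 < i2 \<and> i2 < Suc n} = {(i1, i2). i1 < i2 \<and> i2 < n} \<union> (\<lambda>i. (i, n)) ` {..<n}"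
    by (auto simp: less_Suc_eq)
  { case 1
    have "card ((\<lambda>i. (i, n)) ` {..<n}) = n" by (subst card_image) (auto simp: inj_on_def)
    then show ?case unfolding e using Suc
      by (subst card_Un_disjoint) (auto simp: numeral_2_eq_2)
  }
  { case 2
    show ?case unfolding e using Suc by simp }
qed simp_all

lemma card_increasing_triples: "card {(i1, i2, i3). i1 < i2 \<and> i2 < i3 \<and> i3 < (n::nat)} = n choose 3"
  and finite_increasing_triples: "finite {(i1, i2, i3). i1 < i2 \<and> i2 < i3 \<and> i3 < (n::nat)}"
proof (induction n)
  case (Suc n)
  have e: "{(i1, i2, i3). i1 < i2 \<and> i2 < i3 \<and> i3 < Suc n} =
    {(i1, i2, i3). i1 < i2 \<and> i2 < i3 \<and> i3 < n} \<union> (\<lambda>(i, j). (i, j, n)) ` {(i1, i2). i1 < i2 \<and> i2 < n}"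
    by (auto simp: less_Suc_eq image_iff)
  { case 1
    have "card ((\<lambda>(i, j). (i, j, n)) ` {(i1, i2). i1 < i2 \<and> i2 < n}) = n choose 2"
      by (subst card_image) (auto simp: inj_on_def card_increasing_pairs)
    then show ?case unfolding e using Suc finite_increasing_pairs[of n]
      by (subst card_Un_disjoint) (auto simp: numeral_3_eq_3 numeral_2_eq_2)
  }
  { case 2
    show ?case unfolding e using Suc finite_increasing_pairs[of n] by simp }
qed (simp_all add: case_prod_unfold)

lemma card_distinct_triples:
  "card {(j1, j2, j3). j1 < n \<and> j2 < n \<and> j3 < n \<and> j1 \<noteq> j2 \<and> j1 \<noteq> j3 \<and> j2 \<noteq> (j3::nat)} = n * (n - 1) * (n - 2)"
  and finite_distinct_triples:
  "finite {(j1, j2, j3). j1 < n \<and> j2 < n \<and> j3 < n \<and> j1 \<noteq> j2 \<and> j1 \<noteq> j3 \<and> j2 \<noteq> (j3::nat)}"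
proof -
  have e: "{(j1, j2, j3). j1 < n \<and> j2 < n \<and> j3 < n \<and> j1 \<noteq> j2 \<and> j1 \<noteq> j3 \<and> j2 \<noteq> (j3::nat)} =
    Sigma {..<n} (\<lambda>j1. Sigma ({..<n} - {j1}) (\<lambda>j2. {..<n} - {j1, j2}))" by auto
  show "finite {(j1, j2, j3). j1 < n \<and> j2 < n \<and> j3 < n \<and> j1 \<noteq> j2 \<and> j1 \<noteq> j3 \<and> j2 \<noteq> (j3::nat)}"
    unfolding e by auto
  have c3: "card ({..<n} - {j1, j2}) = n - 2" if "j1 < n" "j2 \<in> {..<n} - {j1}" for j1 j2
    using that by (subst card_Diff_subset) auto
  have c2: "card (Sigma ({..<n} - {j1}) (\<lambda>j2. {..<n} - {j1, j2})) = (n - 1) * (n - 2)" if "j1 < n" for j1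
    using that by (subst card_SigmaI) (auto simp: c3 card_Diff_subset)
  show "card {(j1, j2, j3). j1 < n \<and> j2 < n \<and> j3 < n \<and> j1 \<noteq> j2 \<and> j1 \<noteq> j3 \<and> j2 \<noteq> (j3::nat)} = n * (n - 1) * (n - 2)"
    unfolding e by (subst card_SigmaI) (auto simp: c2 mult.assoc)
qed

lemma finite_matchings: "finite (matchings q p)"
  unfolding matchings_def by (intro finite_cartesian_product finite_increasing_triples finite_distinct_triples)

lemma card_matchings: "card (matchings q p) = 6 * ((q + 3) choose 3) * ((p + 3) choose 3)"
proof -
  have "6 * ((p + 3) choose 3) = (p + 3) * (p + 2) * (p + 1)"
  proof (induction p)
    case (Suc p)
    have "(Suc p + 3) choose 3 = ((p + 3) choose 2) + ((p + 3) choose 3)"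
      by (simp add: numeral_3_eq_3 numeral_2_eq_2)
    moreover have "2 * ((p + 3) choose 2) = (p + 3) * (p + 2)"
      by (simp add: choose_two)
    ultimately show ?case using Suc by (simp add: algebra_simps)
  qed simp
  then have "(p + 3) * (p + 3 - 1) * (p + 3 - 2) = 6 * ((p + 3) choose 3)" by simp
  then show ?thesis
    unfolding matchings_def card_cartesian_product card_increasing_triples card_distinct_triples
    by (simp only: ac_simps)
qed

lemma matching_exists:
  assumes "card {i. i < q + 3 \<and> (\<exists>j<p+3. matched m i j)} \<ge> 3" "mdet m \<noteq> 0"
  shows "\<exists>\<mu>\<in>matchings q p. \<forall>k<3. matched m (tsel k (fst \<mu>)) (tsel k (snd \<mu>))"
proof -
  let ?M = "{i. i < q + 3 \<and> (\<exists>j<p+3. matched m i j)}"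
  obtain T where T: "T \<subseteq> ?M" "card T = 3" "finite T"
    using obtain_subset_with_card_n[OF assms(1)] by blast
  define l where "l = sorted_list_of_set T"
  have l: "sorted_wrt (<) l" "set l = T" "length l = 3"
    unfolding l_def using T by (auto simp: strict_sorted_list_of_set)
  then obtain i1 i2 i3 where li: "l = [i1, i2, i3]"
    by (auto simp: numeral_3_eq_3 length_Suc_conv)
  then have i: "i1 < i2" "i2 < i3" "i1 \<in> ?M" "i2 \<in> ?M" "i3 \<in> ?M" using l T(1) by auto
  obtain j1 where j1: "j1 < p + 3" "matched m i1 j1" using i(3) by blast
  obtain j2 where j2: "j2 < p + 3" "matched m i2 j2" using i(4) by blast
  obtain j3 where j3: "j3 < p + 3" "matched m i3 j3" using i(5) by blast
  note j = j1(1) j2(1) j3(1) j1(2) j2(2) j3(2)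
  have "j1 \<noteq> j2" using matched_inj[OF assms(2) j(4), of i2] j(5) i(1) by blast
  moreover have "j1 \<noteq> j3" using matched_inj[OF assms(2) j(4), of i3] j(6) i(1,2) by auto
  moreover have "j2 \<noteq> j3" using matched_inj[OF assms(2) j(5), of i3] j(6) i(2) by blast
  ultimately have "((i1, i2, i3), (j1, j2, j3)) \<in> matchings q p" using i j by (auto simp: matchings_def)
  moreover have "\<forall>k<3. matched m (tsel k (i1, i2, i3)) (tsel k (j1, j2, j3))"
    using j by (auto simp: tsel_def)
  ultimately show ?thesis by force
qed

text \<open>Since no fourth source can be matched, \<open>m\<close> determines the set of its three
  matched sources; their increasing order fixes the triple, and \<open>m\<close> fixes the
  targets.\<close>

lemma matching_unique:
  assumes det: "mdet m \<noteq> 0" and mu: "\<mu> \<in> matchings q p" "\<nu> \<in> matchings q p"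
    and m: "\<And>k. k < 3 \<Longrightarrow> matched m (tsel k (fst \<mu>)) (tsel k (snd \<mu>))"
      "\<And>k. k < 3 \<Longrightarrow> matched m (tsel k (fst \<nu>)) (tsel k (snd \<nu>))"
  shows "\<mu> = \<nu>"
proof -
  obtain i1 i2 i3 j1 j2 j3 where mu': "\<mu> = ((i1, i2, i3), (j1, j2, j3))" by (metis prod.exhaust)
  obtain i1' i2' i3' j1' j2' j3' where nu': "\<nu> = ((i1', i2', i3'), (j1', j2', j3'))" by (metis prod.exhaust)
  have i: "i1 < i2" "i2 < i3" "i1' < i2'" "i2' < i3'" using mu mu' nu' by (auto simp: matchings_def)
  have mm: "matched m i1 j1" "matched m i2 j2" "matched m i3 j3"
    "matched m i1' j1'" "matched m i2' j2'" "matched m i3' j3'"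
    using m(1)[of 0] m(1)[of 1] m(1)[of 2] m(2)[of 0] m(2)[of 1] m(2)[of 2]
    by (auto simp: mu' nu' tsel_def)
  have in3: "i \<in> {i1, i2, i3}" if "matched m i j" for i j
    using no_four_matched[OF det mm(1,2,3) that] i by auto
  have "i1' \<in> {i1, i2, i3}" "i2' \<in> {i1, i2, i3}" "i3' \<in> {i1, i2, i3}"
    using in3 mm(4,5,6) by blast+
  then have ie: "i1' = i1 \<and> i2' = i2 \<and> i3' = i3" using i by auto
  then have "j1' = j1" "j2' = j2" "j3' = j3" using mm matched_fun[OF det] by metis+
  then show ?thesis using ie mu' nu' by simp
qed

section \<open>Moebius maps with three prescribed values\<close>

text \<open>The matrix taking \<open>z\<^sub>k\<close> to \<open>y\<^sub>k\<close>, scaled so that its entries are polynomial in \<open>y\<close>; the scalars come from the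
  affine dependency of the \<open>z\<^sub>k\<close>.\<close>

definition chart_scalar :: "triple \<Rightarrow> triple \<Rightarrow> nat \<Rightarrow> complex" where
  "chart_scalar z y k = (if k = 0 then (proj 1 y - proj 2 y) / (proj 1 z - proj 2 z)
    else if k = 1 then (proj 2 y - proj 0 y) / (proj 2 z - proj 0 z)
    else (proj 0 y - proj 1 y) / (proj 0 z - proj 1 z))"

definition chart_c :: "triple \<Rightarrow> triple \<Rightarrow> complex" where
  "chart_c z y = (chart_scalar z y 0 - chart_scalar z y 1) / (proj 0 z - proj 1 z)"
definition chart_e :: "triple \<Rightarrow> triple \<Rightarrow> complex" where
  "chart_e z y = chart_scalar z y 0 - chart_c z y * proj 0 z"
definition chart_a :: "triple \<Rightarrow> triple \<Rightarrow> complex" where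
  "chart_a z y = (chart_scalar z y 0 * proj 0 y - chart_scalar z y 1 * proj 1 y) / (proj 0 z - proj 1 z)"
definition chart_b :: "triple \<Rightarrow> triple \<Rightarrow> complex" where
  "chart_b z y = chart_scalar z y 0 * proj 0 y - chart_a z y * proj 0 z"
definition chart :: "triple \<Rightarrow> triple \<Rightarrow> mat2" where
  "chart z y = (chart_a z y, chart_b z y, chart_c z y, chart_e z y)"

definition tdistinct :: "triple \<Rightarrow> bool" where
  "tdistinct z \<longleftrightarrow> proj 0 z \<noteq> proj 1 z \<and> proj 0 z \<noteq> proj 2 z \<and> proj 1 z \<noteq> proj 2 z"

text \<open>The linear relation says that \<open>u1, u2, u3\<close> are values of one affine
  function at \<open>z1, z2, z3\<close>, so interpolation from the first two points reproduces the
  third value.\<close>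

lemma affine_three_points:
  fixes u1 u2 u3 z1 z2 z3 :: complex
  assumes "(z2 - z3) * u1 + (z3 - z1) * u2 + (z1 - z2) * u3 = 0" "z1 \<noteq> z2"
  shows "(u1 - u2) / (z1 - z2) * z3 + (u1 - (u1 - u2) / (z1 - z2) * z1) = u3"
proof -
  have n: "z1 - z2 \<noteq> 0" using assms(2) by simp
  have "(z1 - z2) * ((u1 - u2) / (z1 - z2) * z3 + (u1 - (u1 - u2) / (z1 - z2) * z1)) =
     (u1 - u2) * z3 + (z1 - z2) * u1 - (u1 - u2) * z1"
    using n by (simp add: distrib_left right_diff_distrib)
  also have "\<dots> = (z1 - z2) * u3" using assms(1) by (simp add: algebra_simps)
  finally show ?thesis using n by simp
qed

lemma chart_point:
  assumes z: "tdistinct z" and k: "k < 3"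
  shows "chart_a z y * proj k z + chart_b z y = chart_scalar z y k * proj k y"
    and "chart_c z y * proj k z + chart_e z y = chart_scalar z y k"
proof -
  define z1 z2 z3 y1 y2 y3 where d: "z1 = proj 0 z" "z2 = proj 1 z" "z3 = proj 2 z" "y1 = proj 0 y" "y2 = proj 1 y" "y3 = proj 2 y"
  define l1 l2 l3 where l: "l1 = (y2 - y3) / (z2 - z3)" "l2 = (y3 - y1) / (z3 - z1)" "l3 = (y1 - y2) / (z1 - z2)"
  have zd: "z1 \<noteq> z2" "z1 \<noteq> z3" "z2 \<noteq> z3" using z by (auto simp: tdistinct_def d)
  have cs: "chart_scalar z y 0 = l1" "chart_scalar z y 1 = l2" "chart_scalar z y 2 = l3"
    "chart_scalar z y (Suc 0) = l2"
    by (simp_all add: chart_scalar_def d l)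
  have ml: "(z2 - z3) * l1 = y2 - y3" "(z3 - z1) * l2 = y3 - y1" "(z1 - z2) * l3 = y1 - y2"
    using zd by (simp_all add: l)
  \<comment> \<open>After inserting \<open>ml\<close>, the relations required of the denominators
    and of the numerators become cyclic sums in the \<open>y\<close> that cancel.\<close>
  have r1: "(z2 - z3) * l1 + (z3 - z1) * l2 + (z1 - z2) * l3 = 0" unfolding ml by simp
  have r2: "(z2 - z3) * (l1 * y1) + (z3 - z1) * (l2 * y2) + (z1 - z2) * (l3 * y3) = 0"
    unfolding mult.assoc[symmetric] ml by (simp add: algebra_simps)
  have A: "chart_a z y = (l1 * y1 - l2 * y2) / (z1 - z2)" "chart_b z y = l1 * y1 - chart_a z y * z1"
    "chart_c z y = (l1 - l2) / (z1 - z2)" "chart_e z y = l1 - chart_c z y * z1"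
    by (simp_all add: chart_a_def chart_b_def chart_c_def chart_e_def cs d)
  have two: "(u - v) / (z1 - z2) * z2 + (u - (u - v) / (z1 - z2) * z1) = v" for u v :: complex
  proof -
    have "(u - v) / (z1 - z2) * z2 + (u - (u - v) / (z1 - z2) * z1) = u - (u - v) / (z1 - z2) * (z1 - z2)"
      by (simp only: algebra_simps)
    also have "\<dots> = v" using zd by simp
    finally show ?thesis .
  qed
  have "chart_a z y * proj k z + chart_b z y = chart_scalar z y k * proj k y \<and>
    chart_c z y * proj k z + chart_e z y = chart_scalar z y k"
    using less_3_cases[OF k]
  proof (elim disjE)
    assume "k = 0"
    then show ?thesis by (simp add: A cs d[symmetric])
  next
    assume "k = 1"
    then show ?thesis using two by (simp add: A cs d[symmetric] d(2)[symmetric, unfolded One_nat_def] d(5)[symmetric, unfolded One_nat_def])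
  next
    assume "k = 2"
    then show ?thesis using affine_three_points[OF r1 zd(1)] affine_three_points[OF r2 zd(1)]
      by (simp add: A cs d[symmetric])
  qed
  then show "chart_a z y * proj k z + chart_b z y = chart_scalar z y k * proj k y"
    "chart_c z y * proj k z + chart_e z y = chart_scalar z y k" by auto
qed

lemma chart_scalar_nz: "tdistinct z \<Longrightarrow> tdistinct y \<Longrightarrow> chart_scalar z y k \<noteq> 0"
  by (auto simp: chart_scalar_def tdistinct_def)

lemma mdet_chart: "tdistinct z \<Longrightarrow> tdistinct y \<Longrightarrow> mdet (chart z y) \<noteq> 0"
proof -
  assume z: "tdistinct z" and y: "tdistinct y"
  have P: "chart_a z y * proj 0 z + chart_b z y = chart_scalar z y 0 * proj 0 y"
    "chart_c z y * proj 0 z + chart_e z y = chart_scalar z y 0"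
    "chart_a z y * proj 1 z + chart_b z y = chart_scalar z y 1 * proj 1 y"
    "chart_c z y * proj 1 z + chart_e z y = chart_scalar z y 1"
    by (rule chart_point[OF z]; simp)+
  have "mdet (chart z y) * (proj 0 z - proj 1 z) =
    (chart_a z y * proj 0 z + chart_b z y) * (chart_c z y * proj 1 z + chart_e z y) -
    (chart_a z y * proj 1 z + chart_b z y) * (chart_c z y * proj 0 z + chart_e z y)"
    by (simp add: chart_def algebra_simps)
  also have "\<dots> = chart_scalar z y 0 * chart_scalar z y 1 * (proj 0 y - proj 1 y)"
    unfolding P by (simp add: algebra_simps)
  also have "\<dots> \<noteq> 0" using chart_scalar_nz[OF z y] y by (simp add: tdistinct_def)
  finally show ?thesis by auto
qed

text \<open>A Moebius map is determined by its values at three points. In addition an invertible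
  matrix keeps distinct points distinct, so \<open>tdistinct y\<close> comes out as a
  conclusion.\<close>

lemma chart_unique:
  assumes z: "tdistinct z" and det: "mdet (a, b, c, e) \<noteq> 0"
    and pt: "\<And>k. k < 3 \<Longrightarrow> a * proj k z + b = proj k y * (c * proj k z + e)"
  shows "pgl_class (a, b, c, e) = pgl_class (chart z y)" "tdistinct y"
proof -
  define z1 z2 z3 y1 y2 y3 where d: "z1 = proj 0 z" "z2 = proj 1 z" "z3 = proj 2 z" "y1 = proj 0 y" "y2 = proj 1 y" "y3 = proj 2 y"
  define u1 u2 u3 where u: "u1 = c * z1 + e" "u2 = c * z2 + e" "u3 = c * z3 + e"
  have zd: "z1 \<noteq> z2" "z1 \<noteq> z3" "z2 \<noteq> z3" using z by (auto simp: tdistinct_def d)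
  have p: "a * z1 + b = y1 * u1" "a * z2 + b = y2 * u2" "a * z3 + b = y3 * u3"
    using pt[of 0] pt[of 1] pt[of 2] by (auto simp: d u)
  have unz: "u \<noteq> 0" if "u = c * x + e" "a * x + b = v * u" for u v x
  proof
    assume "u = 0"
    then have "c * x + e = 0" "a * x + b = 0" using that by auto
    moreover have "a * e - b * c = a * (c * x + e) - c * (a * x + b)" by (simp add: algebra_simps)
    ultimately show False using det by simp
  qed
  have n: "u1 \<noteq> 0" "u2 \<noteq> 0" "u3 \<noteq> 0" using unz[OF u(1) p(1)] unz[OF u(2) p(2)] unz[OF u(3) p(3)] by auto
  have dd: "(a * e - b * c) * (x - x') = (a * x + b) * (c * x' + e) - (a * x' + b) * (c * x + e)" for x x'
    by (simp add: algebra_simps)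
  have yd: "v \<noteq> v'" if "x \<noteq> x'" "a * x + b = v * (c * x + e)" "a * x' + b = v' * (c * x' + e)" for x x' v v'
    using dd[of x x'] that det by auto
  show ty: "tdistinct y"
    using yd[OF zd(1)] yd[OF zd(2)] yd[OF zd(3)] p unfolding u tdistinct_def d by blast
  \<comment> \<open>The denominators \<open>u1, u2, u3\<close> and the chart scalars satisfy the
    same two independent linear relations, hence are proportional with factor
    \<open>K\<close>.\<close>
  define K where "K = u1 / chart_scalar z y 0"
  have cnz: "chart_scalar z y k \<noteq> 0" for k by (rule chart_scalar_nz[OF z ty])
  have Knz: "K \<noteq> 0" using n cnz by (simp add: K_def)
  have s: "(z2 - z3) * u1 + (z3 - z1) * u2 + (z1 - z2) * u3 = 0" by (simp add: u algebra_simps)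
  have "(z2 - z3) * (y1 * u1) + (z3 - z1) * (y2 * u2) + (z1 - z2) * (y3 * u3) = 0"
    unfolding p[symmetric] by (simp add: algebra_simps)
  moreover have "(z2 - z3) * (y1 * u1) + (z3 - z1) * (y2 * u2) + (z1 - z2) * (y3 * u3) =
    y3 * ((z2 - z3) * u1 + (z3 - z1) * u2 + (z1 - z2) * u3) + (z2 - z3) * u1 * (y1 - y3) - (z3 - z1) * u2 * (y3 - y2)"
    by (simp add: algebra_simps)
  ultimately have "(z2 - z3) * u1 * (y1 - y3) = (z3 - z1) * u2 * (y3 - y2)" using s by simp
  then have e12: "u1 * chart_scalar z y 1 = u2 * chart_scalar z y 0"
    using zd by (simp add: chart_scalar_def d[symmetric] d(2)[symmetric, unfolded One_nat_def] d(5)[symmetric, unfolded One_nat_def] divide_simps) (simp add: algebra_simps)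
  have U1: "u1 = K * chart_scalar z y 0" using cnz by (simp add: K_def)
  have U2: "u2 = K * chart_scalar z y 1" using e12 cnz[of 0] by (simp add: K_def field_simps)
  have cc: "c = K * chart_c z y"
  proof -
    have "c * (z1 - z2) = u1 - u2" by (simp add: u algebra_simps)
    also have "\<dots> = K * (chart_scalar z y 0 - chart_scalar z y 1)" by (simp add: U1 U2 algebra_simps)
    finally show ?thesis using zd(1) by (simp add: chart_c_def d[symmetric] d(2)[symmetric, unfolded One_nat_def] field_simps)
  qed
  have aa: "a = K * chart_a z y"
  proof -
    have "a * (z1 - z2) = (a * z1 + b) - (a * z2 + b)" by (simp add: algebra_simps)
    also have "\<dots> = K * (chart_scalar z y 0 * y1 - chart_scalar z y 1 * y2)" unfolding p by (simp add: U1 U2 algebra_simps)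
    finally show ?thesis using zd(1) by (simp add: chart_a_def d[symmetric] d(2)[symmetric, unfolded One_nat_def] d(5)[symmetric, unfolded One_nat_def] field_simps)
  qed
  have ee: "e = K * chart_e z y" using u(1) U1 cc by (simp add: chart_e_def d[symmetric] algebra_simps)
  have bb: "b = K * chart_b z y" using p(1) U1 aa by (simp add: chart_b_def d[symmetric] algebra_simps)
  have "(a, b, c, e) = mscale K (chart z y)" using aa bb cc ee by (simp add: chart_def)
  then show "pgl_class (a, b, c, e) = pgl_class (chart z y)" using pgl_class_mscale[OF Knz] by metis
qed

section \<open>Degenerating substitutions\<close>

lemma linear_factor_nz:
  assumes "mdet (a, b, c, e) \<noteq> 0"
  shows "[:b - x * e, a - x * c:] \<noteq> (0 :: complex poly)"
proof
  assume "[:b - x * e, a - x * c:] = 0"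
  then have "b = x * e" "a = x * c" by auto
  then show False using assms by simp
qed

lemma order_prod_eq_sum:
  fixes f :: "'a \<Rightarrow> complex poly"
  assumes "finite A" "\<And>i. i \<in> A \<Longrightarrow> f i \<noteq> 0"
  shows "order x (\<Prod>i\<in>A. f i) = (\<Sum>i\<in>A. order x (f i))"
  using assms
proof (induction A rule: finite_induct)
  case (insert i A)
  then have "f i * (\<Prod>i\<in>A. f i) \<noteq> 0" by (simp add: prod_zero_iff)
  from order_mult[OF this, of x] insert show ?case by simp
qed simp

text \<open>The roots are distinct, so at most one of the linear factors of the transform vanishes
  at 0; two of them would make the matrix singular.\<close>

lemma order_0_form_act_hpoly:
  assumes "mdet m \<noteq> 0"
  shows "order 0 (form_act n m (hpoly n)) \<le> 1"
proof -
  obtain a b c e where m: "m = (a, b, c, e)" by (cases m)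
  let ?f = "\<lambda>i. [:b - zp i * e, a - zp i * c:]"
  let ?B = "{i. i < n \<and> b - zp i * e = 0}"
  have nz: "?f i \<noteq> 0" for i using linear_factor_nz assms m by blast
  have ord: "order 0 (\<Prod>i<n. ?f i) = (\<Sum>i<n. order 0 (?f i))"
    by (rule order_prod_eq_sum) (use nz in simp_all)
  have "order 0 (?f i) \<le> (if i \<in> ?B then 1 else 0)" if "i < n" for i
  proof (cases "b - zp i * e = 0")
    case True
    have "order 0 (?f i) \<le> degree (?f i)" by (rule order_degree[OF nz])
    also have "\<dots> \<le> 1" by simp
    finally show ?thesis using True that by simp
  next
    case False
    then show ?thesis by (simp add: order_0I)
  qed
  then have "(\<Sum>i<n. order 0 (?f i)) \<le> (\<Sum>i<n. if i \<in> ?B then 1 else 0)"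
    by (intro sum_mono) simp
  also have "\<dots> = card ?B" by (subst sum.If_cases) (auto intro!: arg_cong[where f = card])
  also have "\<dots> \<le> 1"
  proof -
    have "i = j" if "i \<in> ?B" "j \<in> ?B" for i j
    proof (rule ccontr)
      assume "i \<noteq> j"
      then have ne: "zp i - zp j \<noteq> 0" by (simp add: zp_inj)
      have "(zp i - zp j) * e = (b - zp j * e) - (b - zp i * e)" by (simp add: algebra_simps)
      then have "e = 0" using that ne by simp
      then show False using that assms m by simp
    qed
    then show ?thesis by (intro card_le_Suc0_iff_eq[THEN iffD2, folded One_nat_def]) auto
  qed
  finally have "(\<Sum>i<n. order 0 (?f i)) \<le> 1" .
  then show ?thesis unfolding m hpoly_def form_act_prod_roots[OF assms[unfolded m]] ord .
qed

text \<open>The counterpart at infinity: at most one linear factor loses its degree.\<close>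

lemma degree_form_act_kpoly:
  assumes "mdet m \<noteq> 0"
  shows "degree (form_act n m (kpoly n)) + 1 \<ge> n"
proof -
  obtain a b c e where m: "m = (a, b, c, e)" by (cases m)
  let ?f = "\<lambda>i. [:b - wp i * e, a - wp i * c:]"
  let ?B = "{i. i < n \<and> a - wp i * c = 0}"
  have nz: "?f i \<noteq> 0" for i using linear_factor_nz assms m by blast
  have "(if i \<in> ?B then 0 else 1) \<le> degree (?f i)" if "i < n" for i using that by auto
  then have "(\<Sum>i<n. if i \<in> ?B then 0 else 1) \<le> (\<Sum>i<n. degree (?f i))" by (intro sum_mono) simp
  also have "(\<Sum>i<n. degree (?f i)) = degree (prod ?f {..<n})"
    by (rule degree_prod_eq_sum_degree[symmetric]) (use nz in blast)
  also have "prod ?f {..<n} = form_act n m (kpoly n)"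
    using assms unfolding m kpoly_def by (rule form_act_prod_roots[symmetric])
  finally have 1: "(\<Sum>i<n. if i \<in> ?B then 0 else 1) \<le> degree (form_act n m (kpoly n))" .
  have "card ?B \<le> 1"
  proof -
    have "i = j" if "i \<in> ?B" "j \<in> ?B" for i j
    proof (rule ccontr)
      assume "i \<noteq> j"
      then have ne: "wp i - wp j \<noteq> 0" by (simp add: wp_inj)
      have "(wp i - wp j) * c = (a - wp j * c) - (a - wp i * c)" by (simp add: algebra_simps)
      then have "c = 0" using that ne by simp
      then show False using that assms m by simp
    qed
    then show ?thesis by (intro card_le_Suc0_iff_eq[THEN iffD2, folded One_nat_def]) auto
  qed
  moreover have "(\<Sum>i<n. (if i \<in> ?B then 0 else 1) + (if i \<in> ?B then 1 else 0)) = n"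
    by (subst sum.cong[OF refl, of _ _ "\<lambda>_. 1"]) auto
  moreover have "(\<Sum>i<n. if i \<in> ?B then 1 else 0) = card ?B"
    by (subst sum.If_cases) (auto intro!: arg_cong[where f = card])
  ultimately show ?thesis using 1 unfolding sum.distrib by linarith
qed

text \<open>The order of vanishing at 0 is at most 1 from the transform of
  \<open>hpoly (q + 3)\<close> plus \<open>p\<close> from that of \<open>r\<close>.\<close>

lemma low_coeff_exists:
  assumes det: "mdet m \<noteq> 0" and r: "r \<noteq> 0" "degree r \<le> p"
  shows "\<exists>i\<le>p + 1. coeff (form_act (p + q + 3) m (hpoly (q + 3) * r)) i \<noteq> 0"
proof -
  have pq: "p + q + 3 = (q + 3) + p" by simp
  let ?F = "form_act (p + q + 3) m (hpoly (q + 3) * r)"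
  have fa: "?F = form_act (q + 3) m (hpoly (q + 3)) * form_act p m r"
    unfolding pq by (rule form_act_mult[OF det _ r(2)]) simp
  have n1: "form_act (q + 3) m (hpoly (q + 3)) \<noteq> 0" using form_act_eq_0_iff[OF det, of "hpoly (q + 3)" "q + 3"] by simp
  have n2: "form_act p m r \<noteq> 0" using form_act_eq_0_iff[OF det r(2)] r(1) by simp
  have F0: "?F \<noteq> 0" using n1 n2 fa by simp
  have "order 0 ?F = order 0 (form_act (q + 3) m (hpoly (q + 3))) + order 0 (form_act p m r)"
    unfolding fa using n1 n2 by (intro order_mult) simp
  also have "order 0 (form_act p m r) \<le> degree (form_act p m r)" by (rule order_degree[OF n2])
  also have "\<dots> \<le> p" by (rule degree_form_act)
  finally have "\<not> p + 2 \<le> order 0 ?F" using order_0_form_act_hpoly[OF det, of "q + 3"] by simp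
  then have "\<not> monom 1 (p + 2) dvd ?F" using F0 by (simp add: monom_1_dvd_iff)
  then show ?thesis unfolding monom_1_dvd_iff' by (auto simp: less_Suc_eq_le)
qed

text \<open>The order of vanishing at infinity is at most \<open>q + 1\<close>, so the degree is at
  least \<open>p + 2\<close>. This exceeds the index \<open>p + 1\<close> of
  \<open>low_coeff_exists\<close>, and on that gap the exclusion of singular limits rests.\<close>

lemma high_coeff_exists:
  assumes det: "mdet m \<noteq> 0" and s: "s \<noteq> 0" "degree s \<le> q"
  shows "\<exists>j\<ge>p + 2. coeff (form_act (p + q + 3) m (kpoly (p + 3) * s)) j \<noteq> 0"
proof -
  have pq: "p + q + 3 = (p + 3) + q" by simp
  let ?F = "form_act (p + q + 3) m (kpoly (p + 3) * s)"
  have fa: "?F = form_act (p + 3) m (kpoly (p + 3)) * form_act q m s"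
    unfolding pq by (rule form_act_mult[OF det _ s(2)]) simp
  have n1: "form_act (p + 3) m (kpoly (p + 3)) \<noteq> 0" using form_act_eq_0_iff[OF det, of "kpoly (p + 3)" "p + 3"] by simp
  have n2: "form_act q m s \<noteq> 0" using form_act_eq_0_iff[OF det s(2)] s(1) by simp
  have "degree ?F \<ge> p + 2"
    unfolding fa degree_mult_eq[OF n1 n2] using degree_form_act_kpoly[OF det, of "p + 3"] by simp
  moreover have "coeff ?F (degree ?F) \<noteq> 0" using n1 n2 fa by simp
  ultimately show ?thesis by blast
qed

section \<open>Limits of substitutions of rank one\<close>

lemma coeff_form_act_diag: "i \<le> d \<Longrightarrow> coeff (form_act d (a, 0, 0, e) p) i = a ^ i * e ^ (d - i) * coeff p i"
proof -
  assume i: "i \<le> d"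
  have e: "[:0, a:] ^ j * [:e, 0:] ^ (d - j) = monom (a ^ j * e ^ (d - j)) j" for j
  proof -
    have "[:0, a:] ^ j = monom (a ^ j) j"
      using monom_power[of a 1 j] by (simp add: monom_Suc monom_0)
    moreover have "[:e, 0:] ^ (d - j) = [:e ^ (d - j):]" by (simp add: poly_const_pow)
    ultimately show ?thesis by (simp add: smult_monom mult.commute)
  qed
  show ?thesis using i unfolding form_act_simp e
    by (simp add: coeff_sum smult_monom sum.delta mult.commute)
qed

text \<open>Comparing two coefficients through the factorisation of the matrix into a lower unipotent, a diagonal and
  an upper unipotent factor eliminates the unknown scalars \<open>\<kappa>\<close>.\<close>

lemma degenerate_limit:
  fixes a b c e \<kappa> :: "nat \<Rightarrow> complex"
  assumes lim: "a \<longlonglongrightarrow> 1" "b \<longlonglongrightarrow> 0" "c \<longlonglongrightarrow> 0" "e \<longlonglongrightarrow> 0"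
    and det: "\<And>n. mdet (a n, b n, c n, e n) \<noteq> 0"
    and deg: "\<And>n. degree (F n) \<le> d" "\<And>n. degree (G n) \<le> d" "degree F' \<le> d" "degree G' \<le> d"
    and eq: "\<And>n. F n = smult (\<kappa> n) (form_act d (a n, b n, c n, e n) (G n))"
    and cF: "\<And>i. (\<lambda>n. coeff (F n) i) \<longlonglongrightarrow> coeff F' i" and cG: "\<And>i. (\<lambda>n. coeff (G n) i) \<longlonglongrightarrow> coeff G' i"
    and ij: "i < j" "j \<le> d"
  shows "coeff F' i * coeff G' j = 0"
proof -
  define F2 where "F2 n = form_act d (1, - (b n / a n), 0, 1) (F n)" for n
  define G2 where "G2 n = form_act d (1, 0, c n / a n, 1) (G n)" for n
  define \<epsilon> where "\<epsilon> n = e n - c n * b n / a n" for n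
  \<comment> \<open>Coefficient \<open>l\<close> of \<open>F2 n\<close> is
    \<open>\<kappa> n * a n ^ l * \<epsilon> n ^ (d - l)\<close> times that of \<open>G2 n\<close>.
    Cross-multiplying for \<open>i\<close> and \<open>j\<close> cancels \<open>\<kappa> n\<close>
    and leaves \<open>\<epsilon> n ^ (j - i)\<close> on one side, which tends to 0 because
    \<open>i < j\<close>.\<close>
  have key: "a n ^ j * (coeff (F2 n) i * coeff (G2 n) j) = \<epsilon> n ^ (j - i) * (a n ^ i * (coeff (F2 n) j * coeff (G2 n) i))"
    if an: "a n \<noteq> 0" for n
  proof -
    have "a n * \<epsilon> n = mdet (a n, b n, c n, e n)" using an by (simp add: \<epsilon>_def field_simps)
    then have en: "\<epsilon> n \<noteq> 0" using det[of n] by auto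
    have "F2 n = smult (\<kappa> n) (form_act d (1, - (b n / a n), 0, 1) (form_act d (a n, b n, c n, e n) (G n)))"
      unfolding F2_def by (simp add: eq form_act_smult)
    also have "form_act d (1, - (b n / a n), 0, 1) (form_act d (a n, b n, c n, e n) (G n)) =
      form_act d (mmul (a n, b n, c n, e n) (1, - (b n / a n), 0, 1)) (G n)"
      by (rule form_act_mmul) (use deg in auto)
    also have "mmul (a n, b n, c n, e n) (1, - (b n / a n), 0, 1) = mmul (1, 0, c n / a n, 1) (a n, 0, 0, \<epsilon> n)"
      using an by (simp add: \<epsilon>_def)
    also have "form_act d (mmul (1, 0, c n / a n, 1) (a n, 0, 0, \<epsilon> n)) (G n) = form_act d (a n, 0, 0, \<epsilon> n) (G2 n)"
      unfolding G2_def by (rule form_act_mmul[symmetric]) (use deg en an in auto)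
    finally have F2: "coeff (F2 n) l = \<kappa> n * (a n ^ l * \<epsilon> n ^ (d - l) * coeff (G2 n) l)" if "l \<le> d" for l
      using that by (simp add: coeff_form_act_diag)
    have "\<epsilon> n ^ (d - i) = \<epsilon> n ^ (j - i) * \<epsilon> n ^ (d - j)" using ij by (simp flip: power_add)
    then show ?thesis using ij by (simp add: F2)
  qed
  have la: "(\<lambda>n. b n / a n) \<longlonglongrightarrow> 0" "(\<lambda>n. c n / a n) \<longlonglongrightarrow> 0" "\<epsilon> \<longlonglongrightarrow> 0"
    using tendsto_divide[OF lim(2,1)] tendsto_divide[OF lim(3,1)]
      tendsto_diff[OF lim(4) tendsto_divide[OF tendsto_mult[OF lim(3,2)] lim(1)]] unfolding \<epsilon>_def by simp_all
  have lF: "(\<lambda>n. coeff (F2 n) l) \<longlonglongrightarrow> coeff F' l" for l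
  proof -
    have "(\<lambda>n. coeff (F2 n) l) \<longlonglongrightarrow> coeff (form_act d (1, - 0, 0, 1) F') l"
      unfolding F2_def by (intro tendsto_form_act cF tendsto_const tendsto_minus la)
    then show ?thesis using deg by (simp add: form_act_id)
  qed
  have lG: "(\<lambda>n. coeff (G2 n) l) \<longlonglongrightarrow> coeff G' l" for l
  proof -
    have "(\<lambda>n. coeff (G2 n) l) \<longlonglongrightarrow> coeff (form_act d (1, 0, 0, 1) G') l"
      unfolding G2_def by (intro tendsto_form_act cG tendsto_const la)
    then show ?thesis using deg by (simp add: form_act_id)
  qed
  have L1: "(\<lambda>n. a n ^ j * (coeff (F2 n) i * coeff (G2 n) j)) \<longlonglongrightarrow> 1 ^ j * (coeff F' i * coeff G' j)"
    by (intro tendsto_intros lim lF lG)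
  have L2: "(\<lambda>n. \<epsilon> n ^ (j - i) * (a n ^ i * (coeff (F2 n) j * coeff (G2 n) i))) \<longlonglongrightarrow>
      0 ^ (j - i) * (1 ^ i * (coeff F' j * coeff G' i))"
    by (intro tendsto_intros lim lF lG la)
  have "\<forall>\<^sub>F n in sequentially. a n \<noteq> 0"
    by (rule tendsto_imp_eventually_ne[OF lim(1)]) simp
  then have "\<forall>\<^sub>F n in sequentially. \<epsilon> n ^ (j - i) * (a n ^ i * (coeff (F2 n) j * coeff (G2 n) i)) =
      a n ^ j * (coeff (F2 n) i * coeff (G2 n) j)"
    by eventually_elim (rule key[symmetric])
  from Lim_transform_eventually[OF L2 this]
  have "0 ^ (j - i) * (1 ^ i * (coeff F' j * coeff G' i)) = 1 ^ j * (coeff F' i * coeff G' j)"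
    using L1 by (rule LIMSEQ_unique)
  then show ?thesis using ij by (simp add: zero_power)
qed

lemma mmul_projections: "mmul m m' =
  (fst m * fst m' + fst (snd m) * fst (snd (snd m')), fst m * fst (snd m') + fst (snd m) * snd (snd (snd m')),
   fst (snd (snd m)) * fst m' + snd (snd (snd m)) * fst (snd (snd m')),
   fst (snd (snd m)) * fst (snd m') + snd (snd (snd m)) * snd (snd (snd m')))"
  by (cases m; cases m') simp

lemma mscale_projections: "mscale k m = (k * fst m, k * fst (snd m), k * fst (snd (snd m)), k * snd (snd (snd m)))"
  by (cases m) simp

lemma tendsto_mmul [tendsto_intros]:
  "(f \<longlongrightarrow> x) F \<Longrightarrow> (g \<longlongrightarrow> y) F \<Longrightarrow> ((\<lambda>n. mmul (f n) (g n)) \<longlongrightarrow> mmul x y) F"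
  unfolding mmul_projections by (intro tendsto_intros)

lemma tendsto_mscale [tendsto_intros]:
  "(f \<longlongrightarrow> x) F \<Longrightarrow> (g \<longlongrightarrow> y) F \<Longrightarrow> ((\<lambda>n. mscale (f n) (g n)) \<longlongrightarrow> mscale x y) F"
  unfolding mscale_projections by (intro tendsto_intros)

lemma tendsto_form_act_mat:
  assumes "(m \<longlongrightarrow> m') F" "\<And>i. ((\<lambda>n. coeff (P n) i) \<longlongrightarrow> coeff P' i) F"
  shows "((\<lambda>n. coeff (form_act d (m n) (P n)) k) \<longlongrightarrow> coeff (form_act d m' P') k) F"
proof -
  have "((\<lambda>n. coeff (form_act d (fst (m n), fst (snd (m n)), fst (snd (snd (m n))), snd (snd (snd (m n)))) (P n)) k) \<longlongrightarrow>
    coeff (form_act d (fst m', fst (snd m'), fst (snd (snd m')), snd (snd (snd m'))) P') k) F"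
    by (rule tendsto_form_act) (intro assms tendsto_intros)+
  then show ?thesis by simp
qed

text \<open>Normal form of rank-one matrices: write \<open>m\<close> as a column times a row, then
  complete the column and the row to invertible matrices.\<close>

lemma singular_factorisation:
  assumes "mdet m = 0" "m \<noteq> 0"
  shows "\<exists>P Q. mdet P \<noteq> 0 \<and> mdet Q \<noteq> 0 \<and> m = mmul (mmul P (1, 0, 0, 0)) Q"
proof -
  obtain a b c e where m: "m = (a, b, c, e)" by (cases m)
  have d: "a * e = b * c" using assms m by simp
  have "\<exists>R1 R2 l1 l2. (R1 \<noteq> 0 \<or> R2 \<noteq> 0) \<and> (l1 \<noteq> 0 \<or> l2 \<noteq> 0) \<and> a = R1 * l1 \<and> b = R1 * l2 \<and> c = R2 * l1 \<and> e = R2 * l2"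
  proof (cases "a = 0 \<and> b = 0")
    case True
    then show ?thesis using assms(2) m
      by (intro exI[of _ 0] exI[of _ 1] exI[of _ c] exI[of _ e]) (auto simp: zero_prod_def)
  next
    case False
    show ?thesis
    proof (cases "a = 0")
      case True
      then have "b \<noteq> 0" "c = 0" using False d by auto
      then show ?thesis using True by (intro exI[of _ 1] exI[of _ "e / b"] exI[of _ a] exI[of _ b]) auto
    next
      case a: False
      then show ?thesis using d
        by (intro exI[of _ 1] exI[of _ "c / a"] exI[of _ a] exI[of _ b]) (auto simp: field_simps)
    qed
  qed
  then obtain R1 R2 l1 l2 where R: "R1 \<noteq> 0 \<or> R2 \<noteq> 0" "l1 \<noteq> 0 \<or> l2 \<noteq> 0"
    "a = R1 * l1" "b = R1 * l2" "c = R2 * l1" "e = R2 * l2" by blast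
  \<comment> \<open>The unit vector that completes the column or row is chosen so that the
    determinant is plus or minus a nonzero entry.\<close>
  define P where "P = (if R1 \<noteq> 0 then (R1, 0, R2, 1) else (R1, 1, R2, 0) :: mat2)"
  define Q where "Q = (if l1 \<noteq> 0 then (l1, l2, 0, 1) else (l1, l2, 1, 0) :: mat2)"
  have "mdet P \<noteq> 0" "mdet Q \<noteq> 0" "m = mmul (mmul P (1, 0, 0, 0)) Q"
    using R by (auto simp: P_def Q_def m)
  then show ?thesis by blast
qed

text \<open>If the limit were singular, fixed changes of coordinates \<open>P\<close> and
  \<open>Q\<close> would turn it into \<open>(1, 0, 0, 0)\<close>. By
  \<open>degenerate_limit\<close> a coefficient of index \<open>i\<close> of one transformed limit
  form times one of larger index \<open>j\<close> of the other is then 0, contrary to the nonzero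
  coefficients with \<open>i \<le> p + 1\<close> and \<open>j \<ge> p + 2\<close>.\<close>

lemma no_singular_limit:
  fixes m :: "nat \<Rightarrow> mat2"
  assumes lim: "m \<longlonglongrightarrow> m'" and m': "m' \<noteq> 0" and det: "\<And>n. mdet (m n) \<noteq> 0"
    and deg: "\<And>n. degree (F n) \<le> p + q + 3" "\<And>n. degree (G n) \<le> p + q + 3"
    and eq: "\<And>n. F n = smult (\<kappa> n) (form_act (p + q + 3) (m n) (G n))"
    and cF: "\<And>i. (\<lambda>n. coeff (F n) i) \<longlonglongrightarrow> coeff (hpoly (q + 3) * r) i" and r: "r \<noteq> 0" "degree r \<le> p"
    and cG: "\<And>i. (\<lambda>n. coeff (G n) i) \<longlonglongrightarrow> coeff (kpoly (p + 3) * s) i" and s: "s \<noteq> 0" "degree s \<le> q"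
  shows "mdet m' \<noteq> 0"
proof
  let ?d = "p + q + 3"
  assume "mdet m' = 0"
  then obtain P Q where PQ: "mdet P \<noteq> 0" "mdet Q \<noteq> 0" "m' = mmul (mmul P (1, 0, 0, 0)) Q"
    using singular_factorisation m' by blast
  define N where "N n = mscale (1 / (mdet P * mdet Q)) (mmul (mmul (madj P) (m n)) (madj Q))" for n
  define F2 where "F2 n = form_act ?d (madj Q) (F n)" for n
  define G2 where "G2 n = form_act ?d P (G n)" for n
  have E: "mscale (1 / (mdet P * mdet Q)) (mmul (mmul (madj P) m') (madj Q)) = (1, 0, 0, 0)"
  proof -
    have "mmul (mmul (madj P) m') (madj Q) = mscale (mdet P * mdet Q) (1, 0, 0, 0)"
      unfolding PQ(3) by (cases P; cases Q) (simp add: algebra_simps)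
    then show ?thesis using PQ by simp
  qed
  have "N \<longlonglongrightarrow> mscale (1 / (mdet P * mdet Q)) (mmul (mmul (madj P) m') (madj Q))"
    unfolding N_def by (intro tendsto_intros lim)
  then have lN: "N \<longlonglongrightarrow> (1, 0, 0, 0)" unfolding E .
  have detN: "mdet (N n) \<noteq> 0" for n unfolding N_def using PQ det[of n] by (simp add: mdet_mscale mdet_mmul)
  have PN: "mmul P (N n) = mscale (1 / mdet Q) (mmul (m n) (madj Q))" for n
  proof -
    have "mmul P (mmul (mmul (madj P) M) A) = mscale (mdet P) (mmul M A)" for M A
      by (cases P; cases M; cases A) (simp add: algebra_simps)
    moreover have "mmul P (mscale k M) = mscale k (mmul P M)" for k M
      by (cases P; cases M) (simp add: algebra_simps)
    moreover have "mscale k (mscale l M) = mscale (k * l) M" for k l M by (cases M) (simp add: mult.assoc)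
    ultimately show ?thesis unfolding N_def using PQ by simp
  qed
  have eq2: "F2 n = smult (\<kappa> n * mdet Q ^ ?d) (form_act ?d (N n) (G2 n))" for n
  proof -
    have "form_act ?d (N n) (G2 n) = form_act ?d (mmul P (N n)) (G n)"
      unfolding G2_def by (rule form_act_mmul[OF detN deg(2)])
    also have "\<dots> = smult ((1 / mdet Q) ^ ?d) (form_act ?d (mmul (m n) (madj Q)) (G n))"
      unfolding PN by (rule form_act_mscale)
    also have "form_act ?d (mmul (m n) (madj Q)) (G n) = form_act ?d (madj Q) (form_act ?d (m n) (G n))"
      by (rule form_act_mmul[symmetric]) (use PQ deg in auto)
    finally show ?thesis unfolding F2_def eq using PQ(2)
      by (simp add: form_act_smult power_one_over mult.assoc)
  qed
  have z: "coeff (form_act ?d (madj Q) (hpoly (q + 3) * r)) i * coeff (form_act ?d P (kpoly (p + 3) * s)) j = 0"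
    if "i < j" "j \<le> ?d" for i j
  proof (rule degenerate_limit[where a = "\<lambda>n. fst (N n)" and b = "\<lambda>n. fst (snd (N n))" and c = "\<lambda>n. fst (snd (snd (N n)))"
        and e = "\<lambda>n. snd (snd (snd (N n)))" and F = F2 and G = G2 and \<kappa> = "\<lambda>n. \<kappa> n * mdet Q ^ ?d" and d = ?d])
    show "(\<lambda>n. fst (N n)) \<longlonglongrightarrow> 1" "(\<lambda>n. fst (snd (N n))) \<longlonglongrightarrow> 0" "(\<lambda>n. fst (snd (snd (N n)))) \<longlonglongrightarrow> 0"
      "(\<lambda>n. snd (snd (snd (N n)))) \<longlonglongrightarrow> 0"
      using tendsto_fst[OF lN] tendsto_fst[OF tendsto_snd[OF lN]] tendsto_fst[OF tendsto_snd[OF tendsto_snd[OF lN]]]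
        tendsto_snd[OF tendsto_snd[OF tendsto_snd[OF lN]]] by simp_all
    show "\<And>i. (\<lambda>n. coeff (F2 n) i) \<longlonglongrightarrow> coeff (form_act ?d (madj Q) (hpoly (q + 3) * r)) i"
      unfolding F2_def by (intro tendsto_form_act_mat tendsto_const cF)
    show "\<And>i. (\<lambda>n. coeff (G2 n) i) \<longlonglongrightarrow> coeff (form_act ?d P (kpoly (p + 3) * s)) i"
      unfolding G2_def by (intro tendsto_form_act_mat tendsto_const cG)
  qed (use that detN eq2 in \<open>simp_all add: F2_def G2_def degree_form_act\<close>)
  obtain i where i: "i \<le> p + 1" "coeff (form_act ?d (madj Q) (hpoly (q + 3) * r)) i \<noteq> 0"
    using low_coeff_exists[of "madj Q" r p q] PQ r by auto
  obtain j where j: "j \<ge> p + 2" "coeff (form_act ?d P (kpoly (p + 3) * s)) j \<noteq> 0"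
    using high_coeff_exists[OF PQ(1) s, of p] by auto
  have "j \<le> ?d" using j(2) degree_form_act[of ?d P] le_degree order_trans by blast
  then show False using z[of i j] i j by simp
qed

section \<open>Counting solutions in a family\<close>

lemma mscale_of_real: "mscale (of_real r) m = r *\<^sub>R m"
  by (cases m) (simp add: scaleR_conv_of_real)

definition tpt :: "(nat \<Rightarrow> complex) \<Rightarrow> triple" where "tpt x = (x 0, x 1, x 2)"

lemma tpt_pt [simp]: "tpt (pt y t) = y"
  by (auto simp: tpt_def pt_def proj_def)

lemma polyfun_proj_tpt: "polyfun (\<lambda>x. proj k (tpt x))"
  unfolding proj_def tpt_def by (cases "k = 0"; cases "k = 1") (simp_all add: polyfun.var)

lemma polyfun_chart_scalar: "polyfun (\<lambda>x. chart_scalar z (tpt x) k)"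
proof -
  have d: "polyfun (\<lambda>x. (proj i (tpt x) - proj j (tpt x)) / c)" for i j c
    unfolding divide_inverse by (intro polyfun_proj_tpt polyfun_diff polyfun.mult polyfun.const)
  show ?thesis unfolding chart_scalar_def by (cases "k = 0"; cases "k = 1") (simp_all only: if_True if_False d refl simp_thms zero_neq_one one_neq_zero)
qed

lemma polyfun_chart:
  "polyfun (\<lambda>x. chart_a z (tpt x))" "polyfun (\<lambda>x. chart_b z (tpt x))"
  "polyfun (\<lambda>x. chart_c z (tpt x))" "polyfun (\<lambda>x. chart_e z (tpt x))"
  unfolding chart_b_def chart_e_def unfolding chart_a_def chart_c_def divide_inverse
  by (intro polyfun_proj_tpt polyfun_diff polyfun.mult polyfun.const polyfun_chart_scalar)+

lemma continuous_on_chart: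
  assumes "continuous_on A f"
  shows "continuous_on A (\<lambda>v. chart_a z (f v))" "continuous_on A (\<lambda>v. chart_b z (f v))"
    "continuous_on A (\<lambda>v. chart_c z (f v))" "continuous_on A (\<lambda>v. chart_e z (f v))"
  using continuous_on_polyfun[OF polyfun_chart(1) assms continuous_on_const, of z 0]
    continuous_on_polyfun[OF polyfun_chart(2) assms continuous_on_const, of z 0]
    continuous_on_polyfun[OF polyfun_chart(3) assms continuous_on_const, of z 0]
    continuous_on_polyfun[OF polyfun_chart(4) assms continuous_on_const, of z 0] by simp_all

lemma open_tdistinct: "open {y. tdistinct y}"
proof -
  have "open {y :: triple. proj i y \<noteq> proj j y}" for i j
    by (intro open_Collect_neq continuous_on_proj continuous_on_id)
  then show ?thesis unfolding tdistinct_def by (intro open_Collect_conj)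
qed

text \<open>Proportionality of two chart matrices is a closed condition on the pair of points, and
  distinctness of coordinates is open; so different classes stay different on small balls.\<close>

lemma charts_separated:
  assumes z: "tdistinct z" "tdistinct z'" and w: "tdistinct w" "tdistinct w'"
    and ne: "pgl_class (chart z w) \<noteq> pgl_class (chart z' w')"
  shows "\<exists>r>0. \<forall>y y'. y \<in> cball w r \<longrightarrow> y' \<in> cball w' r \<longrightarrow> pgl_class (chart z y) \<noteq> pgl_class (chart z' y')"
proof -
  let ?S = "{v :: triple \<times> triple. mprop (chart z (fst v)) (chart z' (snd v))}"
  have "closed ?S" unfolding mprop_def chart_def prod.case
    by (intro closed_Collect_conj closed_Collect_eq continuous_intros continuous_on_chart)
  moreover have "open {v :: triple \<times> triple. tdistinct (fst v)}" "open {v :: triple \<times> triple. tdistinct (snd v)}"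
    using open_vimage[OF open_tdistinct, of fst] open_vimage[OF open_tdistinct, of snd]
    by (simp_all add: vimage_def continuous_on_fst continuous_on_snd continuous_on_id)
  ultimately have "open (- ?S \<inter> ({v. tdistinct (fst v)} \<inter> {v. tdistinct (snd v)}))"
    by (intro open_Int) auto
  moreover have "(w, w') \<in> - ?S \<inter> ({v. tdistinct (fst v)} \<inter> {v. tdistinct (snd v)})"
    using ne mprop_iff[OF mdet_chart[OF z(1) w(1)] mdet_chart[OF z(2) w(2)]] w by simp
  ultimately obtain U V where UV: "open U" "open V" "w \<in> U" "w' \<in> V"
    "U \<times> V \<subseteq> - ?S \<inter> ({v. tdistinct (fst v)} \<inter> {v. tdistinct (snd v)})"
    by (rule open_prod_elim) blast
  obtain r1 where r1: "r1 > 0" "cball w r1 \<subseteq> U" using UV open_contains_cball by blast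
  obtain r2 where r2: "r2 > 0" "cball w' r2 \<subseteq> V" using UV open_contains_cball by blast
  show ?thesis
  proof (intro exI[of _ "min r1 r2"] conjI allI impI)
    fix y y' assume "y \<in> cball w (min r1 r2)" "y' \<in> cball w' (min r1 r2)"
    then have "y \<in> cball w r1" "y' \<in> cball w' r2" by auto
    then have "(y, y') \<in> U \<times> V" using r1 r2 by blast
    then have y: "tdistinct y" "tdistinct y'" "\<not> mprop (chart z y) (chart z' y')" using UV(5) by auto
    then show "pgl_class (chart z y) \<noteq> pgl_class (chart z' y')"
      using mprop_iff[OF mdet_chart[OF z(1) y(1)] mdet_chart[OF z(2) y(2)]] by blast
  qed (use r1 r2 in auto)
qed

text \<open>Sources of a matching; \<open>wt\<close> below gives the targets. The chart at
  \<open>zt \<mu>\<close> with values \<open>wt \<mu>\<close> is the substitution realising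
  \<open>\<mu>\<close>.\<close>

definition zt :: "((nat \<times> nat \<times> nat) \<times> (nat \<times> nat \<times> nat)) \<Rightarrow> triple" where
  "zt \<mu> = (zp (tsel 0 (fst \<mu>)), zp (tsel 1 (fst \<mu>)), zp (tsel 2 (fst \<mu>)))"
definition wt :: "((nat \<times> nat \<times> nat) \<times> (nat \<times> nat \<times> nat)) \<Rightarrow> triple" where
  "wt \<mu> = (wp (tsel 0 (snd \<mu>)), wp (tsel 1 (snd \<mu>)), wp (tsel 2 (snd \<mu>)))"

lemma proj_zt: "k < 3 \<Longrightarrow> proj k (zt \<mu>) = zp (tsel k (fst \<mu>))"
  using less_3_cases[of k] by (auto simp: zt_def)

lemma proj_wt: "k < 3 \<Longrightarrow> proj k (wt \<mu>) = wp (tsel k (snd \<mu>))"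
  using less_3_cases[of k] by (auto simp: wt_def)

lemma tdistinct_zt: "\<mu> \<in> matchings q p \<Longrightarrow> tdistinct (zt \<mu>)"
  by (auto simp: matchings_def tdistinct_def zt_def proj_def tsel_def zp_inj)

lemma tdistinct_wt: "\<mu> \<in> matchings q p \<Longrightarrow> tdistinct (wt \<mu>)"
  by (auto simp: matchings_def tdistinct_def wt_def proj_def tsel_def wp_inj)

lemma matched_chart:
  assumes "\<mu> \<in> matchings q p" "k < 3"
  shows "matched (chart (zt \<mu>) (wt \<mu>)) (tsel k (fst \<mu>)) (tsel k (snd \<mu>))"
  using chart_point[OF tdistinct_zt[OF assms(1)] assms(2), of "wt \<mu>"] proj_zt[OF assms(2)] proj_wt[OF assms(2)]
  by (simp add: chart_def matched_simp mult.commute)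

text \<open>Being matched is invariant under scaling, so equal classes would match both triples by
  one matrix, which \<open>matching_unique\<close> excludes.\<close>

lemma chart_classes_distinct:
  assumes "\<mu> \<in> matchings q p" "\<nu> \<in> matchings q p" "\<mu> \<noteq> \<nu>"
  shows "pgl_class (chart (zt \<mu>) (wt \<mu>)) \<noteq> pgl_class (chart (zt \<nu>) (wt \<nu>))"
proof
  let ?m = "chart (zt \<mu>) (wt \<mu>)" and ?n = "chart (zt \<nu>) (wt \<nu>)"
  assume "pgl_class ?m = pgl_class ?n"
  then obtain k where k: "k \<noteq> 0" "?n = mscale k ?m" unfolding pgl_class_eq_iff by blast
  have "matched ?m i j" if "matched (mscale k ?m) i j" for i j
  proof -
    obtain a b c e where m: "?m = (a, b, c, e)" by (cases ?m)
    have "k * (a * zp i + b) = k * (wp j * (c * zp i + e))" using that by (simp add: m matched_simp algebra_simps)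
    then show ?thesis using k(1) by (simp add: m matched_simp)
  qed
  then have "matched ?m (tsel l (fst \<nu>)) (tsel l (snd \<nu>))" if "l < 3" for l
    using matched_chart[OF assms(2) that] k(2) by metis
  then have "\<mu> = \<nu>"
    using matching_unique[OF mdet_chart[OF tdistinct_zt[OF assms(1)] tdistinct_wt[OF assms(1)]] assms(1,2)]
      matched_chart[OF assms(1)] by blast
  then show False using assms(3) by simp
qed

section \<open>Compactness and the count near the special pair\<close>

lemma bounded_coeffs_subsequence:
  fixes g :: "nat \<Rightarrow> complex poly"
  assumes deg: "\<And>n. degree (g n) \<le> d" and bd: "\<And>n i. cmod (coeff (g n) i) \<le> 1"
  shows "\<exists>r g'. strict_mono r \<and> degree g' \<le> d \<and> (\<forall>i. (\<lambda>n. coeff (g (r n)) i) \<longlonglongrightarrow> coeff g' i)"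
proof -
  have "\<exists>r l. strict_mono (r :: nat \<Rightarrow> nat) \<and> (\<forall>i<k. (\<lambda>n. coeff (g (r n)) i) \<longlonglongrightarrow> l i)" for k
  proof (induction k)
    case 0
    show ?case by (intro exI[of _ id]) (simp add: strict_mono_def)
  next
    case (Suc k)
    then obtain r l where r: "strict_mono (r :: nat \<Rightarrow> nat)" "\<forall>i<k. (\<lambda>n. coeff (g (r n)) i) \<longlonglongrightarrow> l i" by blast
    have "\<exists>l'\<in>cball 0 1. \<exists>r'. strict_mono (r' :: nat \<Rightarrow> nat) \<and> ((\<lambda>n. coeff (g (r n)) k) \<circ> r') \<longlonglongrightarrow> l'"
      using compact_cball[of "0::complex" 1, unfolded compact_def, THEN spec, of "\<lambda>n. coeff (g (r n)) k"] bd by simp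
    then obtain l' r' where r': "strict_mono (r' :: nat \<Rightarrow> nat)" "((\<lambda>n. coeff (g (r n)) k) \<circ> r') \<longlonglongrightarrow> l'" by blast
    have "(\<lambda>n. coeff (g ((r \<circ> r') n)) i) \<longlonglongrightarrow> (l(k := l')) i" if "i < Suc k" for i
    proof (cases "i = k")
      case True
      then show ?thesis using r'(2) by (simp add: comp_def)
    next
      case False
      then have "(\<lambda>n. coeff (g (r n)) i) \<longlonglongrightarrow> l i" using that r(2) by simp
      from LIMSEQ_subseq_LIMSEQ[OF this r'(1)] show ?thesis using False by (simp add: comp_def)
    qed
    moreover have "strict_mono (r \<circ> r')" using r(1) r'(1) by (rule strict_mono_o)
    ultimately show ?case by blast
  qed
  then obtain r l where r: "strict_mono (r :: nat \<Rightarrow> nat)" "\<forall>i<Suc d. (\<lambda>n. coeff (g (r n)) i) \<longlonglongrightarrow> l i" by blast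
  define g' where "g' = (\<Sum>i\<le>d. monom (l i) i)"
  have c: "coeff g' i = (if i \<le> d then l i else 0)" for i
    unfolding g'_def by (simp add: coeff_sum sum.delta' cong: if_cong)
  have "degree g' \<le> d" by (rule degree_le) (simp add: c)
  moreover have "(\<lambda>n. coeff (g (r n)) i) \<longlonglongrightarrow> coeff g' i" for i
  proof (cases "i \<le> d")
    case True
    then show ?thesis using r(2) c by simp
  next
    case False
    then have "coeff (g (r n)) i = 0" for n using deg[of "r n"] by (intro coeff_eq_0) simp
    then show ?thesis using False c by simp
  qed
  ultimately show ?thesis using r(1) by blast
qed

text \<open>A continuous normalisation of forms of bounded degree: limits of forms of norm 1 are
  nonzero.\<close>

definition coeff_norm :: "nat \<Rightarrow> complex poly \<Rightarrow> real" where
  "coeff_norm d p = (\<Sum>i\<le>d. cmod (coeff p i))"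

lemma coeff_norm_pos: "degree p \<le> d \<Longrightarrow> p \<noteq> 0 \<Longrightarrow> coeff_norm d p > 0"
  unfolding coeff_norm_def by (rule sum_pos2[of _ "degree p"]) auto

lemma coeff_norm_smult: "coeff_norm d (smult k p) = cmod k * coeff_norm d p"
  by (simp add: coeff_norm_def norm_mult sum_distrib_left)

lemma coeff_le_coeff_norm: "degree p \<le> d \<Longrightarrow> cmod (coeff p i) \<le> coeff_norm d p"
proof -
  assume d: "degree p \<le> d"
  show ?thesis
  proof (cases "i \<le> d")
    case True
    then show ?thesis unfolding coeff_norm_def by (intro member_le_sum) auto
  next
    case False
    then have "coeff p i = 0" using d by (intro coeff_eq_0) simp
    then show ?thesis by (simp add: coeff_norm_def sum_nonneg)
  qed
qed

lemma coeff_norm_limit: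
  assumes "\<And>i. (\<lambda>n. coeff (g n) i) \<longlonglongrightarrow> coeff g' i" "\<And>n. coeff_norm d (g n) = 1"
  shows "g' \<noteq> 0"
proof
  assume g: "g' = 0"
  have "(\<lambda>n. coeff_norm d (g n)) \<longlonglongrightarrow> coeff_norm d g'"
    unfolding coeff_norm_def by (intro tendsto_intros assms)
  then have "coeff_norm d g' = 1" using assms(2) by (simp add: LIMSEQ_const_iff)
  then show False by (simp add: g coeff_norm_def)
qed

definition sols :: "nat \<Rightarrow> complex poly set \<Rightarrow> complex poly set \<Rightarrow> mat2 set" where
  "sols d V W = {m. mdet m \<noteq> 0 \<and> (\<exists>g\<in>W. g \<noteq> 0 \<and> form_act d m g \<in> V)}"

text \<open>Stability under nonzero scalars allows solutions to be normalised before limits are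
  taken.\<close>

definition cone :: "nat \<Rightarrow> complex poly set \<Rightarrow> bool" where
  "cone d V \<longleftrightarrow> (\<forall>f\<in>V. degree f \<le> d \<and> (\<forall>k. k \<noteq> 0 \<longrightarrow> smult k f \<in> V))"

text \<open>Semicontinuity of the family at \<open>t = 0\<close> in terms of sequences: limits of
  members at parameters tending to 0 belong to the special space.\<close>

definition closed_at_0 :: "nat \<Rightarrow> (complex \<Rightarrow> complex poly set) \<Rightarrow> complex poly set \<Rightarrow> bool" where
  "closed_at_0 d V V0 \<longleftrightarrow> (\<forall>t f f'. t \<longlonglongrightarrow> 0 \<longrightarrow> (\<forall>n. f n \<in> V (t n)) \<longrightarrow> degree f' \<le> d \<longrightarrow>
    (\<forall>i. (\<lambda>n. coeff (f n) i) \<longlonglongrightarrow> coeff f' i) \<longrightarrow> f' \<in> V0)"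

lemma sols_mscale: "cone d V \<Longrightarrow> m \<in> sols d V W \<Longrightarrow> k \<noteq> 0 \<Longrightarrow> mscale k m \<in> sols d V W"
  unfolding sols_def cone_def by (auto simp: form_act_mscale mdet_mscale)

lemma tendsto_0_of_less_inverse:
  fixes t :: "nat \<Rightarrow> complex"
  assumes "\<And>n. cmod (t n) < inverse (real (Suc n))"
  shows "t \<longlonglongrightarrow> 0"
proof (rule tendsto_norm_zero_cancel, rule tendsto_sandwich)
  show "\<forall>\<^sub>F n in sequentially. (0::real) \<le> norm (t n)" by simp
  show "\<forall>\<^sub>F n in sequentially. norm (t n) \<le> inverse (real (Suc n))" using assms by (simp add: less_imp_le)
  show "(\<lambda>n. inverse (real (Suc n))) \<longlonglongrightarrow> 0" by (rule LIMSEQ_inverse_real_of_nat)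
qed simp

text \<open>Otherwise bad solutions exist for parameters tending to 0. After normalisation a
  subsequence of matrices and forms converges; the limit matrix is invertible by
  \<open>no_singular_limit\<close> and solves the special problem, hence matches some
  \<open>\<mu>\<close>. Then the values of the matrices at the sources converge to
  \<open>wt \<mu>\<close>, contradicting badness.\<close>

lemma sols_near_matching:
  assumes cone: "\<And>t. cone (p + q + 3) (V t)" "\<And>t. cone (p + q + 3) (W t)"
    and cV: "closed_at_0 (p + q + 3) V {hpoly (q + 3) * r | r. degree r \<le> p}"
    and cW: "closed_at_0 (p + q + 3) W {kpoly (p + 3) * s | s. degree s \<le> q}"
    and \<epsilon>: "\<epsilon> > 0"
  shows "\<exists>\<delta>>0. \<forall>t. cmod t < \<delta> \<longrightarrow> (\<forall>m\<in>sols (p + q + 3) (V t) (W t).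
    \<exists>\<mu>\<in>matchings q p. \<exists>y\<in>cball (wt \<mu>) \<epsilon>. pgl_class m = pgl_class (chart (zt \<mu>) y))"
proof (rule ccontr)
  let ?d = "p + q + 3"
  define good where "good m \<longleftrightarrow> (\<exists>\<mu>\<in>matchings q p. \<exists>y\<in>cball (wt \<mu>) \<epsilon>. pgl_class m = pgl_class (chart (zt \<mu>) y))" for m
  assume "\<not> ?thesis"
  then have neg: "\<forall>\<delta>>0. \<exists>t. cmod t < \<delta> \<and> (\<exists>m\<in>sols ?d (V t) (W t). \<not> good m)" unfolding good_def by meson
  have "\<forall>n. \<exists>tm. cmod (fst tm) < inverse (real (Suc n)) \<and> snd tm \<in> sols ?d (V (fst tm)) (W (fst tm)) \<and> \<not> good (snd tm)"
  proof
    fix n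
    obtain t m where "cmod t < inverse (real (Suc n))" "m \<in> sols ?d (V t) (W t)" "\<not> good m"
      using neg[rule_format, of "inverse (real (Suc n))"] by auto
    then show "\<exists>tm. cmod (fst tm) < inverse (real (Suc n)) \<and> snd tm \<in> sols ?d (V (fst tm)) (W (fst tm)) \<and> \<not> good (snd tm)"
      by (intro exI[of _ "(t, m)"]) simp
  qed
  from choice[OF this] obtain tm where tm: "\<And>n. cmod (fst (tm n)) < inverse (real (Suc n))"
    "\<And>n. snd (tm n) \<in> sols ?d (V (fst (tm n))) (W (fst (tm n)))" "\<And>n. \<not> good (snd (tm n))" by blast
  define t where "t n = fst (tm n)" for n
  define M where "M n = mscale (of_real (inverse (norm (snd (tm n))))) (snd (tm n))" for n
  have nz: "snd (tm n) \<noteq> 0" for n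
  proof
    assume "snd (tm n) = 0"
    then have "mdet (snd (tm n)) = 0" by (simp add: zero_prod_def)
    then show False using tm(2)[of n] by (simp add: sols_def)
  qed
  have t0: "t \<longlonglongrightarrow> 0" by (rule tendsto_0_of_less_inverse) (simp add: t_def tm(1) del: of_nat_Suc)
  have knz: "of_real (inverse (norm (snd (tm n)))) \<noteq> (0::complex)" for n using nz by simp
  have Ms: "M n \<in> sols ?d (V (t n)) (W (t n))" for n
    unfolding M_def t_def by (rule sols_mscale[OF cone(1) tm(2) knz])
  have Mg: "\<not> good (M n)" for n
    using tm(3)[of n] unfolding good_def M_def pgl_class_mscale[OF knz] .
  have Mn: "norm (M n) = 1" for n unfolding M_def mscale_of_real using nz[of n] by simp
  have Md: "mdet (M n) \<noteq> 0" for n using Ms by (simp add: sols_def)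
  have "\<forall>n. \<exists>g. g \<in> W (t n) \<and> g \<noteq> 0 \<and> form_act ?d (M n) g \<in> V (t n)" using Ms unfolding sols_def by blast
  from choice[OF this] obtain g where g: "\<And>n. g n \<in> W (t n)" "\<And>n. g n \<noteq> 0" "\<And>n. form_act ?d (M n) (g n) \<in> V (t n)" by blast
  have gd: "degree (g n) \<le> ?d" for n using g(1) cone(2) unfolding cone_def by blast
  define G where "G n = smult (of_real (inverse (coeff_norm ?d (g n)))) (g n)" for n
  have kg: "of_real (inverse (coeff_norm ?d (g n))) \<noteq> (0::complex)" "coeff_norm ?d (g n) > 0" for n
    using coeff_norm_pos[OF gd g(2), of n] by simp_all
  have GW: "G n \<in> W (t n)" for n using g(1) cone(2) kg unfolding cone_def G_def by blast
  have Gn: "coeff_norm ?d (G n) = 1" for n unfolding G_def coeff_norm_smult using kg(2)[of n] by (simp add: norm_inverse)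
  have Gd: "degree (G n) \<le> ?d" for n using GW cone(2) unfolding cone_def by blast
  have G0: "G n \<noteq> 0" for n using Gn[of n] by (auto simp: coeff_norm_def)
  define f where "f n = form_act ?d (M n) (G n)" for n
  have fV: "f n \<in> V (t n)" for n
    using g(3)[of n] cone(1) kg(1)[of n] unfolding cone_def f_def G_def form_act_smult by blast
  have fd: "degree (f n) \<le> ?d" for n by (simp add: f_def degree_form_act)
  have f0: "f n \<noteq> 0" for n unfolding f_def using form_act_eq_0_iff[OF Md Gd] G0 by blast
  \<comment> \<open>The transforms \<open>f n\<close> may tend to 0 as long as the limit matrix is
    not known to be invertible, so they get a normalisation of their own.\<close>
  define F where "F n = smult (of_real (inverse (coeff_norm ?d (f n)))) (f n)" for n
  have kf: "of_real (inverse (coeff_norm ?d (f n))) \<noteq> (0::complex)" "coeff_norm ?d (f n) > 0" for n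
    using coeff_norm_pos[OF fd f0, of n] by simp_all
  have FV: "F n \<in> V (t n)" for n using fV cone(1) kf unfolding cone_def F_def by blast
  have Fn: "coeff_norm ?d (F n) = 1" for n unfolding F_def coeff_norm_smult using kf(2)[of n] by (simp add: norm_inverse)
  have Fd: "degree (F n) \<le> ?d" for n using FV cone(1) unfolding cone_def by blast
  have "\<forall>n. M n \<in> sphere 0 1" using Mn by simp
  then obtain m' r1 where r1: "m' \<in> sphere 0 1" "strict_mono (r1 :: nat \<Rightarrow> nat)" "(M \<circ> r1) \<longlonglongrightarrow> m'"
    using compact_sphere[of "0::mat2" 1] unfolding compact_def by blast
  obtain r2 G' where r2: "strict_mono (r2 :: nat \<Rightarrow> nat)" "degree G' \<le> ?d" "\<And>i. (\<lambda>n. coeff (G (r1 (r2 n))) i) \<longlonglongrightarrow> coeff G' i"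
    using bounded_coeffs_subsequence[of "\<lambda>n. G (r1 n)" ?d] Gd coeff_le_coeff_norm[OF Gd] Gn by auto
  obtain r3 F' where r3: "strict_mono (r3 :: nat \<Rightarrow> nat)" "degree F' \<le> ?d" "\<And>i. (\<lambda>n. coeff (F (r1 (r2 (r3 n)))) i) \<longlonglongrightarrow> coeff F' i"
    using bounded_coeffs_subsequence[of "\<lambda>n. F (r1 (r2 n))" ?d] Fd coeff_le_coeff_norm[OF Fd] Fn by auto
  define r where "r n = r1 (r2 (r3 n))" for n
  have sr23: "strict_mono (r2 \<circ> r3)" and sr: "strict_mono r"
    using strict_mono_o[OF r2(1) r3(1)] strict_mono_o[OF r1(2) strict_mono_o[OF r2(1) r3(1)]]
    by (simp_all add: r_def[abs_def] comp_def)
  have lM: "(\<lambda>n. M (r n)) \<longlonglongrightarrow> m'"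
    using LIMSEQ_subseq_LIMSEQ[OF r1(3) sr23] by (simp add: r_def comp_def)
  have lG: "(\<lambda>n. coeff (G (r n)) i) \<longlonglongrightarrow> coeff G' i" for i
    using LIMSEQ_subseq_LIMSEQ[OF r2(3) r3(1), of i] by (simp add: r_def comp_def)
  have lF: "(\<lambda>n. coeff (F (r n)) i) \<longlonglongrightarrow> coeff F' i" for i using r3(3) by (simp add: r_def)
  have lt: "(\<lambda>n. t (r n)) \<longlonglongrightarrow> 0" using LIMSEQ_subseq_LIMSEQ[OF t0 sr] by (simp add: comp_def)
  have G'0: "G' \<noteq> 0" by (rule coeff_norm_limit[OF lG Gn])
  have F'0: "F' \<noteq> 0" by (rule coeff_norm_limit[OF lF Fn])
  have "G' \<in> {kpoly (p + 3) * s | s. degree s \<le> q}"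
    using cW[unfolded closed_at_0_def, rule_format, OF lt GW r2(2) lG] .
  then obtain s where s: "G' = kpoly (p + 3) * s" "degree s \<le> q" by blast
  have "F' \<in> {hpoly (q + 3) * r | r. degree r \<le> p}"
    using cV[unfolded closed_at_0_def, rule_format, OF lt FV r3(2) lF] .
  then obtain \<rho> where \<rho>: "F' = hpoly (q + 3) * \<rho>" "degree \<rho> \<le> p" by blast
  have s0: "s \<noteq> 0" and \<rho>0: "\<rho> \<noteq> 0" using G'0 F'0 s \<rho> by auto
  have m'0: "m' \<noteq> 0" using r1(1) by auto
  have det': "mdet m' \<noteq> 0"
  proof (rule no_singular_limit[OF lM m'0])
    show "F (r n) = smult (of_real (inverse (coeff_norm ?d (f (r n))))) (form_act ?d (M (r n)) (G (r n)))" for n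
      by (simp add: F_def f_def)
    show "(\<lambda>n. coeff (F (r n)) i) \<longlonglongrightarrow> coeff (hpoly (q + 3) * \<rho>) i" for i using lF \<rho> by simp
    show "(\<lambda>n. coeff (G (r n)) i) \<longlonglongrightarrow> coeff (kpoly (p + 3) * s) i" for i using lG s by simp
  qed (use Md Gd Fd s s0 \<rho> \<rho>0 in simp_all)
  \<comment> \<open>With an invertible limit matrix available, the unnormalised transforms give the
    equation between the limits themselves.\<close>
  have "(\<lambda>n. coeff (f (r n)) i) \<longlonglongrightarrow> coeff (form_act ?d m' G') i" for i
    unfolding f_def by (rule tendsto_form_act_mat[OF lM lG])
  then have "form_act ?d m' G' \<in> {hpoly (q + 3) * r | r. degree r \<le> p}"
    using cV[unfolded closed_at_0_def, rule_format, OF lt fV degree_form_act] by blast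
  then obtain r' where "form_act ?d m' (kpoly (p + 3) * s) = hpoly (q + 3) * r'" using s by blast
  from matching_exists[OF three_matched[OF det' s0 s(2) this] det']
  obtain \<mu> where \<mu>: "\<mu> \<in> matchings q p" "\<forall>k<3. matched m' (tsel k (fst \<mu>)) (tsel k (snd \<mu>))" by blast
  define num where "num m k = fst m * proj k (zt \<mu>) + fst (snd m)" for m :: mat2 and k
  define den where "den m k = fst (snd (snd m)) * proj k (zt \<mu>) + snd (snd (snd m))" for m :: mat2 and k
  have mt: "num m' k = proj k (wt \<mu>) * den m' k" if "k < 3" for k
    using \<mu>(2) that by (cases m') (simp add: num_def den_def matched_simp proj_zt proj_wt)
  have den': "den m' k \<noteq> 0" if "k < 3" for k
  proof (cases m')
    case (fields a b c e)
    have "matched (a, b, c, e) (tsel k (fst \<mu>)) (tsel k (snd \<mu>))" using \<mu>(2) that fields by blast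
    from matched_denominator[OF _ this] det' fields show ?thesis using that by (simp add: den_def proj_zt)
  qed
  have lnum: "(\<lambda>n. num (M (r n)) k) \<longlonglongrightarrow> num m' k" and lden: "(\<lambda>n. den (M (r n)) k) \<longlonglongrightarrow> den m' k" for k
    unfolding num_def den_def by (intro tendsto_intros lM)+
  \<comment> \<open>The images of the three sources under \<open>M (r n)\<close>, that is, the chart
    coordinates of this solution.\<close>
  define Y where "Y n = (num (M (r n)) 0 / den (M (r n)) 0, num (M (r n)) 1 / den (M (r n)) 1, num (M (r n)) 2 / den (M (r n)) 2)" for n
  have pY: "proj k (Y n) = num (M (r n)) k / den (M (r n)) k" if "k < 3" for k n
    using less_3_cases[OF that] by (auto simp: Y_def)
  have "Y \<longlonglongrightarrow> (num m' 0 / den m' 0, num m' 1 / den m' 1, num m' 2 / den m' 2)"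
    unfolding Y_def by (intro tendsto_intros lnum lden den') auto
  also have "(num m' 0 / den m' 0, num m' 1 / den m' 1, num m' 2 / den m' 2) = wt \<mu>"
    by (rule triple_eqI) (use mt den' less_3_cases in fastforce)
  finally have "\<forall>\<^sub>F n in sequentially. dist (Y n) (wt \<mu>) < \<epsilon>" using \<epsilon> by (rule tendstoD)
  moreover have "\<forall>\<^sub>F n in sequentially. den (M (r n)) k \<noteq> 0" if "k < 3" for k
    by (rule tendsto_imp_eventually_ne[OF lden den'[OF that]])
  ultimately have "\<forall>\<^sub>F n in sequentially. dist (Y n) (wt \<mu>) < \<epsilon> \<and> (den (M (r n)) 0 \<noteq> 0 \<and> den (M (r n)) 1 \<noteq> 0 \<and> den (M (r n)) 2 \<noteq> 0)"
    by (intro eventually_conj) auto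
  then obtain n where n: "dist (Y n) (wt \<mu>) < \<epsilon>" "den (M (r n)) 0 \<noteq> 0" "den (M (r n)) 1 \<noteq> 0" "den (M (r n)) 2 \<noteq> 0"
    using eventually_happens' sequentially_bot by blast
  obtain a b c e where me: "M (r n) = (a, b, c, e)" by (cases "M (r n)")
  have "a * proj k (zt \<mu>) + b = proj k (Y n) * (c * proj k (zt \<mu>) + e)" if "k < 3" for k
  proof -
    have "den (M (r n)) k \<noteq> 0" using less_3_cases[OF that] n by auto
    then have "num (M (r n)) k = proj k (Y n) * den (M (r n)) k" by (simp add: pY[OF that])
    then show ?thesis by (simp add: num_def den_def me)
  qed
  from chart_unique(1)[OF tdistinct_zt[OF \<mu>(1)] _ this] Md[of "r n"]
  have "pgl_class (M (r n)) = pgl_class (chart (zt \<mu>) (Y n))" by (simp add: me)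
  then have "good (M (r n))" unfolding good_def using \<mu>(1) n(1) by (auto simp: dist_commute intro!: bexI[of _ \<mu>] bexI[of _ "Y n"])
  then show False using Mg by blast
qed

text \<open>Around every target triple a ball is chosen so small that it contains exactly one
  solution and that balls of different matchings yield different classes. Since every solution lies
  in some ball, classes of solutions correspond bijectively to matchings.\<close>

theorem card_sols_eventually:
  assumes cone: "\<And>t. cone (p + q + 3) (V t)" "\<And>t. cone (p + q + 3) (W t)"
    and cV: "closed_at_0 (p + q + 3) V {hpoly (q + 3) * r | r. degree r \<le> p}"
    and cW: "closed_at_0 (p + q + 3) W {kpoly (p + 3) * s | s. degree s \<le> q}"
    and loc: "\<And>\<mu>. \<mu> \<in> matchings q p \<Longrightarrow> \<exists>\<epsilon>0>0. \<forall>\<epsilon>. 0 < \<epsilon> \<longrightarrow> \<epsilon> \<le> \<epsilon>0 \<longrightarrow>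
      (\<exists>\<delta>>0. \<forall>t. cmod t < \<delta> \<longrightarrow> (\<exists>!y. y \<in> cball (wt \<mu>) \<epsilon> \<and> chart (zt \<mu>) y \<in> sols (p + q + 3) (V t) (W t)))"
  shows "\<exists>\<delta>>0. \<forall>t. cmod t < \<delta> \<longrightarrow> finite (pgl_class ` sols (p + q + 3) (V t) (W t)) \<and>
    card (pgl_class ` sols (p + q + 3) (V t) (W t)) = card (matchings q p)"
proof -
  let ?d = "p + q + 3" and ?T = "matchings q p"
  let ?S = "\<lambda>t. sols ?d (V t) (W t)"
  have fin: "finite ?T" by (rule finite_matchings)
  \<comment> \<open>The inserted 1 provides a value for an empty index set.\<close>
  have min_ex: "\<exists>e>0. \<forall>x\<in>X. e \<le> (f x :: real)" if "finite X" "\<forall>x\<in>X. f x > 0" for X :: "'x set" and f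
    using that by (intro exI[of _ "Min (insert 1 (f ` X))"]) auto
  have "\<forall>\<mu>\<in>?T. \<exists>\<epsilon>0. \<epsilon>0 > 0 \<and> (\<forall>\<epsilon>. 0 < \<epsilon> \<longrightarrow> \<epsilon> \<le> \<epsilon>0 \<longrightarrow>
      (\<exists>\<delta>>0. \<forall>t. cmod t < \<delta> \<longrightarrow> (\<exists>!y. y \<in> cball (wt \<mu>) \<epsilon> \<and> chart (zt \<mu>) y \<in> ?S t)))"
    using loc by blast
  from bchoice[OF this] obtain \<epsilon>0 where e0: "\<forall>\<mu>\<in>?T. \<epsilon>0 \<mu> > 0 \<and> (\<forall>\<epsilon>. 0 < \<epsilon> \<longrightarrow> \<epsilon> \<le> \<epsilon>0 \<mu> \<longrightarrow>
      (\<exists>\<delta>>0. \<forall>t. cmod t < \<delta> \<longrightarrow> (\<exists>!y. y \<in> cball (wt \<mu>) \<epsilon> \<and> chart (zt \<mu>) y \<in> ?S t)))" by blast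
  let ?P = "{x \<in> ?T \<times> ?T. fst x \<noteq> snd x}"
  have "\<forall>x\<in>?P. \<exists>r. r > 0 \<and> (\<forall>y y'. y \<in> cball (wt (fst x)) r \<longrightarrow> y' \<in> cball (wt (snd x)) r \<longrightarrow>
      pgl_class (chart (zt (fst x)) y) \<noteq> pgl_class (chart (zt (snd x)) y'))"
  proof
    fix x assume x: "x \<in> ?P"
    then have x': "fst x \<in> ?T" "snd x \<in> ?T" "fst x \<noteq> snd x" by auto
    show "\<exists>r. r > 0 \<and> (\<forall>y y'. y \<in> cball (wt (fst x)) r \<longrightarrow> y' \<in> cball (wt (snd x)) r \<longrightarrow>
      pgl_class (chart (zt (fst x)) y) \<noteq> pgl_class (chart (zt (snd x)) y'))"
      by (rule charts_separated[OF tdistinct_zt[OF x'(1)] tdistinct_zt[OF x'(2)] tdistinct_wt[OF x'(1)]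
            tdistinct_wt[OF x'(2)] chart_classes_distinct[OF x']])
  qed
  from bchoice[OF this] obtain R where R: "\<forall>x\<in>?P. R x > 0 \<and> (\<forall>y y'. y \<in> cball (wt (fst x)) (R x) \<longrightarrow>
      y' \<in> cball (wt (snd x)) (R x) \<longrightarrow> pgl_class (chart (zt (fst x)) y) \<noteq> pgl_class (chart (zt (snd x)) y'))" by blast
  have "\<forall>\<mu>\<in>?T. \<epsilon>0 \<mu> > 0" using e0 by blast
  from min_ex[OF fin this] obtain \<epsilon>1 where \<epsilon>1: "\<epsilon>1 > 0" "\<forall>\<mu>\<in>?T. \<epsilon>1 \<le> \<epsilon>0 \<mu>" by blast
  have finP: "finite ?P" by (rule finite_subset[of _ "?T \<times> ?T"]) (use fin in auto)
  have "\<forall>x\<in>?P. R x > 0" using R by blast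
  from min_ex[OF finP this] obtain \<epsilon>2 where \<epsilon>2: "\<epsilon>2 > 0" "\<forall>x\<in>?P. \<epsilon>2 \<le> R x" by blast
  define \<epsilon> where "\<epsilon> = min \<epsilon>1 \<epsilon>2"
  have \<epsilon>: "\<epsilon> > 0" using \<epsilon>1 \<epsilon>2 by (simp add: \<epsilon>_def)
  have sep: "\<mu> = \<nu>" if "\<mu> \<in> ?T" "\<nu> \<in> ?T" "y \<in> cball (wt \<mu>) \<epsilon>" "y' \<in> cball (wt \<nu>) \<epsilon>"
    "pgl_class (chart (zt \<mu>) y) = pgl_class (chart (zt \<nu>) y')" for \<mu> \<nu> y y'
  proof (rule ccontr)
    assume "\<mu> \<noteq> \<nu>"
    then have x: "(\<mu>, \<nu>) \<in> ?P" using that by simp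
    have "\<epsilon>2 \<le> R (\<mu>, \<nu>)" using \<epsilon>2(2) x by (rule bspec)
    then have "\<epsilon> \<le> R (\<mu>, \<nu>)" by (simp add: \<epsilon>_def)
    then have "y \<in> cball (wt (fst (\<mu>, \<nu>))) (R (\<mu>, \<nu>))" "y' \<in> cball (wt (snd (\<mu>, \<nu>))) (R (\<mu>, \<nu>))" using that by auto
    then show False using bspec[OF R x] that(5) unfolding fst_conv snd_conv by blast
  qed
  have "\<forall>\<mu>\<in>?T. \<exists>\<delta>. \<delta> > 0 \<and> (\<forall>t. cmod t < \<delta> \<longrightarrow> (\<exists>!y. y \<in> cball (wt \<mu>) \<epsilon> \<and> chart (zt \<mu>) y \<in> ?S t))"
  proof
    fix \<mu> assume mu: "\<mu> \<in> ?T"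
    have "\<epsilon>1 \<le> \<epsilon>0 \<mu>" using \<epsilon>1(2) mu by (rule bspec)
    then have "\<epsilon> \<le> \<epsilon>0 \<mu>" by (simp add: \<epsilon>_def)
    then show "\<exists>\<delta>. \<delta> > 0 \<and> (\<forall>t. cmod t < \<delta> \<longrightarrow> (\<exists>!y. y \<in> cball (wt \<mu>) \<epsilon> \<and> chart (zt \<mu>) y \<in> ?S t))"
      using e0 mu \<epsilon> by blast
  qed
  from bchoice[OF this] obtain D where D: "\<forall>\<mu>\<in>?T. D \<mu> > 0 \<and> (\<forall>t. cmod t < D \<mu> \<longrightarrow>
      (\<exists>!y. y \<in> cball (wt \<mu>) \<epsilon> \<and> chart (zt \<mu>) y \<in> ?S t))" by blast
  have "\<forall>\<mu>\<in>?T. D \<mu> > 0" using D by blast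
  from min_ex[OF fin this] obtain \<delta>1 where \<delta>1: "\<delta>1 > 0" "\<forall>\<mu>\<in>?T. \<delta>1 \<le> D \<mu>" by blast
  obtain \<delta>2 where \<delta>2: "\<delta>2 > 0" "\<And>t m. cmod t < \<delta>2 \<Longrightarrow> m \<in> ?S t \<Longrightarrow>
    \<exists>\<mu>\<in>?T. \<exists>y\<in>cball (wt \<mu>) \<epsilon>. pgl_class m = pgl_class (chart (zt \<mu>) y)"
    using sols_near_matching[OF cone cV cW \<epsilon>] by blast
  show ?thesis
  proof (intro exI[of _ "min \<delta>1 \<delta>2"] conjI allI impI)
    show "min \<delta>1 \<delta>2 > 0" using \<delta>1 \<delta>2 by simp
    fix t assume t: "cmod t < min \<delta>1 \<delta>2"
    have ex1: "\<exists>!y. y \<in> cball (wt \<mu>) \<epsilon> \<and> chart (zt \<mu>) y \<in> ?S t" if "\<mu> \<in> ?T" for \<mu>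
    proof -
      have "\<delta>1 \<le> D \<mu>" using \<delta>1(2) that by (rule bspec)
      then have "cmod t < D \<mu>" using t by simp
      then show ?thesis using D that by blast
    qed
    define Y where "Y \<mu> = (THE y. y \<in> cball (wt \<mu>) \<epsilon> \<and> chart (zt \<mu>) y \<in> ?S t)" for \<mu>
    have Y: "Y \<mu> \<in> cball (wt \<mu>) \<epsilon>" "chart (zt \<mu>) (Y \<mu>) \<in> ?S t" if "\<mu> \<in> ?T" for \<mu>
      using theI'[OF ex1[OF that]] by (simp_all add: Y_def)
    have "pgl_class ` ?S t = (\<lambda>\<mu>. pgl_class (chart (zt \<mu>) (Y \<mu>))) ` ?T"
    proof (intro equalityI subsetI)
      fix \<sigma> assume "\<sigma> \<in> pgl_class ` ?S t"
      then obtain m where m: "m \<in> ?S t" "\<sigma> = pgl_class m" by blast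
      obtain \<mu> y where \<mu>: "\<mu> \<in> ?T" "y \<in> cball (wt \<mu>) \<epsilon>" "pgl_class m = pgl_class (chart (zt \<mu>) y)"
        using \<delta>2(2)[OF _ m(1)] t by auto
      obtain k where k: "k \<noteq> 0" "chart (zt \<mu>) y = mscale k m" using \<mu>(3) unfolding pgl_class_eq_iff by blast
      then have "chart (zt \<mu>) y \<in> ?S t" using sols_mscale[OF cone(1) m(1)] by metis
      then have "y = Y \<mu>" using ex1[OF \<mu>(1)] Y[OF \<mu>(1)] \<mu>(2) by blast
      then show "\<sigma> \<in> (\<lambda>\<mu>. pgl_class (chart (zt \<mu>) (Y \<mu>))) ` ?T" using m \<mu> by blast
    next
      fix \<sigma> assume "\<sigma> \<in> (\<lambda>\<mu>. pgl_class (chart (zt \<mu>) (Y \<mu>))) ` ?T"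
      then show "\<sigma> \<in> pgl_class ` ?S t" using Y by blast
    qed
    moreover have "inj_on (\<lambda>\<mu>. pgl_class (chart (zt \<mu>) (Y \<mu>))) ?T"
      using sep Y(1) by (intro inj_onI) blast
    ultimately show "finite (pgl_class ` ?S t)" "card (pgl_class ` ?S t) = card ?T"
      using fin by (simp_all add: card_image)
  qed
qed

section \<open>Nondegeneracy at the special solutions\<close>

lemma roots_prod_dvd:
  fixes f :: "nat \<Rightarrow> complex"
  assumes "inj f" "\<And>i. i < n \<Longrightarrow> poly g (f i) = 0"
  shows "(\<Prod>i<n. [:- f i, 1:]) dvd (g :: complex poly)"
  using assms(2)
proof (induction n)
  case (Suc n)
  then obtain r where r: "g = (\<Prod>i<n. [:- f i, 1:]) * r" by (metis dvdE less_SucI)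
  have "poly (\<Prod>i<n. [:- f i, 1:]) (f n) \<noteq> 0"
    using assms(1) by (auto simp: poly_prod prod_zero_iff dest: injD)
  then have "poly r (f n) = 0" using Suc.prems[of n] r by simp
  then have "[:- f n, 1:] dvd r" by (simp add: poly_eq_0_iff_dvd)
  then show ?case unfolding r by (simp add: mult_dvd_mono mult.commute del: mult_pCons_left mult_pCons_right)
qed simp

lemma multiple_of_hpoly:
  assumes "degree g \<le> p + q + 3" "\<And>i. i < q + 3 \<Longrightarrow> poly g (zp i) = 0"
  shows "g \<in> {hpoly (q + 3) * r | r. degree r \<le> p}"
proof -
  have "hpoly (q + 3) dvd g" unfolding hpoly_def by (rule roots_prod_dvd) (auto simp: inj_def zp_inj assms(2))
  then obtain r where r: "g = hpoly (q + 3) * r" by (rule dvdE)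
  have "degree r \<le> p"
  proof (cases "r = 0")
    case False
    then have "degree g = q + 3 + degree r" using r by (simp add: degree_mult_eq)
    then show ?thesis using assms(1) by simp
  qed simp
  then show ?thesis using r by blast
qed

lemma multiple_of_kpoly:
  assumes "degree g \<le> p + q + 3" "\<And>i. i < p + 3 \<Longrightarrow> poly g (wp i) = 0"
  shows "g \<in> {kpoly (p + 3) * s | s. degree s \<le> q}"
proof -
  have "kpoly (p + 3) dvd g" unfolding kpoly_def by (rule roots_prod_dvd) (auto simp: inj_def wp_inj assms(2))
  then obtain r where r: "g = kpoly (p + 3) * r" by (rule dvdE)
  have "degree r \<le> q"
  proof (cases "r = 0")
    case False
    then have "degree g = p + 3 + degree r" using r by (simp add: degree_mult_eq)
    then show ?thesis using assms(1) by simp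
  qed simp
  then show ?thesis using r by blast
qed

text \<open>A list, because its positions number rows of the linear systems below.\<close>

definition unmatched :: "nat \<Rightarrow> nat \<times> nat \<times> nat \<Rightarrow> nat list" where
  "unmatched q T = filter (\<lambda>i. i \<notin> {tsel 0 T, tsel 1 T, tsel 2 T}) [0..<q + 3]"

lemma set_unmatched: "set (unmatched q T) = {i. i < q + 3 \<and> (\<forall>k<3. i \<noteq> tsel k T)}"
proof -
  have "(\<forall>k<3. i \<noteq> tsel k T) \<longleftrightarrow> i \<notin> {tsel 0 T, tsel 1 T, tsel 2 T}" for i
    by (auto simp: numeral_3_eq_3 less_Suc_eq numeral_2_eq_2)
  then show ?thesis unfolding unmatched_def by auto
qed

lemma tsel_less: "\<mu> \<in> matchings q p \<Longrightarrow> k < 3 \<Longrightarrow> tsel k (fst \<mu>) < q + 3 \<and> tsel k (snd \<mu>) < p + 3"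
  using less_3_cases[of k] by (auto simp: matchings_def tsel_def)

lemma tsel_inj: "\<mu> \<in> matchings q p \<Longrightarrow> k < 3 \<Longrightarrow> l < 3 \<Longrightarrow> tsel k (fst \<mu>) = tsel l (fst \<mu>) \<Longrightarrow> k = l"
  using less_3_cases[of k] less_3_cases[of l] by (auto simp: matchings_def tsel_def)

lemma card_unmatched:
  assumes "\<mu> \<in> matchings q p"
  shows "card (set (unmatched q (fst \<mu>))) = q" "length (unmatched q (fst \<mu>)) = q"
proof -
  have "inj_on (\<lambda>k. tsel k (fst \<mu>)) {..<3}" using tsel_inj[OF assms] by (auto intro!: inj_onI)
  then have c: "card ((\<lambda>k. tsel k (fst \<mu>)) ` {..<3}) = 3" by (simp add: card_image)
  have "set (unmatched q (fst \<mu>)) = {..<q + 3} - (\<lambda>k. tsel k (fst \<mu>)) ` {..<3}"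
    unfolding set_unmatched by auto
  moreover have "card ({..<q + 3} - (\<lambda>k. tsel k (fst \<mu>)) ` {..<3}) = q"
    using tsel_less[OF assms] c by (subst card_Diff_subset) auto
  ultimately show 1: "card (set (unmatched q (fst \<mu>))) = q" by simp
  have "distinct (unmatched q (fst \<mu>))" unfolding unmatched_def by (intro distinct_filter) simp
  then show "length (unmatched q (fst \<mu>)) = q" using 1 by (simp add: distinct_card)
qed

context
  fixes p q :: nat and \<mu> :: "(nat \<times> nat \<times> nat) \<times> (nat \<times> nat \<times> nat)" and m :: mat2
  assumes mu: "\<mu> \<in> matchings q p"
  defines "m \<equiv> chart (zt \<mu>) (wt \<mu>)"
begin

text \<open>Conditions on the transformed form at a source become, up to the chart scalar,
  conditions on the original form at the coordinate \<open>proj k y\<close>.\<close>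

lemma poly_form_act_chart:
  assumes "k < 3" "degree g \<le> n"
  shows "poly (form_act n (chart (zt \<mu>) y) g) (zp (tsel k (fst \<mu>))) =
    chart_scalar (zt \<mu>) y k ^ n * poly g (proj k y)"
proof -
  note c = chart_point[OF tdistinct_zt[OF mu] assms(1), of y, unfolded proj_zt[OF assms(1)]]
  have "poly (form_act n (chart (zt \<mu>) y) g) (zp (tsel k (fst \<mu>))) =
    heval n g (chart_scalar (zt \<mu>) y k * proj k y) (chart_scalar (zt \<mu>) y k * 1)"
    unfolding chart_def poly_form_act c by simp
  also have "\<dots> = chart_scalar (zt \<mu>) y k ^ n * poly g (proj k y)"
    unfolding heval_scale heval_1[OF assms(2)] ..
  finally show ?thesis .
qed

lemma mdet_m: "mdet m \<noteq> 0"
  unfolding m_def by (rule mdet_chart[OF tdistinct_zt[OF mu] tdistinct_wt[OF mu]])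

text \<open>By \<open>no_four_matched\<close> the transform of \<open>kpoly (p + 3)\<close> is
  nonzero at the \<open>q\<close> unmatched sources, so the transform of \<open>s\<close> vanishes
  there. One further zero at a matched source gives \<open>q + 1\<close> roots against degree at
  most \<open>q\<close>.\<close>

lemma cofactor_zero:
  assumes s: "degree s \<le> q" and k: "k < 3"
    and u: "\<And>i. i \<in> set (unmatched q (fst \<mu>)) \<Longrightarrow> poly (form_act (p + q + 3) m (kpoly (p + 3) * s)) (zp i) = 0"
    and sk: "poly s (wp (tsel k (snd \<mu>))) = 0"
  shows "s = 0"
proof (rule ccontr)
  assume "s \<noteq> 0"
  then have s0: "form_act q m s \<noteq> 0" using form_act_eq_0_iff[OF mdet_m s] by simp
  have pq: "p + q + 3 = (p + 3) + q" by simp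
  have fa: "form_act (p + q + 3) m (kpoly (p + 3) * s) = form_act (p + 3) m (kpoly (p + 3)) * form_act q m s"
    unfolding pq by (rule form_act_mult[OF mdet_m _ s]) simp
  have mt: "matched m (tsel k (fst \<mu>)) (tsel k (snd \<mu>))" if "k < 3" for k
    unfolding m_def by (rule matched_chart[OF mu that])
  have r: "poly (form_act q m s) (zp i) = 0" if i: "i \<in> set (unmatched q (fst \<mu>))" for i
  proof -
    have i': "i < q + 3" "\<And>k. k < 3 \<Longrightarrow> i \<noteq> tsel k (fst \<mu>)" using i unfolding set_unmatched by auto
    have ds: "tsel 0 (fst \<mu>) \<noteq> tsel 1 (fst \<mu>)" "tsel 0 (fst \<mu>) \<noteq> tsel 2 (fst \<mu>)" "tsel 1 (fst \<mu>) \<noteq> tsel 2 (fst \<mu>)"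
      using tsel_inj[OF mu, of 0 1] tsel_inj[OF mu, of 0 2] tsel_inj[OF mu, of 1 2] by auto
    have di: "tsel 0 (fst \<mu>) \<noteq> i" "tsel 1 (fst \<mu>) \<noteq> i" "tsel 2 (fst \<mu>) \<noteq> i"
      using i'(2)[of 0] i'(2)[of 1] i'(2)[of 2] by auto
    have m3: "matched m (tsel 0 (fst \<mu>)) (tsel 0 (snd \<mu>))" "matched m (tsel 1 (fst \<mu>)) (tsel 1 (snd \<mu>))"
      "matched m (tsel 2 (fst \<mu>)) (tsel 2 (snd \<mu>))" by (rule mt, simp)+
    have "\<not> matched m i j" for j
    proof
      assume "matched m i j"
      from no_four_matched[OF mdet_m m3 this ds(1,2) di(1) ds(3) di(2,3)] show False .
    qed
    then have "poly (form_act (p + 3) m (kpoly (p + 3))) (zp i) \<noteq> 0"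
      using poly_form_act_kpoly_eq_0[OF mdet_m] by blast
    moreover have "poly (form_act (p + 3) m (kpoly (p + 3))) (zp i) * poly (form_act q m s) (zp i) = 0"
      using u[OF i] unfolding fa by simp
    ultimately show ?thesis by simp
  qed
  have rk: "poly (form_act q m s) (zp (tsel k (fst \<mu>))) = 0"
    unfolding m_def poly_form_act_chart[OF k s] using sk proj_wt[OF k] by simp
  let ?I = "insert (tsel k (fst \<mu>)) (set (unmatched q (fst \<mu>)))"
  have "tsel k (fst \<mu>) \<notin> set (unmatched q (fst \<mu>))" unfolding set_unmatched using k by blast
  then have "card ?I = q + 1" using card_unmatched(1)[OF mu] by simp
  then have "card (zp ` ?I) = q + 1" by (subst card_image) (auto simp: inj_on_def zp_inj)
  moreover have "zp ` ?I \<subseteq> {x. poly (form_act q m s) x = 0}" using r rk by auto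
  then have "card (zp ` ?I) \<le> card {x. poly (form_act q m s) x = 0}"
    using poly_roots_finite[OF s0] by (rule card_mono[rotated])
  moreover have "card {x. poly (form_act q m s) x = 0} \<le> degree (form_act q m s)"
    by (rule card_poly_roots_bound[OF s0])
  ultimately show False using degree_form_act[of q m s] by simp
qed

end

lemma eventually_chart_invertible:
  assumes "\<mu> \<in> matchings q p"
  shows "\<exists>r>0. \<forall>y\<in>cball (wt \<mu>) r. tdistinct y"
proof -
  have "wt \<mu> \<in> {y. tdistinct y}" using tdistinct_wt[OF assms] by simp
  with open_tdistinct obtain r where "r > 0" "cball (wt \<mu>) r \<subseteq> {y. tdistinct y}"
    unfolding open_contains_cball by blast
  then show ?thesis by blast
qed

text \<open>Passes from nonzero vectors in the kernel of a linear system to solutions of the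
  geometric problem, the two agreeing near \<open>w\<close>.\<close>

lemma transfer_unique:
  assumes K: "\<exists>\<epsilon>0>0. \<forall>\<epsilon>. 0 < \<epsilon> \<longrightarrow> \<epsilon> \<le> \<epsilon>0 \<longrightarrow>
    (\<exists>\<delta>>0. \<forall>t. cmod t < \<delta> \<longrightarrow> (\<exists>!y. y \<in> cball (w :: triple) \<epsilon> \<and> K y t))"
    and r: "r > 0" "\<delta>' > 0"
    and eq: "\<And>y t. y \<in> cball w r \<Longrightarrow> cmod t < \<delta>' \<Longrightarrow> K y t \<longleftrightarrow> L y t"
  shows "\<exists>\<epsilon>0>0. \<forall>\<epsilon>. 0 < \<epsilon> \<longrightarrow> \<epsilon> \<le> \<epsilon>0 \<longrightarrow>
    (\<exists>\<delta>>0. \<forall>t. cmod t < \<delta> \<longrightarrow> (\<exists>!y. y \<in> cball w \<epsilon> \<and> L y t))"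
proof -
  obtain \<epsilon>0 where \<epsilon>0: "\<epsilon>0 > 0" "\<And>\<epsilon>. 0 < \<epsilon> \<Longrightarrow> \<epsilon> \<le> \<epsilon>0 \<Longrightarrow>
    (\<exists>\<delta>>0. \<forall>t. cmod t < \<delta> \<longrightarrow> (\<exists>!y. y \<in> cball w \<epsilon> \<and> K y t))" using K by blast
  show ?thesis
  proof (rule exI[of _ "min \<epsilon>0 r"], intro conjI allI impI)
    fix \<epsilon> assume \<epsilon>: "0 < \<epsilon>" "\<epsilon> \<le> min \<epsilon>0 r"
    then obtain \<delta> where \<delta>: "\<delta> > 0" "\<And>t. cmod t < \<delta> \<Longrightarrow> \<exists>!y. y \<in> cball w \<epsilon> \<and> K y t"
      using \<epsilon>0(2)[of \<epsilon>] by auto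
    show "\<exists>\<delta>>0. \<forall>t. cmod t < \<delta> \<longrightarrow> (\<exists>!y. y \<in> cball w \<epsilon> \<and> L y t)"
    proof (intro exI[of _ "min \<delta> \<delta>'"] conjI allI impI)
      fix t assume t: "cmod t < min \<delta> \<delta>'"
      have "y \<in> cball w \<epsilon> \<and> K y t \<longleftrightarrow> y \<in> cball w \<epsilon> \<and> L y t" for y
        using eq[of y t] t \<epsilon>(2) by auto
      then show "\<exists>!y. y \<in> cball w \<epsilon> \<and> L y t" using \<delta>(2)[of t] t by simp
    qed (use \<delta> r in auto)
  qed (use \<epsilon>0 r in auto)
qed

text \<open>The \<open>SL\<^sub>2\<close>-invariant pairing of binary forms, normalised so that pairing with the power \<open>(x - z)\<^sup>d\<close> is evaluation
  at \<open>z\<close>.\<close>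

definition pair :: "nat \<Rightarrow> complex poly \<Rightarrow> complex poly \<Rightarrow> complex" where
  "pair d f g = (\<Sum>i\<le>d. (-1) ^ i / of_nat (d choose i) * coeff f i * coeff g (d - i))"

lemma pair_sum_left: "pair d (\<Sum>i\<in>A. smult (v i) (f i)) g = (\<Sum>i\<in>A. v i * pair d (f i) g)"
  unfolding pair_def coeff_sum sum_distrib_left sum_distrib_right
  by (subst sum.swap) (simp add: mult.assoc mult.left_commute)

lemma pair_smult_left: "pair d (smult k f) g = k * pair d f g"
  using pair_sum_left[of d "\<lambda>_. k" "\<lambda>_. f" "{()}" g] by simp

lemma pair_smult_right: "pair d f (smult k g) = k * pair d f g"
  unfolding pair_def by (simp add: sum_distrib_left mult.left_commute)

lemma pair_add_right: "pair d f (g + g') = pair d f g + pair d f g'"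
  unfolding pair_def by (simp add: distrib_left sum.distrib)

lemma polyfun_pair: "polyfunp P \<Longrightarrow> polyfunp Q \<Longrightarrow> polyfun (\<lambda>x. pair d (P x) (Q x))"
  unfolding pair_def by (intro polyfun_sum polyfun.mult polyfun.const polyfunp_coeff)

lemma tendsto_pair:
  assumes "\<And>i. ((\<lambda>n. coeff (f n) i) \<longlongrightarrow> coeff f' i) F" "\<And>i. ((\<lambda>n. coeff (g n) i) \<longlongrightarrow> coeff g' i) F"
  shows "((\<lambda>n. pair d (f n) (g n)) \<longlongrightarrow> pair d f' g') F"
  unfolding pair_def by (intro tendsto_intros assms)

lemma pair_linear_power: "degree f \<le> d \<Longrightarrow> pair d f ([:- z, 1:] ^ d) = poly f z"
proof -
  assume d: "degree f \<le> d"
  have "(-1) ^ i / of_nat (d choose i) * coeff f i * coeff ([:- z, 1:] ^ d) (d - i) = coeff f i * z ^ i" if "i \<le> d" for i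
  proof -
    have "coeff ([:- z, 1:] ^ d) (d - i) = of_nat (d choose i) * ((-1) ^ i * z ^ i)"
      using coeff_linear_poly_power[of "d - i" d "- z" 1] that by (simp add: binomial_symmetric[symmetric] power_minus[of z])
    moreover have "of_nat (d choose i) \<noteq> (0 :: complex)" using that by (simp add: binomial_eq_0_iff)
    moreover have "(-1 :: complex) ^ i * (-1) ^ i = 1" by (simp flip: power_mult_distrib)
    ultimately show ?thesis by (simp add: field_simps)
  qed
  then have "pair d f ([:- z, 1:] ^ d) = (\<Sum>i\<le>d. coeff f i * z ^ i)" unfolding pair_def by (intro sum.cong) auto
  also have "\<dots> = poly f z" unfolding poly_altdef
    by (intro sum.mono_neutral_right) (use d in \<open>auto simp: coeff_eq_0\<close>)
  finally show ?thesis .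
qed

section \<open>The two special families\<close>

definition vpoly :: "nat \<Rightarrow> (nat \<Rightarrow> complex) \<Rightarrow> complex poly" where
  "vpoly d v = (\<Sum>c\<le>d. smult (v c) (monom 1 c))"

lemma coeff_vpoly: "coeff (vpoly d v) i = (if i \<le> d then v i else 0)"
  unfolding vpoly_def by (simp add: coeff_sum smult_monom sum.delta' cong: if_cong)

lemma degree_vpoly: "degree (vpoly d v) \<le> d"
  by (rule degree_le) (simp add: coeff_vpoly)

lemma vpoly_coeff: "degree g \<le> d \<Longrightarrow> vpoly d (coeff g) = g"
  by (rule poly_eqI) (auto simp: coeff_vpoly coeff_eq_0)

lemma vpoly_eq_0: "vpoly d v = 0 \<longleftrightarrow> (\<forall>c\<le>d. v c = 0)"
  by (auto simp: poly_eq_iff coeff_vpoly)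

lemma pair_vpoly: "(\<Sum>c\<le>d. pair d (monom 1 c) E * v c) = pair d (vpoly d v) E"
  unfolding vpoly_def pair_sum_left by (simp add: mult.commute)

lemma pair_form_act_vpoly:
  "(\<Sum>c\<le>d. pair d (form_act d m (monom 1 c)) E * v c) = pair d (form_act d m (vpoly d v)) E"
  unfolding vpoly_def form_act_sum form_act_smult pair_sum_left by (simp add: mult.commute)

lemma poly_vpoly: "poly (vpoly d v) x = (\<Sum>c\<le>d. v c * x ^ c)"
  unfolding vpoly_def by (simp add: poly_sum poly_monom)

lemma poly_pderiv_vpoly: "poly (pderiv (vpoly d v)) x = (\<Sum>c\<le>d. v c * (of_nat c * x ^ (c - 1)))"
proof -
  have "pderiv (\<Sum>c\<in>A. f c) = (\<Sum>c\<in>A. pderiv (f c))" for A and f :: "nat \<Rightarrow> complex poly"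
    by (induction A rule: infinite_finite_induct) (simp_all add: pderiv_add)
  then show ?thesis unfolding vpoly_def
    by (simp add: pderiv_smult pderiv_monom poly_sum poly_monom mult.assoc)
qed

section \<open>The family given by annihilators\<close>

definition ann :: "nat \<Rightarrow> nat \<Rightarrow> (nat \<Rightarrow> complex poly) \<Rightarrow> complex poly set" where
  "ann d n E = {f. degree f \<le> d \<and> (\<forall>i<n. pair d f (E i) = 0)}"

lemma cone_ann: "cone d (ann d n E)"
  unfolding cone_def ann_def by (auto simp: pair_smult_left)

lemma closed_at_0_ann:
  assumes "\<And>f. f \<in> ann d n E0 \<Longrightarrow> f \<in> V0"
  shows "closed_at_0 d (\<lambda>t. ann d n (\<lambda>i. E0 i + smult t (C i))) V0"
  unfolding closed_at_0_def
proof (intro allI impI)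
  fix t f f'
  assume t: "t \<longlonglongrightarrow> 0" and f: "\<forall>k. f k \<in> ann d n (\<lambda>i. E0 i + smult (t k) (C i))" and d: "degree f' \<le> d"
    and l: "\<forall>i. (\<lambda>k. coeff (f k) i) \<longlonglongrightarrow> coeff f' i"
  have "pair d f' (E0 i) = 0" if "i < n" for i
  proof -
    have "(\<lambda>k. coeff (E0 i + smult (t k) (C i)) j) \<longlonglongrightarrow> coeff (E0 i) j + 0 * coeff (C i) j" for j
      unfolding coeff_add coeff_smult by (intro tendsto_intros t)
    then have "(\<lambda>k. pair d (f k) (E0 i + smult (t k) (C i))) \<longlonglongrightarrow> pair d f' (E0 i)"
      by (intro tendsto_pair) (use l in simp_all)
    moreover have "pair d (f k) (E0 i + smult (t k) (C i)) = 0" for k using f that by (simp add: ann_def)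
    ultimately show ?thesis by (simp add: LIMSEQ_const_iff)
  qed
  then show "f' \<in> V0" using assms[of f'] d by (simp add: ann_def)
qed

lemma proj_tpt_simps: "proj k (tpt (pt y t)) = proj k y" "pt y t 3 = t"
  by (simp only: tpt_pt, simp add: pt_def)

lemma polyfunp_form_act_chart:
  assumes "polyfunp P"
  shows "polyfunp (\<lambda>x. form_act d (chart z (tpt x)) (P x))"
  unfolding chart_def using assms by (intro polyfunp_form_act polyfun_chart polyfunp_coeff)

text \<open>At the simple root \<open>wp j\<close> of \<open>kpoly n\<close>, the derivative of
  \<open>kpoly n * s\<close> is a nonzero multiple of \<open>poly s (wp j)\<close>.\<close>

lemma poly_form_act_kpoly_root:
  assumes "poly (pderiv (kpoly n * s)) (wp j) = 0" "j < n"
  shows "poly s (wp j) = 0"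
proof -
  define k0 where "k0 = (\<Prod>i\<in>{..<n} - {j}. [:- wp i, 1:])"
  have k: "kpoly n = [:- wp j, 1:] * k0" unfolding kpoly_def k0_def
    by (rule prod.remove) (use assms(2) in auto)
  have "poly k0 (wp j) \<noteq> 0" unfolding k0_def by (auto simp: poly_prod prod_zero_iff wp_inj)
  moreover have "pderiv (kpoly n * s) = [:- wp j, 1:] * pderiv (k0 * s) + (k0 * s)"
    unfolding k mult.assoc by (subst pderiv_mult) (simp add: pderiv_pCons)
  ultimately show ?thesis using assms(1) by simp
qed

text \<open>The unknown form \<open>g\<close> has \<open>d + 1\<close> coefficients. Its membership
  in the second annihilator gives \<open>p + 3\<close> rows and the unmatched sources give
  \<open>q\<close> rows on its transform, together \<open>d\<close>. The three matched sources give
  the remaining equations of \<open>local_unique_degeneracy\<close>.\<close>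

lemma local_sols_ann:
  fixes p q :: nat and C D :: "nat \<Rightarrow> complex poly"
  defines "d \<equiv> p + q + 3"
  assumes mu: "\<mu> \<in> matchings q p"
  shows "\<exists>\<epsilon>0>0. \<forall>\<epsilon>. 0 < \<epsilon> \<longrightarrow> \<epsilon> \<le> \<epsilon>0 \<longrightarrow>
    (\<exists>\<delta>>0. \<forall>t. cmod t < \<delta> \<longrightarrow> (\<exists>!y. y \<in> cball (wt \<mu>) \<epsilon> \<and> chart (zt \<mu>) y \<in>
      sols d (ann d (q + 3) (\<lambda>i. [:- zp i, 1:] ^ d + smult t (C i))) (ann d (p + 3) (\<lambda>j. [:- wp j, 1:] ^ d + smult t (D j)))))"
proof -
  let ?z = "zt \<mu>" and ?L = "unmatched q (fst \<mu>)"
  define A where "A i t = [:- zp i, 1:] ^ d + smult t (C i)" for i t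
  define B where "B j t = [:- wp j, 1:] ^ d + smult t (D j)" for j t
  define I where "I k = tsel k (fst \<mu>)" for k
  define J where "J k = tsel k (snd \<mu>)" for k
  define M where "M x = chart ?z (tpt x)" for x
  define R where "R r c x = (if r < p + 3 then pair d (monom 1 c) (B r (x 3))
    else pair d (form_act d (M x) (monom 1 c)) (A (?L ! (r - (p + 3))) (x 3)))" for r c x
  \<comment> \<open>From the condition at a matched source a multiple of the row for its target is
    subtracted. This leaves the solution set unchanged and makes the equation at
    \<open>t = 0\<close> vanish for \<open>proj k y = wp (J k)\<close>.\<close>
  define \<beta> where "\<beta> k c x = pair d (form_act d (M x) (monom 1 c)) (A (I k) (x 3)) -
    chart_scalar ?z (tpt x) k ^ d * pair d (monom 1 c) (B (J k) (x 3))" for k c x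
  \<comment> \<open>The difference quotient of the monomial of degree \<open>c\<close> between
    \<open>proj k y\<close> and \<open>wp (J k)\<close>, times the power of the chart
    scalar.\<close>
  define \<rho> where "\<rho> k c x = chart_scalar ?z (tpt x) k ^ d *
    (\<Sum>l<c. wp (J k) ^ (c - Suc l) * proj k (tpt x) ^ l)" for k c x
  have lenL: "length ?L = q" by (rule card_unmatched(2)[OF mu])
  have pA: "polyfunp (\<lambda>x. A i (x 3))" and pB: "polyfunp (\<lambda>x. B i (x 3))" for i
    unfolding A_def B_def by (intro polyfunp_add polyfunp_const polyfunp_smult polyfun.var)+
  have pF: "polyfunp (\<lambda>x. form_act d (M x) (monom 1 c))" for c
    unfolding M_def by (intro polyfunp_form_act_chart polyfunp_const)
  have pR: "polyfun (R r c)" for r c unfolding R_def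
    by (cases "r < p + 3") (simp_all only: if_True if_False polyfun_pair[OF polyfunp_const pB] polyfun_pair[OF pF pA])
  have p\<beta>: "polyfun (\<beta> k c)" for k c unfolding \<beta>_def
    by (intro polyfun_diff polyfun.mult polyfun_power polyfun_chart_scalar polyfun_pair polyfunp_const pA pB pF)
  have p\<rho>: "polyfun (\<rho> k c)" for k c unfolding \<rho>_def
    by (intro polyfun.mult polyfun_power polyfun_chart_scalar polyfun_sum polyfun.const polyfun_proj_tpt)
  have A0: "pair d f (A i 0) = poly f (zp i)" and B0: "pair d f (B i 0) = poly f (wp i)" if "degree f \<le> d" for f i
    using pair_linear_power[OF that] by (simp_all add: A_def B_def)
  have pow_chart: "poly (form_act d (chart ?z y) g) (zp (I k)) = chart_scalar ?z y k ^ d * poly g (proj k y)"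
    if "k < 3" "degree g \<le> d" for k y g
    unfolding I_def by (rule poly_form_act_chart[OF mu that])
  have \<beta>\<rho>: "\<beta> k c (pt y 0) = (proj k y - proj k (wt \<mu>)) * \<rho> k c (pt y 0)" if k: "k < 3" and c: "c \<le> d" for k c y
  proof -
    have dc: "degree (monom 1 c :: complex poly) \<le> d" using c by (simp add: degree_monom_eq)
    have "\<beta> k c (pt y 0) = chart_scalar ?z y k ^ d * (proj k y ^ c - wp (J k) ^ c)"
      unfolding \<beta>_def M_def tpt_pt proj_tpt_simps(2) A0[OF degree_form_act] B0[OF dc] pow_chart[OF k dc]
      by (simp add: poly_monom right_diff_distrib)
    also have "\<dots> = (proj k y - wp (J k)) * (chart_scalar ?z y k ^ d * (\<Sum>l<c. wp (J k) ^ (c - Suc l) * proj k y ^ l))"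
      unfolding power_diff_sumr2 by (simp add: mult.left_commute)
    finally show ?thesis unfolding \<rho>_def tpt_pt proj_wt[OF k] J_def .
  qed
  have rows: "(\<forall>r<d. (\<Sum>c\<le>d. R r c (pt y t) * v c) = 0) \<longleftrightarrow>
    (\<forall>j<p+3. pair d (vpoly d v) (B j t) = 0) \<and>
    (\<forall>i\<in>set ?L. pair d (form_act d (chart ?z y) (vpoly d v)) (A i t) = 0)" (is "?l \<longleftrightarrow> ?r") for y t v
  proof
    assume l: ?l
    show ?r
    proof (intro conjI allI impI ballI)
      fix j assume j: "j < p + 3"
      then have "(\<Sum>c\<le>d. R j c (pt y t) * v c) = 0" using l by (simp add: d_def)
      then show "pair d (vpoly d v) (B j t) = 0" unfolding R_def using j pair_vpoly[of d "B j t" v]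
        by (simp add: proj_tpt_simps)
    next
      fix i assume "i \<in> set ?L"
      then obtain r where r: "r < q" "?L ! r = i" using lenL by (metis in_set_conv_nth)
      then have "(\<Sum>c\<le>d. R (p + 3 + r) c (pt y t) * v c) = 0" using l by (simp add: d_def)
      then show "pair d (form_act d (chart ?z y) (vpoly d v)) (A i t) = 0"
        unfolding R_def M_def using r pair_form_act_vpoly[of d "chart ?z y" "A i t" v] by (simp add: proj_tpt_simps)
    qed
  next
    assume r: ?r
    show ?l
    proof (intro allI impI)
      fix r' assume r': "r' < d"
      show "(\<Sum>c\<le>d. R r' c (pt y t) * v c) = 0"
      proof (cases "r' < p + 3")
        case True
        then show ?thesis unfolding R_def using r pair_vpoly[of d "B r' t" v] by (simp add: proj_tpt_simps)
      next
        case False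
        then have "?L ! (r' - (p + 3)) \<in> set ?L" using r' lenL by (intro nth_mem) (simp add: d_def)
        then show ?thesis unfolding R_def M_def
          using False r pair_form_act_vpoly[of d "chart ?z y" "A (?L ! (r' - (p + 3))) t" v] by (simp add: proj_tpt_simps)
      qed
    qed
  qed
  have bad: "(\<Sum>c\<le>d. \<beta> k c (pt y t) * v c) = pair d (form_act d (chart ?z y) (vpoly d v)) (A (I k) t) -
    chart_scalar ?z y k ^ d * pair d (vpoly d v) (B (J k) t)" for k y t v
    unfolding \<beta>_def M_def tpt_pt proj_tpt_simps(2) left_diff_distrib sum_subtractf pair_form_act_vpoly
    by (simp add: mult.assoc sum_distrib_left[symmetric] pair_vpoly)
  have nonsing: "\<forall>c\<le>d. v c = 0"
    if k: "k < 3" and good: "\<forall>r<d. (\<Sum>c\<le>d. R r c (pt (wt \<mu>) 0) * v c) = 0"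
      and rho: "(\<Sum>c\<le>d. \<rho> k c (pt (wt \<mu>) 0) * v c) = 0" for k v
  proof -
    let ?g = "vpoly d v"
    have "poly ?g (wp j) = 0" if "j < p + 3" for j
      using good that unfolding rows B0[OF degree_vpoly] by blast
    then have "?g \<in> {kpoly (p + 3) * s | s. degree s \<le> q}"
      by (intro multiple_of_kpoly) (use degree_vpoly[of d v] d_def in auto)
    then obtain s where s: "?g = kpoly (p + 3) * s" "degree s \<le> q" by blast
    have u: "poly (form_act d (chart ?z (wt \<mu>)) (kpoly (p + 3) * s)) (zp i) = 0" if "i \<in> set ?L" for i
      using good that unfolding rows A0[OF degree_form_act] s(1)[symmetric] by blast
    \<comment> \<open>At \<open>y = wt \<mu>\<close> the difference quotient becomes a derivative,
      so the hypothesis on \<open>\<rho>\<close> says that \<open>pderiv ?g\<close> vanishes at the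
      target.\<close>
    have "\<rho> k c (pt (wt \<mu>) 0) = chart_scalar ?z (wt \<mu>) k ^ d * (of_nat c * wp (J k) ^ (c - 1))" for c
    proof -
      have "(\<Sum>l<c. wp (J k) ^ (c - Suc l) * wp (J k) ^ l) = (\<Sum>l<c. wp (J k) ^ (c - 1))"
        by (intro sum.cong refl) (simp flip: power_add)
      then show ?thesis unfolding \<rho>_def tpt_pt proj_wt[OF k] J_def by simp
    qed
    then have "chart_scalar ?z (wt \<mu>) k ^ d * poly (pderiv ?g) (wp (J k)) = 0"
      using rho unfolding poly_pderiv_vpoly by (simp add: sum_distrib_left mult_ac)
    moreover have "chart_scalar ?z (wt \<mu>) k \<noteq> 0"
      by (rule chart_scalar_nz[OF tdistinct_zt[OF mu] tdistinct_wt[OF mu]])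
    ultimately have "poly (pderiv (kpoly (p + 3) * s)) (wp (J k)) = 0" using s(1) by simp
    then have "poly s (wp (tsel k (snd \<mu>))) = 0"
      using poly_form_act_kpoly_root tsel_less[OF mu k] unfolding J_def by blast
    then have "s = 0" using cofactor_zero[OF mu s(2) k u[unfolded d_def]] by blast
    then have "?g = 0" using s by simp
    then show ?thesis by (simp add: vpoly_eq_0)
  qed
  have K: "\<exists>\<epsilon>0>0. \<forall>\<epsilon>. 0 < \<epsilon> \<longrightarrow> \<epsilon> \<le> \<epsilon>0 \<longrightarrow>
    (\<exists>\<delta>>0. \<forall>t. cmod t < \<delta> \<longrightarrow> (\<exists>!y. y \<in> cball (wt \<mu>) \<epsilon> \<and>
      (\<exists>v. (\<exists>c\<le>d. v c \<noteq> 0) \<and> (\<forall>r<d. (\<Sum>c\<le>d. R r c (pt y t) * v c) = 0) \<and>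
        (\<forall>k<3. (\<Sum>c\<le>d. \<beta> k c (pt y t) * v c) = 0))))"
    by (rule local_unique_degeneracy[OF pR p\<beta> p\<rho> \<beta>\<rho> nonsing])
  obtain r where r: "r > 0" "\<And>y. y \<in> cball (wt \<mu>) r \<Longrightarrow> tdistinct y" using eventually_chart_invertible[OF mu] by blast
  have Iq: "i < q + 3 \<longleftrightarrow> i \<in> set ?L \<or> (\<exists>k<3. i = I k)" for i
    unfolding set_unmatched I_def using tsel_less[OF mu] by auto
  have eq: "(\<exists>v. (\<exists>c\<le>d. v c \<noteq> 0) \<and> (\<forall>r<d. (\<Sum>c\<le>d. R r c (pt y t) * v c) = 0) \<and>
      (\<forall>k<3. (\<Sum>c\<le>d. \<beta> k c (pt y t) * v c) = 0)) \<longleftrightarrow>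
    chart ?z y \<in> sols d (ann d (q + 3) (\<lambda>i. A i t)) (ann d (p + 3) (\<lambda>j. B j t))" (is "?l \<longleftrightarrow> ?r")
    if y: "y \<in> cball (wt \<mu>) r" and "cmod t < 1" for y t
  proof -
    have det: "mdet (chart ?z y) \<noteq> 0" by (rule mdet_chart[OF tdistinct_zt[OF mu] r(2)[OF y]])
    have cond: "(\<forall>r<d. (\<Sum>c\<le>d. R r c (pt y t) * v c) = 0) \<and> (\<forall>k<3. (\<Sum>c\<le>d. \<beta> k c (pt y t) * v c) = 0) \<longleftrightarrow>
      vpoly d v \<in> ann d (p + 3) (\<lambda>j. B j t) \<and> form_act d (chart ?z y) (vpoly d v) \<in> ann d (q + 3) (\<lambda>i. A i t)" for v
    proof -
      have "J k < p + 3" if "k < 3" for k using tsel_less[OF mu that] by (simp add: J_def)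
      then have "(\<forall>j<p+3. pair d (vpoly d v) (B j t) = 0) \<Longrightarrow> k < 3 \<Longrightarrow> pair d (vpoly d v) (B (J k) t) = 0" for k
        by blast
      then show ?thesis unfolding rows bad ann_def using degree_vpoly degree_form_act Iq by auto
    qed
    show ?thesis
    proof
      assume ?l
      then obtain v where v: "\<exists>c\<le>d. v c \<noteq> 0" "vpoly d v \<in> ann d (p + 3) (\<lambda>j. B j t)"
        "form_act d (chart ?z y) (vpoly d v) \<in> ann d (q + 3) (\<lambda>i. A i t)" using cond by blast
      then have "vpoly d v \<noteq> 0" by (simp add: vpoly_eq_0)
      then show ?r using v det unfolding sols_def by blast
    next
      assume ?r
      then obtain g where g: "g \<in> ann d (p + 3) (\<lambda>j. B j t)" "g \<noteq> 0"
        "form_act d (chart ?z y) g \<in> ann d (q + 3) (\<lambda>i. A i t)" unfolding sols_def by blast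
      then have gv: "vpoly d (coeff g) = g" by (intro vpoly_coeff) (simp add: ann_def)
      then have "\<exists>c\<le>d. coeff g c \<noteq> 0" using g(2) vpoly_eq_0[of d "coeff g"] by auto
      then show ?l using cond[of "coeff g"] g unfolding gv by blast
    qed
  qed
  show ?thesis unfolding A_def[symmetric] B_def[symmetric]
  proof (rule transfer_unique[OF K])
    show "0 < r" by (rule r(1))
    show "0 < (1::real)" by simp
  qed (rule eq)
qed

theorem card_sols_ann:
  fixes p q :: nat and C D :: "nat \<Rightarrow> complex poly"
  defines "d \<equiv> p + q + 3"
  shows "\<exists>\<delta>>0. \<forall>t. cmod t < \<delta> \<longrightarrow>
    (let S = pgl_class ` sols d (ann d (q + 3) (\<lambda>i. [:- zp i, 1:] ^ d + smult t (C i))) (ann d (p + 3) (\<lambda>j. [:- wp j, 1:] ^ d + smult t (D j)))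
     in finite S \<and> card S = card (matchings q p))"
  unfolding Let_def d_def
proof (rule card_sols_eventually)
  show "closed_at_0 (p + q + 3) (\<lambda>t. ann (p + q + 3) (q + 3) (\<lambda>i. [:- zp i, 1:] ^ (p + q + 3) + smult t (C i)))
     {hpoly (q + 3) * r |r. degree r \<le> p}"
  proof (rule closed_at_0_ann)
    fix f assume f: "f \<in> ann (p + q + 3) (q + 3) (\<lambda>i. [:- zp i, 1:] ^ (p + q + 3))"
    then show "f \<in> {hpoly (q + 3) * r |r. degree r \<le> p}"
      by (intro multiple_of_hpoly) (auto simp: ann_def pair_linear_power)
  qed
  show "closed_at_0 (p + q + 3) (\<lambda>t. ann (p + q + 3) (p + 3) (\<lambda>j. [:- wp j, 1:] ^ (p + q + 3) + smult t (D j)))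
     {kpoly (p + 3) * s |s. degree s \<le> q}"
  proof (rule closed_at_0_ann)
    fix f assume f: "f \<in> ann (p + q + 3) (p + 3) (\<lambda>j. [:- wp j, 1:] ^ (p + q + 3))"
    then show "f \<in> {kpoly (p + 3) * s |s. degree s \<le> q}"
      by (intro multiple_of_kpoly) (auto simp: ann_def pair_linear_power)
  qed
qed (rule cone_ann local_sols_ann, assumption?)+

section \<open>The family given by spanning forms\<close>

definition lin :: "nat \<Rightarrow> (nat \<Rightarrow> complex poly) \<Rightarrow> complex poly set" where
  "lin n E = {(\<Sum>i\<le>n. smult (u i) (E i)) | u. True}"

text \<open>Independence of the indexed family: a repeated member makes it dependent.\<close>

definition indep :: "nat \<Rightarrow> (nat \<Rightarrow> complex poly) \<Rightarrow> bool" where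
  "indep n E \<longleftrightarrow> (\<forall>u. (\<Sum>i\<le>n. smult (u i) (E i)) = 0 \<longrightarrow> (\<forall>i\<le>n. u i = 0))"

lemma lin_memI: "(\<Sum>i\<le>n. smult (u i) (E i)) \<in> lin n E"
  by (auto simp: lin_def)

lemma smult_sum_right: "smult k (\<Sum>i\<in>A. f i) = (\<Sum>i\<in>A. smult k (f i))"
  by (induction A rule: infinite_finite_induct) (simp_all add: smult_add_right)

lemma cone_lin: "(\<And>i. i \<le> n \<Longrightarrow> degree (E i) \<le> d) \<Longrightarrow> cone d (lin n E)"
  unfolding cone_def
proof (intro ballI conjI allI impI)
  fix f assume d: "\<And>i. i \<le> n \<Longrightarrow> degree (E i) \<le> d" and "f \<in> lin n E"
  then obtain u where f: "f = (\<Sum>i\<le>n. smult (u i) (E i))" by (auto simp: lin_def)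
  have "degree (smult (u i) (E i)) \<le> d" if "i \<le> n" for i
    using degree_smult_le[of "u i" "E i"] d[OF that] by simp
  then show "degree f \<le> d" unfolding f by (intro degree_sum_le) auto
  show "smult k f \<in> lin n E" for k
    unfolding f lin_def smult_sum_right smult_smult by (intro CollectI exI[of _ "\<lambda>i. k * u i"]) simp
qed

text \<open>Weights \<open>g\<close> on a moving family, with the weight of the right-hand side stored as coefficient \<open>n + 1\<close>.\<close>

lemma lin_limit:
  fixes g :: "nat \<Rightarrow> complex poly"
  assumes deg: "\<And>k. degree (g k) \<le> Suc n" and nrm: "\<And>k. coeff_norm (Suc n) (g k) = 1" and t: "t \<longlonglongrightarrow> 0"
    and eq: "\<And>k. (\<Sum>i\<le>n. smult (coeff (g k) i) (E0 i + smult (t k) (C i))) = smult (coeff (g k) (Suc n)) (f k)"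
    and lf: "\<And>i. (\<lambda>k. coeff (f k) i) \<longlonglongrightarrow> coeff f' i"
  shows "\<exists>g' r. g' \<noteq> 0 \<and> degree g' \<le> Suc n \<and> (\<Sum>i\<le>n. smult (coeff g' i) (E0 i)) = smult (coeff g' (Suc n)) f' \<and>
    (\<forall>i. (\<lambda>k. coeff (g (r k)) i) \<longlonglongrightarrow> coeff g' i)"
proof -
  obtain r g' where r: "strict_mono (r :: nat \<Rightarrow> nat)" "degree g' \<le> Suc n" "\<And>i. (\<lambda>k. coeff (g (r k)) i) \<longlonglongrightarrow> coeff g' i"
    using bounded_coeffs_subsequence[of g "Suc n"] deg coeff_le_coeff_norm[OF deg] nrm by auto
  have g'0: "g' \<noteq> 0" by (rule coeff_norm_limit[OF r(3)]) (rule nrm)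
  have lt: "(\<lambda>k. t (r k)) \<longlonglongrightarrow> 0" using LIMSEQ_subseq_LIMSEQ[OF t r(1)] by (simp add: comp_def)
  have lf': "(\<lambda>k. coeff (f (r k)) i) \<longlonglongrightarrow> coeff f' i" for i
    using LIMSEQ_subseq_LIMSEQ[OF lf r(1), of i] by (simp add: comp_def)
  have "(\<Sum>i\<le>n. smult (coeff g' i) (E0 i)) = smult (coeff g' (Suc n)) f'"
  proof (rule poly_eqI)
    fix j
    have "(\<lambda>k. \<Sum>i\<le>n. coeff (g (r k)) i * (coeff (E0 i) j + t (r k) * coeff (C i) j)) \<longlonglongrightarrow>
      (\<Sum>i\<le>n. coeff g' i * (coeff (E0 i) j + 0 * coeff (C i) j))"
      by (intro tendsto_intros r(3) lt)
    moreover have "(\<lambda>k. coeff (g (r k)) (Suc n) * coeff (f (r k)) j) \<longlonglongrightarrow> coeff g' (Suc n) * coeff f' j"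
      by (intro tendsto_intros r(3) lf')
    moreover have "(\<Sum>i\<le>n. coeff (g (r k)) i * (coeff (E0 i) j + t (r k) * coeff (C i) j)) =
      coeff (g (r k)) (Suc n) * coeff (f (r k)) j" for k
      using arg_cong[OF eq[of "r k"], of "\<lambda>p. coeff p j"] by (simp add: coeff_sum)
    ultimately have "(\<Sum>i\<le>n. coeff g' i * (coeff (E0 i) j + 0 * coeff (C i) j)) = coeff g' (Suc n) * coeff f' j"
      using LIMSEQ_unique by simp
    then show "coeff (\<Sum>i\<le>n. smult (coeff g' i) (E0 i)) j = coeff (smult (coeff g' (Suc n)) f') j"
      by (simp add: coeff_sum)
  qed
  then show ?thesis using g'0 r by blast
qed

lemma poly_zeroI: "degree g \<le> Suc n \<Longrightarrow> (\<And>i. i \<le> n \<Longrightarrow> coeff g i = 0) \<Longrightarrow> coeff g (Suc n) = 0 \<Longrightarrow> g = 0"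
  by (rule poly_eqI) (metis coeff_0 coeff_eq_0 le_SucE le_trans not_le)

text \<open>The weights of the approximating combinations may be unbounded. Extended by the weight
  of the right-hand side and normalised, they have a nonzero limit relation, in which independence
  of \<open>E0\<close> forces a nonzero weight on \<open>f'\<close>.\<close>

lemma closed_at_0_lin:
  assumes ind: "indep n E0"
  shows "closed_at_0 d (\<lambda>t. lin n (\<lambda>i. E0 i + smult t (C i))) (lin n E0)"
  unfolding closed_at_0_def
proof (intro allI impI)
  fix t f f'
  assume t: "t \<longlonglongrightarrow> 0" and f: "\<forall>k. f k \<in> lin n (\<lambda>i. E0 i + smult (t k) (C i))"
    and l: "\<forall>i. (\<lambda>k. coeff (f k) i) \<longlonglongrightarrow> coeff f' i"
  have "\<forall>k. \<exists>u. f k = (\<Sum>i\<le>n. smult (u i) (E0 i + smult (t k) (C i)))" using f by (auto simp: lin_def)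
  from choice[OF this] obtain u where u: "\<And>k. f k = (\<Sum>i\<le>n. smult (u k i) (E0 i + smult (t k) (C i)))" by blast
  \<comment> \<open>The entry 1 at index \<open>Suc n\<close> is the weight of \<open>f k\<close>
    itself and keeps the vector nonzero.\<close>
  define P where "P k = vpoly (Suc n) (\<lambda>i. if i = Suc n then 1 else u k i)" for k
  have cP: "coeff (P k) i = (if i = Suc n then 1 else if i \<le> n then u k i else 0)" for k i
    unfolding P_def coeff_vpoly by auto
  have dP: "degree (P k) \<le> Suc n" for k unfolding P_def by (rule degree_vpoly)
  have "P k \<noteq> 0" for k
  proof
    assume "P k = 0"
    then show False using cP[of k "Suc n"] by simp
  qed
  then have nP: "coeff_norm (Suc n) (P k) > 0" for k using coeff_norm_pos[OF dP] by blast
  define N where "N k = of_real (inverse (coeff_norm (Suc n) (P k))) * (1 :: complex)" for k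
  define g where "g k = smult (N k) (P k)" for k
  have eq: "(\<Sum>i\<le>n. smult (coeff (g k) i) (E0 i + smult (t k) (C i))) = smult (coeff (g k) (Suc n)) (f k)" for k
  proof -
    have "(\<Sum>i\<le>n. smult (coeff (g k) i) (E0 i + smult (t k) (C i))) = (\<Sum>i\<le>n. smult (N k) (smult (u k i) (E0 i + smult (t k) (C i))))"
      by (intro sum.cong refl) (simp add: g_def cP)
    then show ?thesis unfolding u smult_sum_right[symmetric] by (simp add: g_def cP)
  qed
  have dg: "degree (g k) \<le> Suc n" for k using degree_smult_le[of "N k" "P k"] dP[of k] by (simp add: g_def)
  have ng: "coeff_norm (Suc n) (g k) = 1" for k
    unfolding g_def coeff_norm_smult N_def using nP[of k] by (simp add: norm_inverse)
  from lin_limit[OF dg ng t eq] l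
  obtain g' where g': "g' \<noteq> 0" "degree g' \<le> Suc n" "(\<Sum>i\<le>n. smult (coeff g' i) (E0 i)) = smult (coeff g' (Suc n)) f'" by blast
  have nz: "coeff g' (Suc n) \<noteq> 0"
  proof
    assume z: "coeff g' (Suc n) = 0"
    then have "(\<Sum>i\<le>n. smult (coeff g' i) (E0 i)) = 0" using g'(3) by simp
    then have "\<forall>i\<le>n. coeff g' i = 0" using ind unfolding indep_def by blast
    then show False using poly_zeroI[OF g'(2)] z g'(1) by blast
  qed
  have "f' = smult (inverse (coeff g' (Suc n))) (smult (coeff g' (Suc n)) f')" using nz by simp
  also have "\<dots> = (\<Sum>i\<le>n. smult (inverse (coeff g' (Suc n)) * coeff g' i) (E0 i))"
    unfolding g'(3)[symmetric] smult_sum_right smult_smult ..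
  finally show "f' \<in> lin n E0" unfolding lin_def by (intro CollectI exI conjI TrueI)
qed

text \<open>Independence is an open condition: normalised relations at parameters tending to 0 would
  converge to a nontrivial relation at 0. This is \<open>lin_limit\<close> with weight 0 on the
  right-hand side.\<close>

lemma indep_eventually:
  assumes ind: "indep n E0"
  shows "\<exists>\<delta>>0. \<forall>t. cmod t < \<delta> \<longrightarrow> indep n (\<lambda>i. E0 i + smult t (C i))"
proof (rule ccontr)
  assume "\<not> ?thesis"
  then have neg: "\<And>\<delta>. \<delta> > 0 \<Longrightarrow> \<exists>t. cmod t < \<delta> \<and> \<not> indep n (\<lambda>i. E0 i + smult t (C i))" by blast
  have "\<forall>k. \<exists>t. cmod t < inverse (real (Suc k)) \<and> \<not> indep n (\<lambda>i. E0 i + smult t (C i))"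
    by (intro allI neg) simp
  from choice[OF this] obtain t where t: "\<And>k. cmod (t k) < inverse (real (Suc k))"
    "\<And>k. \<not> indep n (\<lambda>i. E0 i + smult (t k) (C i))" by blast
  have t0: "t \<longlonglongrightarrow> 0" by (rule tendsto_0_of_less_inverse[OF t(1)])
  have "\<forall>k. \<exists>u. (\<Sum>i\<le>n. smult (u i) (E0 i + smult (t k) (C i))) = 0 \<and> (\<exists>i\<le>n. u i \<noteq> 0)"
    using t(2) unfolding indep_def by blast
  from choice[OF this] obtain u where u: "\<And>k. (\<Sum>i\<le>n. smult (u k i) (E0 i + smult (t k) (C i))) = 0" "\<And>k. \<exists>i\<le>n. u k i \<noteq> 0" by blast
  define P where "P k = vpoly n (u k)" for k
  have dP: "degree (P k) \<le> Suc n" for k unfolding P_def using degree_vpoly[of n "u k"] by simp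
  have "P k \<noteq> 0" for k unfolding P_def vpoly_eq_0 using u(2) by blast
  then have nP: "coeff_norm (Suc n) (P k) > 0" for k using coeff_norm_pos[OF dP] by blast
  define N where "N k = of_real (inverse (coeff_norm (Suc n) (P k))) * (1 :: complex)" for k
  define g where "g k = smult (N k) (P k)" for k
  have gS: "coeff (g k) (Suc n) = 0" for k by (simp add: g_def P_def coeff_vpoly)
  have eq: "(\<Sum>i\<le>n. smult (coeff (g k) i) (E0 i + smult (t k) (C i))) = smult (coeff (g k) (Suc n)) 0" for k
  proof -
    have "(\<Sum>i\<le>n. smult (coeff (g k) i) (E0 i + smult (t k) (C i))) = (\<Sum>i\<le>n. smult (N k) (smult (u k i) (E0 i + smult (t k) (C i))))"
      by (intro sum.cong refl) (simp add: g_def P_def coeff_vpoly)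
    then show ?thesis unfolding smult_sum_right[symmetric] u(1) by simp
  qed
  have dg: "degree (g k) \<le> Suc n" for k using degree_smult_le[of "N k" "P k"] dP[of k] by (simp add: g_def)
  have ng: "coeff_norm (Suc n) (g k) = 1" for k
    unfolding g_def coeff_norm_smult N_def using nP[of k] by (simp add: norm_inverse)
  from lin_limit[OF dg ng t0 eq tendsto_const]
  obtain g' r where g': "g' \<noteq> 0" "degree g' \<le> Suc n" "(\<Sum>i\<le>n. smult (coeff g' i) (E0 i)) = smult (coeff g' (Suc n)) 0"
    "\<And>i. (\<lambda>k. coeff (g (r k)) i) \<longlonglongrightarrow> coeff g' i" by blast
  have "coeff g' (Suc n) = 0" using g'(4)[of "Suc n"] unfolding gS by (simp add: LIMSEQ_const_iff)
  moreover have "\<forall>i\<le>n. coeff g' i = 0" using g'(3) ind unfolding indep_def by simp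
  ultimately show False using poly_zeroI[OF g'(2)] g'(1) by blast
qed

lemma sum_smult_monom_mult: "(\<Sum>i\<le>n. smult (u i) (monom 1 i * h)) = h * vpoly n u"
  unfolding vpoly_def sum_distrib_left by (intro sum.cong refl) (simp add: mult.commute)

lemma indep_monom_mult: "h \<noteq> 0 \<Longrightarrow> indep n (\<lambda>i. monom 1 i * h)"
  unfolding indep_def sum_smult_monom_mult by (simp add: vpoly_eq_0)

lemma lin_monom_mult: "lin n (\<lambda>i. monom 1 i * h) = {h * r | r. degree r \<le> n}"
  unfolding lin_def sum_smult_monom_mult using degree_vpoly vpoly_coeff by (auto; metis)

lemma sum_split_at:
  fixes p q :: nat and F :: "nat \<Rightarrow> 'a :: comm_monoid_add"
  shows "(\<Sum>c\<le>p + q + 1. F c) = (\<Sum>c\<le>p. F c) + (\<Sum>j\<le>q. F (p + 1 + j))"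
  by (induction q) (simp_all add: add.assoc)

lemma poly_eqI_points:
  assumes "degree f \<le> d" "degree g \<le> d" "\<And>i. i < Suc d \<Longrightarrow> poly f (zp i) = poly g (zp i)"
  shows "f = g"
proof (rule poly_eqI_degree[of "zp ` {..<Suc d}"])
  have "card (zp ` {..<Suc d}) = Suc d" by (subst card_image) (auto simp: inj_on_def zp_inj)
  then show "degree f < card (zp ` {..<Suc d})" "degree g < card (zp ` {..<Suc d})" using assms(1,2) by simp_all
qed (use assms(3) in auto)

text \<open>Both the form and its transform are unknown, with \<open>q + 1\<close> and
  \<open>p + 1\<close> coordinates. The equation between them is tested at the \<open>d + 1\<close>
  points \<open>zp 0\<close> to \<open>zp d\<close>. The three matched sources play the special
  role; the other \<open>p + q + 1\<close> points give the rows \<open>R\<close>.\<close>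

lemma local_sols_lin:
  fixes p q :: nat and C D :: "nat \<Rightarrow> complex poly"
  defines "d \<equiv> p + q + 3"
  assumes mu: "\<mu> \<in> matchings q p" and dC: "\<And>i. degree (C i) \<le> d" and dD: "\<And>i. degree (D i) \<le> d"
  shows "\<exists>\<epsilon>0>0. \<forall>\<epsilon>. 0 < \<epsilon> \<longrightarrow> \<epsilon> \<le> \<epsilon>0 \<longrightarrow>
    (\<exists>\<delta>>0. \<forall>t. cmod t < \<delta> \<longrightarrow> (\<exists>!y. y \<in> cball (wt \<mu>) \<epsilon> \<and> chart (zt \<mu>) y \<in>
      sols d (lin p (\<lambda>i. monom 1 i * hpoly (q + 3) + smult t (C i))) (lin q (\<lambda>j. monom 1 j * kpoly (p + 3) + smult t (D j)))))"
proof -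
  let ?z = "zt \<mu>" and ?n = "p + q + 1"
  \<comment> \<open>The \<open>q\<close> unmatched roots of \<open>hpoly (q + 3)\<close>, followed
    by the \<open>p + 1\<close> additional evaluation points.\<close>
  let ?L = "unmatched q (fst \<mu>) @ [q + 3..<p + q + 4]"
  define A where "A i t = monom 1 i * hpoly (q + 3) + smult t (C i)" for i t
  define B where "B j t = monom 1 j * kpoly (p + 3) + smult t (D j)" for j t
  define I where "I k = tsel k (fst \<mu>)" for k
  define J where "J k = tsel k (snd \<mu>)" for k
  define M where "M x = chart ?z (tpt x)" for x
  define U where "U v t = (\<Sum>i\<le>p. smult (v i) (A i t))" for v t
  define W where "W v t = (\<Sum>j\<le>q. smult (v (p + 1 + j)) (B j t))" for v t
  define R where "R i c x = (if c \<le> p then - poly (A c (x 3)) (zp i) else poly (form_act d (M x) (B (c - (p + 1)) (x 3))) (zp i))"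
    for i c x
  \<comment> \<open>The cofactor of the root \<open>wp (J k)\<close> in
    \<open>kpoly (p + 3)\<close>, evaluated at \<open>proj k y\<close>. At a matched source and
    \<open>t = 0\<close> the multiples of \<open>hpoly (q + 3)\<close> vanish, and the factor
    \<open>proj k y - wp (J k)\<close> splits off from the rest.\<close>
  define Q where "Q k y = (\<Prod>l\<in>{..<p + 3} - {J k}. proj k y - wp l)" for k y
  define \<rho> where "\<rho> k c x = (if c \<le> p then 0 else chart_scalar ?z (tpt x) k ^ d * (proj k (tpt x) ^ (c - (p + 1)) * Q k (tpt x)))" for k c x
  have lenL: "length ?L = ?n" using card_unmatched(2)[OF mu] by simp
  have dA: "degree (A i t) \<le> d" if "i \<le> p" for i t
  proof -
    have "degree (monom 1 i * hpoly (q + 3)) \<le> d"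
      using degree_mult_le[of "monom 1 i" "hpoly (q + 3)"] that by (simp add: degree_monom_eq d_def)
    then show ?thesis unfolding A_def using dC[of i] degree_smult_le[of t "C i"] by (intro degree_add_le) auto
  qed
  have dB: "degree (B j t) \<le> d" if "j \<le> q" for j t
  proof -
    have "degree (monom 1 j * kpoly (p + 3)) \<le> d"
      using degree_mult_le[of "monom 1 j" "kpoly (p + 3)"] that by (simp add: degree_monom_eq d_def)
    then show ?thesis unfolding B_def using dD[of j] degree_smult_le[of t "D j"] by (intro degree_add_le) auto
  qed
  have dU: "degree (U v t) \<le> d" for v t unfolding U_def
    by (intro degree_sum_le order_trans[OF degree_smult_le dA]) simp_all
  have dW: "degree (W v t) \<le> d" for v t unfolding W_def
    by (intro degree_sum_le order_trans[OF degree_smult_le dB]) simp_all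
  have pB: "polyfunp (\<lambda>x. B i (x 3))" for i
    unfolding B_def by (intro polyfunp_add polyfunp_const polyfunp_smult polyfun.var)
  have pF: "polyfun (\<lambda>x. poly (form_act d (M x) (B j (x 3))) (zp i))" for i j
    unfolding M_def by (rule polyfun_poly[OF polyfunp_form_act_chart[OF pB] degree_form_act polyfun.const])
  have pA: "polyfun (\<lambda>x. - poly (A c (x 3)) (zp i))" for i c
    unfolding A_def poly_add poly_smult by (intro polyfun_uminus polyfun.add polyfun.mult polyfun.const polyfun.var)
  have pR: "polyfun (R i c)" for i c unfolding R_def
    by (cases "c \<le> p") (simp_all only: if_True if_False pA pF)
  have p\<rho>1: "polyfun (\<lambda>x. chart_scalar ?z (tpt x) k ^ d * (proj k (tpt x) ^ (c - (p + 1)) * Q k (tpt x)))" for k c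
    unfolding Q_def
    by (intro polyfun.mult polyfun_power polyfun_chart_scalar polyfun_prod polyfun_diff polyfun.const polyfun_proj_tpt)
  have p\<rho>: "polyfun (\<rho> k c)" for k c unfolding \<rho>_def
    by (cases "c \<le> p") (simp_all only: if_True if_False polyfun.const p\<rho>1)
  have pow_chart: "poly (form_act d (chart ?z y) g) (zp (I k)) = chart_scalar ?z y k ^ d * poly g (proj k y)"
    if "k < 3" "degree g \<le> d" for k y g
    unfolding I_def by (rule poly_form_act_chart[OF mu that])
  have Jp: "J k < p + 3" and Iq: "I k < q + 3" if "k < 3" for k using tsel_less[OF mu that] by (auto simp: J_def I_def)
  have kQ: "poly (kpoly (p + 3)) (proj k y) = (proj k y - wp (J k)) * Q k y" if "k < 3" for k y
    unfolding poly_kpoly Q_def by (rule prod.remove) (use Jp[OF that] in auto)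
  have h0: "poly (hpoly (q + 3)) (zp i) = 0" if "i < q + 3" for i
    using that by (auto simp: poly_hpoly prod_zero_iff)
  have \<beta>\<rho>: "R (I k) c (pt y 0) = (proj k y - proj k (wt \<mu>)) * \<rho> k c (pt y 0)" if k: "k < 3" and c: "c \<le> ?n" for k c y
  proof (cases "c \<le> p")
    case True
    then show ?thesis unfolding R_def \<rho>_def proj_tpt_simps(2) A_def using h0[OF Iq[OF k]] by simp
  next
    case False
    then have j: "c - (p + 1) \<le> q" using c by simp
    have "R (I k) c (pt y 0) = chart_scalar ?z y k ^ d * poly (B (c - (p + 1)) 0) (proj k y)"
      using False unfolding R_def M_def tpt_pt proj_tpt_simps(2) by (simp only: if_False pow_chart[OF k dB[OF j]])
    also have "poly (B (c - (p + 1)) 0) (proj k y) = proj k y ^ (c - (p + 1)) * ((proj k y - wp (J k)) * Q k y)"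
      unfolding B_def by (simp add: poly_monom kQ[OF k])
    finally show ?thesis unfolding \<rho>_def tpt_pt proj_wt[OF k] J_def[symmetric] using False by (simp add: mult.left_commute)
  qed
  have row: "(\<Sum>c\<le>?n. R i c (pt y t) * v c) = poly (form_act d (chart ?z y) (W v t)) (zp i) - poly (U v t) (zp i)" for i y t v
  proof -
    have "(\<Sum>c\<le>p. R i c (pt y t) * v c) = - poly (U v t) (zp i)"
      unfolding R_def U_def poly_sum poly_smult sum_negf[symmetric] by (intro sum.cong) (auto simp: pt_def)
    moreover have "(\<Sum>j\<le>q. R i (p + 1 + j) (pt y t) * v (p + 1 + j)) = poly (form_act d (chart ?z y) (W v t)) (zp i)"
      unfolding W_def form_act_sum form_act_smult poly_sum poly_smult R_def M_def tpt_pt proj_tpt_simps(2)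
      by (intro sum.cong) auto
    ultimately show ?thesis unfolding sum_split_at by simp
  qed
  have cover: "i < Suc d \<longleftrightarrow> i \<in> set ?L \<or> (\<exists>k<3. i = I k)" for i
    unfolding set_append set_unmatched I_def d_def using tsel_less[OF mu] by fastforce
  have goodrows: "(\<forall>r<?n. (\<Sum>c\<le>?n. R (?L ! r) c (pt y t) * v c) = 0) \<longleftrightarrow>
    (\<forall>i\<in>set ?L. poly (form_act d (chart ?z y) (W v t)) (zp i) = poly (U v t) (zp i))" for y t v
    unfolding row using lenL by (auto simp: all_set_conv_all_nth[where xs = ?L] simp del: set_append)
  have nonsing: "\<forall>c\<le>?n. v c = 0"
    if k: "k < 3" and good: "\<forall>r<?n. (\<Sum>c\<le>?n. R (?L ! r) c (pt (wt \<mu>) 0) * v c) = 0"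
      and rho: "(\<Sum>c\<le>?n. \<rho> k c (pt (wt \<mu>) 0) * v c) = 0" for k v
  proof -
    define s where "s = vpoly q (\<lambda>j. v (p + 1 + j))"
    have s: "degree s \<le> q" unfolding s_def by (rule degree_vpoly)
    have U0: "U v 0 = hpoly (q + 3) * vpoly p v" unfolding U_def A_def by (simp add: sum_smult_monom_mult)
    have W0: "W v 0 = kpoly (p + 3) * s" unfolding W_def B_def s_def by (simp add: sum_smult_monom_mult)
    have eqL: "poly (form_act d (chart ?z (wt \<mu>)) (W v 0)) (zp i) = poly (U v 0) (zp i)" if "i \<in> set ?L" for i
      using good that unfolding goodrows by blast
    have eqI: "poly (form_act d (chart ?z (wt \<mu>)) (W v 0)) (zp (I l)) = poly (U v 0) (zp (I l))" if l: "l < 3" for l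
    proof -
      have "poly (W v 0) (proj l (wt \<mu>)) = 0" unfolding W0 proj_wt[OF l] J_def[symmetric] poly_mult
        using kQ[OF l, of "wt \<mu>"] by (simp add: proj_wt[OF l] J_def)
      then show ?thesis unfolding pow_chart[OF l dW] U0 using h0[OF Iq[OF l]] by simp
    qed
    have eq: "form_act d (chart ?z (wt \<mu>)) (W v 0) = U v 0"
      by (rule poly_eqI_points[OF degree_form_act dU]) (use cover eqL eqI in blast)
    have u: "poly (form_act (p + q + 3) (chart ?z (wt \<mu>)) (kpoly (p + 3) * s)) (zp i) = 0"
      if "i \<in> set (unmatched q (fst \<mu>))" for i
    proof -
      have "i < q + 3" using that unfolding set_unmatched by simp
      then show ?thesis using eq unfolding W0 U0 d_def using h0 by simp
    qed
    have "(\<Sum>c\<le>p. \<rho> k c (pt (wt \<mu>) 0) * v c) = 0" by (rule sum.neutral) (simp add: \<rho>_def)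
    moreover have "(\<Sum>j\<le>q. \<rho> k (p + 1 + j) (pt (wt \<mu>) 0) * v (p + 1 + j)) =
      chart_scalar ?z (wt \<mu>) k ^ d * Q k (wt \<mu>) * poly s (wp (J k))"
      unfolding s_def poly_vpoly sum_distrib_left \<rho>_def tpt_pt proj_wt[OF k] J_def
      by (intro sum.cong) (simp_all add: mult_ac)
    ultimately have "chart_scalar ?z (wt \<mu>) k ^ d * Q k (wt \<mu>) * poly s (wp (J k)) = 0"
      using rho unfolding sum_split_at by simp
    moreover have "chart_scalar ?z (wt \<mu>) k \<noteq> 0"
      by (rule chart_scalar_nz[OF tdistinct_zt[OF mu] tdistinct_wt[OF mu]])
    moreover have "Q k (wt \<mu>) \<noteq> 0" unfolding Q_def proj_wt[OF k] J_def[symmetric] by (auto simp: prod_zero_iff wp_inj)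
    ultimately have "poly s (wp (tsel k (snd \<mu>))) = 0" by (simp add: J_def)
    then have s0: "s = 0" using cofactor_zero[OF mu s k u] by blast
    then have "hpoly (q + 3) * vpoly p v = 0" using eq unfolding W0 U0 by (simp add: form_act_0)
    then have v1: "\<forall>c\<le>p. v c = 0" using vpoly_eq_0 by simp
    have v2: "\<forall>j\<le>q. v (p + 1 + j) = 0" using s0 unfolding s_def vpoly_eq_0 .
    show ?thesis
    proof (intro allI impI)
      fix c assume c: "c \<le> ?n"
      show "v c = 0"
      proof (cases "c \<le> p")
        case False
        then have "c = p + 1 + (c - (p + 1))" "c - (p + 1) \<le> q" using c by simp_all
        then show ?thesis using v2 by metis
      qed (use v1 in simp)
    qed
  qed
  have K: "\<exists>\<epsilon>0>0. \<forall>\<epsilon>. 0 < \<epsilon> \<longrightarrow> \<epsilon> \<le> \<epsilon>0 \<longrightarrow>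
    (\<exists>\<delta>>0. \<forall>t. cmod t < \<delta> \<longrightarrow> (\<exists>!y. y \<in> cball (wt \<mu>) \<epsilon> \<and>
      (\<exists>v. (\<exists>c\<le>?n. v c \<noteq> 0) \<and> (\<forall>r<?n. (\<Sum>c\<le>?n. R (?L ! r) c (pt y t) * v c) = 0) \<and>
        (\<forall>k<3. (\<Sum>c\<le>?n. R (I k) c (pt y t) * v c) = 0))))"
    by (rule local_unique_degeneracy[OF pR pR p\<rho> \<beta>\<rho> nonsing])
  obtain r where r: "r > 0" "\<And>y. y \<in> cball (wt \<mu>) r \<Longrightarrow> tdistinct y" using eventually_chart_invertible[OF mu] by blast
  \<comment> \<open>Independence of both families for small \<open>t\<close> ensures that a nonzero
    coordinate vector gives a nonzero form \<open>W v t\<close>.\<close>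
  obtain \<delta>1 where \<delta>1: "\<delta>1 > 0" "\<And>t. cmod t < \<delta>1 \<Longrightarrow> indep p (\<lambda>i. A i t)"
    using indep_eventually[OF indep_monom_mult[OF hpoly_nz]] unfolding A_def by blast
  obtain \<delta>2 where \<delta>2: "\<delta>2 > 0" "\<And>t. cmod t < \<delta>2 \<Longrightarrow> indep q (\<lambda>i. B i t)"
    using indep_eventually[OF indep_monom_mult[OF kpoly_nz]] unfolding B_def by blast
  have eq: "(\<exists>v. (\<exists>c\<le>?n. v c \<noteq> 0) \<and> (\<forall>r<?n. (\<Sum>c\<le>?n. R (?L ! r) c (pt y t) * v c) = 0) \<and>
      (\<forall>k<3. (\<Sum>c\<le>?n. R (I k) c (pt y t) * v c) = 0)) \<longleftrightarrow>
    chart ?z y \<in> sols d (lin p (\<lambda>i. A i t)) (lin q (\<lambda>j. B j t))" (is "?l \<longleftrightarrow> ?r")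
    if y: "y \<in> cball (wt \<mu>) r" and t: "cmod t < min \<delta>1 \<delta>2" for y t
  proof -
    have det: "mdet (chart ?z y) \<noteq> 0" by (rule mdet_chart[OF tdistinct_zt[OF mu] r(2)[OF y]])
    have cond: "(\<forall>r<?n. (\<Sum>c\<le>?n. R (?L ! r) c (pt y t) * v c) = 0) \<and> (\<forall>k<3. (\<Sum>c\<le>?n. R (I k) c (pt y t) * v c) = 0) \<longleftrightarrow>
      form_act d (chart ?z y) (W v t) = U v t" for v
    proof
      assume a: "(\<forall>r<?n. (\<Sum>c\<le>?n. R (?L ! r) c (pt y t) * v c) = 0) \<and> (\<forall>k<3. (\<Sum>c\<le>?n. R (I k) c (pt y t) * v c) = 0)"
      have "poly (form_act d (chart ?z y) (W v t)) (zp i) = poly (U v t) (zp i)" if i: "i < Suc d" for i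
      proof (cases "i \<in> set ?L")
        case True
        then show ?thesis using a unfolding goodrows by blast
      next
        case False
        then obtain k where k: "k < 3" "i = I k" using i False cover[of i] by blast
        have "(\<Sum>c\<le>?n. R (I k) c (pt y t) * v c) = 0" using conjunct2[OF a] k(1) by blast
        then show ?thesis unfolding row k(2) by simp
      qed
      then show "form_act d (chart ?z y) (W v t) = U v t" by (rule poly_eqI_points[OF degree_form_act dU])
    next
      assume "form_act d (chart ?z y) (W v t) = U v t"
      then show "(\<forall>r<?n. (\<Sum>c\<le>?n. R (?L ! r) c (pt y t) * v c) = 0) \<and> (\<forall>k<3. (\<Sum>c\<le>?n. R (I k) c (pt y t) * v c) = 0)"
        unfolding row by simp
    qed
    show ?thesis
    proof
      assume ?l
      then obtain v where v: "\<exists>c\<le>?n. v c \<noteq> 0" "form_act d (chart ?z y) (W v t) = U v t" using cond by blast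
      have "W v t \<noteq> 0"
      proof
        assume w: "W v t = 0"
        then have u: "U v t = 0" using v(2) by (simp add: form_act_0)
        have v1: "\<forall>c\<le>p. v c = 0" using u \<delta>1(2)[of t] t unfolding indep_def U_def by simp
        have v2: "\<forall>j\<le>q. v (p + 1 + j) = 0"
          using w \<delta>2(2)[of t] t unfolding indep_def W_def by (metis min_less_iff_conj)
        obtain c where c: "c \<le> ?n" "v c \<noteq> 0" using v(1) by blast
        have "\<not> c \<le> p" using v1 c by blast
        then have "c = p + 1 + (c - (p + 1))" "c - (p + 1) \<le> q" using c by simp_all
        then show False using v2 c(2) by metis
      qed
      moreover have "W v t \<in> lin q (\<lambda>j. B j t)" unfolding W_def by (rule lin_memI)
      moreover have "U v t \<in> lin p (\<lambda>i. A i t)" unfolding U_def by (rule lin_memI)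
      ultimately show ?r using v(2) det unfolding sols_def by auto
    next
      assume ?r
      then obtain g where g: "g \<in> lin q (\<lambda>j. B j t)" "g \<noteq> 0" "form_act d (chart ?z y) g \<in> lin p (\<lambda>i. A i t)"
        unfolding sols_def by blast
      obtain v2 where v2: "g = (\<Sum>j\<le>q. smult (v2 j) (B j t))" using g(1) unfolding lin_def by blast
      obtain v1 where v1: "form_act d (chart ?z y) g = (\<Sum>i\<le>p. smult (v1 i) (A i t))" using g(3) unfolding lin_def by blast
      define v where "v c = (if c \<le> p then v1 c else v2 (c - (p + 1)))" for c
      have W: "W v t = g" unfolding W_def v2 by (intro sum.cong) (simp_all add: v_def)
      have U: "U v t = form_act d (chart ?z y) g" unfolding U_def v1 by (intro sum.cong) (simp_all add: v_def)
      have "\<exists>j\<le>q. v2 j \<noteq> 0"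
      proof (rule ccontr)
        assume "\<not> ?thesis"
        then have "g = 0" unfolding v2 by (intro sum.neutral) simp
        then show False using g(2) by simp
      qed
      then obtain j where "j \<le> q" "v2 j \<noteq> 0" by blast
      then have "\<exists>c\<le>?n. v c \<noteq> 0" by (intro exI[of _ "p + 1 + j"]) (simp add: v_def)
      then show ?l using cond[of v] W U by auto
    qed
  qed
  show ?thesis unfolding A_def[symmetric] B_def[symmetric]
  proof (rule transfer_unique[OF K])
    show "0 < r" by (rule r(1))
    show "0 < min \<delta>1 \<delta>2" using \<delta>1 \<delta>2 by simp
  qed (rule eq)
qed

theorem card_sols_lin:
  fixes p q :: nat and C D :: "nat \<Rightarrow> complex poly"
  defines "d \<equiv> p + q + 3"
  assumes dC: "\<And>i. degree (C i) \<le> d" and dD: "\<And>i. degree (D i) \<le> d"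
  shows "\<exists>\<delta>>0. \<forall>t. cmod t < \<delta> \<longrightarrow>
    (let S = pgl_class ` sols d (lin p (\<lambda>i. monom 1 i * hpoly (q + 3) + smult t (C i))) (lin q (\<lambda>j. monom 1 j * kpoly (p + 3) + smult t (D j)))
     in finite S \<and> card S = card (matchings q p))"
  unfolding Let_def d_def
proof (rule card_sols_eventually)
  show "cone (p + q + 3) (lin p (\<lambda>i. monom 1 i * hpoly (q + 3) + smult t (C i)))" for t
  proof (rule cone_lin)
    fix i assume "i \<le> p"
    then have "degree (monom 1 i * hpoly (q + 3)) \<le> p + q + 3"
      using degree_mult_le[of "monom 1 i" "hpoly (q + 3)"] by (simp add: degree_monom_eq)
    then show "degree (monom 1 i * hpoly (q + 3) + smult t (C i)) \<le> p + q + 3"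
      using dC[of i] degree_smult_le[of t "C i"] unfolding d_def by (intro degree_add_le) auto
  qed
  show "cone (p + q + 3) (lin q (\<lambda>j. monom 1 j * kpoly (p + 3) + smult t (D j)))" for t
  proof (rule cone_lin)
    fix i assume "i \<le> q"
    then have "degree (monom 1 i * kpoly (p + 3)) \<le> p + q + 3"
      using degree_mult_le[of "monom 1 i" "kpoly (p + 3)"] by (simp add: degree_monom_eq)
    then show "degree (monom 1 i * kpoly (p + 3) + smult t (D i)) \<le> p + q + 3"
      using dD[of i] degree_smult_le[of t "D i"] unfolding d_def by (intro degree_add_le) auto
  qed
  show "closed_at_0 (p + q + 3) (\<lambda>t. lin p (\<lambda>i. monom 1 i * hpoly (q + 3) + smult t (C i))) {hpoly (q + 3) * r |r. degree r \<le> p}"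
    unfolding lin_monom_mult[symmetric] by (rule closed_at_0_lin[OF indep_monom_mult[OF hpoly_nz]])
  show "closed_at_0 (p + q + 3) (\<lambda>t. lin q (\<lambda>j. monom 1 j * kpoly (p + 3) + smult t (D j))) {kpoly (p + 3) * s |s. degree s \<le> q}"
    unfolding lin_monom_mult[symmetric] by (rule closed_at_0_lin[OF indep_monom_mult[OF kpoly_nz]])
qed (rule local_sols_lin[OF _ dC[unfolded d_def] dD[unfolded d_def]])

section \<open>Dimensions and annihilators\<close>

interpretation pvs: vector_space "Polynomial.smult :: complex \<Rightarrow> complex poly \<Rightarrow> complex poly"
  by unfold_locales (simp_all add: smult_add_right smult_add_left)

lemma pdim_eq: "pdim S = pvs.dim S" by (simp add: pdim_def)
lemma pspan_eq: "pspan S = pvs.span S" by (simp add: pspan_def)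

lemma span_image_eq_lin: "pvs.span (E ` {..n}) = lin n E"
proof (rule equalityI)
  have "pvs.subspace (lin n E)"
  proof (rule pvs.subspaceI)
    show "0 \<in> lin n E" using lin_memI[of "\<lambda>_. 0" E n] by simp
    show "x + y \<in> lin n E" if "x \<in> lin n E" "y \<in> lin n E" for x y
    proof -
      obtain u v where "x = (\<Sum>i\<le>n. smult (u i) (E i))" "y = (\<Sum>i\<le>n. smult (v i) (E i))"
        using \<open>x \<in> lin n E\<close> \<open>y \<in> lin n E\<close> unfolding lin_def by blast
      then have "x + y = (\<Sum>i\<le>n. smult (u i + v i) (E i))" by (simp add: smult_add_left sum.distrib)
      then show ?thesis using lin_memI[of "\<lambda>i. u i + v i" E n] by simp
    qed
    show "smult k x \<in> lin n E" if x: "x \<in> lin n E" for k x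
    proof -
      obtain u where "x = (\<Sum>i\<le>n. smult (u i) (E i))" using x unfolding lin_def by blast
      then have "smult k x = (\<Sum>i\<le>n. smult (k * u i) (E i))" by (simp add: smult_sum_right)
      then show ?thesis using lin_memI[of "\<lambda>i. k * u i" E n] by simp
    qed
  qed
  moreover have "E i \<in> lin n E" if "i \<le> n" for i
  proof -
    have "(\<Sum>j\<le>n. smult (if j = i then 1 else 0) (E j)) = E i"
      using that by (simp add: if_distrib[of "\<lambda>a. smult a _"] cong: if_cong)
    then show ?thesis using lin_memI[of "\<lambda>j. if j = i then 1 else 0" E n] by simp
  qed
  ultimately show "pvs.span (E ` {..n}) \<subseteq> lin n E" by (intro pvs.span_minimal) auto
  show "lin n E \<subseteq> pvs.span (E ` {..n})"
  proof
    fix x assume "x \<in> lin n E"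
    then obtain u where x: "x = (\<Sum>i\<le>n. smult (u i) (E i))" unfolding lin_def by blast
    show "x \<in> pvs.span (E ` {..n})"
      unfolding x by (intro pvs.span_sum pvs.span_scale pvs.span_base) auto
  qed
qed

lemma dim_lin_le_iff: "pvs.dim (lin n E) \<le> n \<longleftrightarrow> \<not> indep n E"
proof
  assume d: "pvs.dim (lin n E) \<le> n"
  show "\<not> indep n E"
  proof
    assume ind: "indep n E"
    have inj: "inj_on E {..n}"
    proof (rule inj_onI, rule ccontr)
      fix i j assume ij: "i \<in> {..n}" "j \<in> {..n}" "E i = E j" "i \<noteq> j"
      define u where "u k = (if k = i then 1 else if k = j then - 1 else 0 :: complex)" for k
      have "(\<Sum>k\<le>n. smult (u k) (E k)) = (\<Sum>k\<in>{i, j}. smult (u k) (E k))"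
        by (rule sum.mono_neutral_right) (use ij in \<open>auto simp: u_def\<close>)
      also have "\<dots> = 0" using ij by (simp add: u_def)
      finally have "\<forall>k\<le>n. u k = 0" using ind unfolding indep_def by blast
      then show False using ij(1) by (auto simp: u_def)
    qed
    have "pvs.independent (E ` {..n})"
    proof
      assume "pvs.dependent (E ` {..n})"
      then obtain u where u: "\<exists>v\<in>E ` {..n}. u v \<noteq> 0" "(\<Sum>v\<in>E ` {..n}. smult (u v) v) = 0"
        unfolding pvs.dependent_finite[OF finite_imageI[OF finite_atMost]] by blast
      have "(\<Sum>i\<le>n. smult (u (E i)) (E i)) = 0" using u(2) by (simp add: sum.reindex[OF inj])
      then have "\<forall>i\<le>n. u (E i) = 0" using ind[unfolded indep_def, THEN spec, of "\<lambda>i. u (E i)"] by simp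
      then show False using u(1) by auto
    qed
    then have "pvs.dim (lin n E) = Suc n"
      unfolding span_image_eq_lin[symmetric] by (subst pvs.dim_span_eq_card_independent) (auto simp: card_image[OF inj])
    then show False using d by simp
  qed
next
  assume "\<not> indep n E"
  then obtain u i where u: "(\<Sum>i\<le>n. smult (u i) (E i)) = 0" "i \<le> n" "u i \<noteq> 0" unfolding indep_def by blast
  let ?S = "E ` ({..n} - {i})"
  have "smult (u i) (E i) = - (\<Sum>j\<in>{..n} - {i}. smult (u j) (E j))"
    using u(1) sum.remove[of "{..n}" i "\<lambda>i. smult (u i) (E i)"] u(2) by (simp add: eq_neg_iff_add_eq_0)
  also have "\<dots> \<in> pvs.span ?S"
    by (intro pvs.span_neg pvs.span_sum pvs.span_scale pvs.span_base) auto
  finally have "smult (inverse (u i)) (smult (u i) (E i)) \<in> pvs.span ?S" by (rule pvs.span_scale)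
  then have "E i \<in> pvs.span ?S" using u(3) by simp
  then have "E ` {..n} \<subseteq> pvs.span ?S" by (auto intro: pvs.span_base)
  then have "lin n E \<subseteq> pvs.span ?S"
    unfolding span_image_eq_lin[symmetric] using pvs.span_minimal pvs.subspace_span by blast
  then have "pvs.dim (lin n E) \<le> card ?S" by (intro pvs.dim_le_card) auto
  also have "\<dots> \<le> card ({..n} - {i})" by (rule card_image_le) simp
  also have "\<dots> = n" using u(2) by simp
  finally show "pvs.dim (lin n E) \<le> n" .
qed

definition rowp :: "nat \<Rightarrow> (nat \<Rightarrow> nat \<Rightarrow> complex) \<Rightarrow> nat \<Rightarrow> complex poly" where
  "rowp d A i = vpoly d (A i)"

lemma degree_rowp: "degree (rowp d A i) \<le> d" unfolding rowp_def by (rule degree_vpoly)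

lemma row_span_eq_lin: "row_span d n A = lin n (rowp d A)"
proof -
  have "(\<Sum>j\<le>d. monom (A i j) j) = rowp d A i" for i
    unfolding rowp_def vpoly_def by (simp add: smult_monom)
  then have "{(\<Sum>j\<le>d. monom (A i j) j) | i. i \<le> n} = rowp d A ` {..n}" by auto
  then show ?thesis unfolding row_span_def pspan_eq using span_image_eq_lin by simp
qed

lemma subspace_act_lin: "subspace_act d m (lin n E) = lin n (\<lambda>i. form_act d m (E i))"
proof -
  have "form_act d m (\<Sum>i\<le>n. smult (u i) (E i)) = (\<Sum>i\<le>n. smult (u i) (form_act d m (E i)))" for u
    by (simp add: form_act_sum form_act_smult)
  then show ?thesis unfolding subspace_act_def lin_def by (auto simp: image_iff) metis+
qed

definition concat_fam :: "nat \<Rightarrow> (nat \<Rightarrow> complex poly) \<Rightarrow> (nat \<Rightarrow> complex poly) \<Rightarrow> nat \<Rightarrow> complex poly" where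
  "concat_fam a E F c = (if c \<le> a then E c else F (c - (a + 1)))"

lemma sum_concat_fam: "(\<Sum>c\<le>a + b + 1. smult (u c) (concat_fam a E F c)) =
  (\<Sum>i\<le>a. smult (u i) (E i)) + (\<Sum>j\<le>b. smult (u (a + 1 + j)) (F j))"
  unfolding sum_split_at by (simp add: concat_fam_def)

lemma subspace_sum_lin: "subspace_sum (lin a E) (lin b F) = lin (a + b + 1) (concat_fam a E F)"
proof (rule equalityI; rule subsetI)
  fix x assume "x \<in> subspace_sum (lin a E) (lin b F)"
  then obtain u v where "x = (\<Sum>i\<le>a. smult (u i) (E i)) + (\<Sum>j\<le>b. smult (v j) (F j))"
    unfolding subspace_sum_def lin_def by blast
  then have "x = (\<Sum>c\<le>a + b + 1. smult ((\<lambda>c. if c \<le> a then u c else v (c - (a + 1))) c) (concat_fam a E F c))"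
    unfolding sum_concat_fam by simp
  then show "x \<in> lin (a + b + 1) (concat_fam a E F)" by (simp only: lin_memI)
next
  fix x assume "x \<in> lin (a + b + 1) (concat_fam a E F)"
  then obtain u where "x = (\<Sum>c\<le>a + b + 1. smult (u c) (concat_fam a E F c))" unfolding lin_def by blast
  then have "x = (\<Sum>i\<le>a. smult (u i) (E i)) + (\<Sum>j\<le>b. smult (u (a + 1 + j)) (F j))" unfolding sum_concat_fam .
  then show "x \<in> subspace_sum (lin a E) (lin b F)"
    unfolding subspace_sum_def by (intro CollectI exI conjI) (assumption, (rule lin_memI)+)
qed

lemma sum_act_eq_lin: "subspace_sum (lin a E) (subspace_act d m (lin b F)) =
  lin (a + b + 1) (concat_fam a E (\<lambda>j. form_act d m (F j)))"
  unfolding subspace_act_lin subspace_sum_lin ..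

text \<open>A linear relation in the concatenated family is an equation between a combination of the
  \<open>E i\<close> and the transform of a combination \<open>g\<close> of the \<open>F j\<close>.
  Independence of both families makes \<open>g\<close> nonzero for a nontrivial relation.\<close>

lemma sols_lin_iff:
  assumes "indep a E" "indep b F" "mdet m \<noteq> 0"
  shows "pdim (subspace_sum (lin a E) (subspace_act d m (lin b F))) \<le> a + b + 1 \<longleftrightarrow> m \<in> sols d (lin a E) (lin b F)"
proof -
  let ?G = "concat_fam a E (\<lambda>j. form_act d m (F j))"
  have act: "(\<Sum>j\<le>b. smult (v j) (form_act d m (F j))) = form_act d m (\<Sum>j\<le>b. smult (v j) (F j))" for v
    by (simp add: form_act_sum form_act_smult)
  have "\<not> indep (a + b + 1) ?G \<longleftrightarrow> m \<in> sols d (lin a E) (lin b F)"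
  proof
    assume "\<not> indep (a + b + 1) ?G"
    then obtain u c where u: "(\<Sum>c\<le>a + b + 1. smult (u c) (?G c)) = 0" "c \<le> a + b + 1" "u c \<noteq> 0"
      unfolding indep_def by blast
    define g where "g = (\<Sum>j\<le>b. smult (u (a + 1 + j)) (F j))"
    have e: "(\<Sum>i\<le>a. smult (u i) (E i)) + form_act d m g = 0"
      using u(1) unfolding sum_concat_fam act g_def .
    have "g \<noteq> 0"
    proof
      assume g: "g = 0"
      then have "\<forall>j\<le>b. u (a + 1 + j) = 0" using assms(2) unfolding indep_def g_def by meson
      moreover have "\<forall>i\<le>a. u i = 0" using e g assms(1) unfolding indep_def by (simp add: form_act_0)
      ultimately show False using u(2,3)
        by (cases "c \<le> a") (auto dest!: spec[of _ "c - (a + 1)"])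
    qed
    moreover have "form_act d m g = (\<Sum>i\<le>a. smult (- u i) (E i))"
      using e by (simp add: sum_negf add_eq_0_iff)
    then have "form_act d m g \<in> lin a E" using lin_memI[of "\<lambda>i. - u i" E a] by simp
    moreover have "g \<in> lin b F" unfolding g_def by (rule lin_memI)
    ultimately show "m \<in> sols d (lin a E) (lin b F)" unfolding sols_def using assms(3) by blast
  next
    assume "m \<in> sols d (lin a E) (lin b F)"
    then obtain g where g: "g \<in> lin b F" "g \<noteq> 0" "form_act d m g \<in> lin a E" unfolding sols_def by blast
    obtain v where v: "g = (\<Sum>j\<le>b. smult (v j) (F j))" using g(1) unfolding lin_def by blast
    obtain w where w: "form_act d m g = (\<Sum>i\<le>a. smult (w i) (E i))" using g(3) unfolding lin_def by blast
    define u where "u c = (if c \<le> a then - w c else v (c - (a + 1)))" for c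
    have "(\<Sum>c\<le>a + b + 1. smult (u c) (?G c)) = 0"
      unfolding sum_concat_fam act using v w by (simp add: u_def sum_negf)
    moreover have "\<exists>c\<le>a + b + 1. u c \<noteq> 0"
    proof (rule ccontr)
      assume n: "\<not> ?thesis"
      have "v j = 0" if "j \<le> b" for j
      proof -
        have "u (a + 1 + j) = 0" using n that by simp
        then show ?thesis by (simp add: u_def)
      qed
      then have "g = 0" unfolding v by (intro sum.neutral) simp
      then show False using g(2) by simp
    qed
    ultimately show "\<not> indep (a + b + 1) ?G" unfolding indep_def by blast
  qed
  then show ?thesis unfolding pdim_eq sum_act_eq_lin dim_lin_le_iff .
qed

lemma pair_sum_right: "pair d f (\<Sum>i\<in>A. smult (v i) (g i)) = (\<Sum>i\<in>A. v i * pair d f (g i))"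
  unfolding pair_def coeff_sum sum_distrib_left
  by (subst sum.swap) (simp add: mult.assoc mult.left_commute)

lemma pair_monom_right: "j \<le> d \<Longrightarrow> pair d f (monom 1 (d - j)) = (-1) ^ j / of_nat (d choose j) * coeff f j"
proof -
  assume j: "j \<le> d"
  have "pair d f (monom 1 (d - j)) = (\<Sum>i\<le>d. if i = j then (-1) ^ j / of_nat (d choose j) * coeff f j else 0)"
    unfolding pair_def by (intro sum.cong refl) (use j in auto)
  then show ?thesis using j by simp
qed

text \<open>The form \<open>f\<close> solves a homogeneous linear system with more unknowns than equations.\<close>

lemma dim_lin_le_iff_pair:
  assumes deg: "\<And>i. i \<le> n \<Longrightarrow> degree (E i) \<le> d"
  shows "pvs.dim (lin n E) \<le> d \<longleftrightarrow> (\<exists>f. f \<noteq> 0 \<and> degree f \<le> d \<and> (\<forall>i\<le>n. pair d f (E i) = 0))"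
proof
  assume dm: "pvs.dim (lin n E) \<le> d"
  obtain B where B: "B \<subseteq> lin n E" "pvs.independent B" "lin n E \<subseteq> pvs.span B" "card B = pvs.dim (lin n E)"
    using pvs.basis_exists by blast
  have "B \<subseteq> pvs.span (E ` {..n})" using B(1) span_image_eq_lin by simp
  then have fB: "finite B" using pvs.independent_span_bound[OF _ B(2)] by blast
  obtain b where b: "bij_betw b {0..<card B} B" using ex_bij_betw_nat_finite[OF fB] by blast
  \<comment> \<open>The columns of the linear system, written as polynomials of degree below
    \<open>card B\<close>: being \<open>d + 1\<close> vectors in a space of dimension at most
    \<open>d\<close>, they are dependent, and the weights of a relation are the coefficients of the
    wanted form.\<close>
  define G where "G j = (\<Sum>i<card B. smult (pair d (monom 1 j) (b i)) (monom 1 i))" for j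
  have "lin d G \<subseteq> pvs.span ((\<lambda>i. monom 1 i) ` {..<card B})"
    unfolding span_image_eq_lin[symmetric]
  proof (rule pvs.span_minimal)
    show "G ` {..d} \<subseteq> pvs.span ((\<lambda>i. monom 1 i) ` {..<card B})"
    proof (rule image_subsetI)
      show "G j \<in> pvs.span ((\<lambda>i. monom 1 i) ` {..<card B})" for j
        unfolding G_def by (intro pvs.span_sum pvs.span_scale pvs.span_base) auto
    qed
  qed simp
  then have "pvs.dim (lin d G) \<le> card ((\<lambda>i. monom (1::complex) i) ` {..<card B})" by (intro pvs.dim_le_card) auto
  also have "\<dots> \<le> card {..<card B}" by (rule card_image_le) simp
  also have "\<dots> \<le> d" using B(4) dm by simp
  finally have "\<not> indep d G" by (simp add: dim_lin_le_iff)
  then obtain u c where u: "(\<Sum>j\<le>d. smult (u j) (G j)) = 0" "c \<le> d" "u c \<noteq> 0" unfolding indep_def by blast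
  have kb: "pair d (vpoly d u) (b i) = 0" if "i < card B" for i
  proof -
    have "coeff (\<Sum>j\<le>d. smult (u j) (G j)) i = (\<Sum>j\<le>d. u j * pair d (monom 1 j) (b i))"
      using that by (simp add: G_def coeff_sum smult_monom sum.delta' cong: if_cong)
    then show ?thesis using u(1) unfolding vpoly_def pair_sum_left by simp
  qed
  have kB: "pair d (vpoly d u) x = 0" if xB: "x \<in> B" for x
  proof -
    have "x \<in> b ` {0..<card B}" unfolding bij_betw_imp_surj_on[OF b] by (rule xB)
    then obtain i where "i < card B" "x = b i" by (elim imageE) simp
    then show ?thesis using kb by simp
  qed
  have "pvs.subspace {x. pair d (vpoly d u) x = 0}"
  proof (rule pvs.subspaceI)
    show "0 \<in> {x. pair d (vpoly d u) x = 0}" by (simp add: pair_def)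
  qed (simp_all add: pair_add_right pair_smult_right)
  then have "pvs.span B \<subseteq> {x. pair d (vpoly d u) x = 0}" using kB by (intro pvs.span_minimal) auto
  moreover have "E i \<in> lin n E" if "i \<le> n" for i
    unfolding span_image_eq_lin[symmetric] using that by (intro pvs.span_base) simp
  ultimately have "\<forall>i\<le>n. pair d (vpoly d u) (E i) = 0" using B(3) by blast
  moreover have "vpoly d u \<noteq> 0" using u by (auto simp: vpoly_eq_0)
  ultimately show "\<exists>f. f \<noteq> 0 \<and> degree f \<le> d \<and> (\<forall>i\<le>n. pair d f (E i) = 0)" using degree_vpoly by blast
next
  assume "\<exists>f. f \<noteq> 0 \<and> degree f \<le> d \<and> (\<forall>i\<le>n. pair d f (E i) = 0)"
  then obtain f where f: "f \<noteq> 0" "degree f \<le> d" "\<And>i. i \<le> n \<Longrightarrow> pair d f (E i) = 0" by blast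
  \<comment> \<open>Pairing with the monomial of degree \<open>d - degree f\<close> picks out the
    leading coefficient of \<open>f\<close>, hence is nonzero; the kernel of the functional is then
    spanned by \<open>d\<close> corrected monomials.\<close>
  define j0 where "j0 = d - degree f"
  have j0: "j0 \<le> d" by (simp add: j0_def)
  define \<phi> where "\<phi> j = pair d f (monom 1 j)" for j
  have p0: "\<phi> j0 \<noteq> 0"
    unfolding \<phi>_def j0_def pair_monom_right[OF f(2)] using f(1,2) by (simp add: binomial_eq_0_iff)
  define H where "H j = monom 1 j - smult (\<phi> j / \<phi> j0) (monom 1 j0)" for j
  let ?S = "H ` ({..d} - {j0})"
  have ker: "g \<in> pvs.span ?S" if g: "degree g \<le> d" "pair d f g = 0" for g
  proof -
    have gs: "g = (\<Sum>j\<le>d. smult (coeff g j) (monom 1 j))" using vpoly_coeff[OF g(1)] unfolding vpoly_def by simp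
    have z: "(\<Sum>j\<le>d. coeff g j * \<phi> j) = 0"
      using g(2) pair_sum_right[of d f "coeff g" "\<lambda>j. monom 1 j" "{..d}"] gs unfolding \<phi>_def by simp
    have "(\<Sum>j\<le>d. smult (coeff g j) (H j)) = g - (\<Sum>j\<le>d. smult (coeff g j * (\<phi> j / \<phi> j0)) (monom 1 j0))"
      unfolding H_def smult_diff_right sum_subtractf gs[symmetric] smult_smult ..
    also have "(\<Sum>j\<le>d. smult (coeff g j * (\<phi> j / \<phi> j0)) (monom 1 j0)) = smult (\<Sum>j\<le>d. coeff g j * (\<phi> j / \<phi> j0)) (monom 1 j0)"
      by (rule smult_sum[symmetric])
    also have "(\<Sum>j\<le>d. coeff g j * (\<phi> j / \<phi> j0)) = (\<Sum>j\<le>d. coeff g j * \<phi> j) / \<phi> j0"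
      by (simp add: sum_divide_distrib)
    finally have "g = (\<Sum>j\<le>d. smult (coeff g j) (H j))" using z by simp
    also have "\<dots> = (\<Sum>j\<in>{..d} - {j0}. smult (coeff g j) (H j))"
      by (rule sum.mono_neutral_right) (use p0 in \<open>auto simp: H_def\<close>)
    also have "\<dots> \<in> pvs.span ?S" by (intro pvs.span_sum pvs.span_scale pvs.span_base) auto
    finally show ?thesis .
  qed
  have "lin n E \<subseteq> pvs.span ?S"
    unfolding span_image_eq_lin[symmetric] by (rule pvs.span_minimal) (use ker deg f(3) in auto)
  then have "pvs.dim (lin n E) \<le> card ?S" by (intro pvs.dim_le_card) auto
  also have "\<dots> \<le> card ({..d} - {j0})" by (rule card_image_le) simp
  also have "\<dots> = d" using j0 by simp
  finally show "pvs.dim (lin n E) \<le> d" .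
qed

section \<open>Invariance of the pairing\<close>

lemma pair_linear_power_general: "pair d f ([:v, u:] ^ d) = heval d f (- v) u"
  unfolding pair_def heval_def
proof (intro sum.cong refl)
  fix i assume "i \<in> {..d}"
  then have i: "i \<le> d" by simp
  have "coeff ([:v, u:] ^ d) (d - i) = of_nat (d choose i) * u ^ (d - i) * v ^ i"
    using coeff_linear_poly_power[of "d - i" d v u] i by (simp add: binomial_symmetric[symmetric])
  moreover have "of_nat (d choose i) \<noteq> (0 :: complex)" using i by (simp add: binomial_eq_0_iff)
  ultimately show "(- 1) ^ i / of_nat (d choose i) * coeff f i * coeff ([:v, u:] ^ d) (d - i) = coeff f i * (- v) ^ i * u ^ (d - i)"
    by (simp add: power_minus[of v])
qed

text \<open>For powers of linear forms the pairing is evaluation, where the adjugate visibly is the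
  adjoint. The powers \<open>[:- z, 1:] ^ d\<close> determine everything, because the defect is a
  polynomial in \<open>z\<close>.\<close>

lemma pair_form_act:
  assumes det: "mdet m \<noteq> 0" and f: "degree f \<le> d" and g: "degree g \<le> d"
  shows "pair d f (form_act d m g) = pair d (form_act d (madj m) f) g"
proof -
  obtain a b c e where m: "m = (a, b, c, e)" by (cases m)
  define \<Delta> where "\<Delta> i = pair d f (form_act d m (monom 1 i)) - pair d (form_act d (madj m) f) (monom 1 i)" for i
  have lin: "pair d f (form_act d m (vpoly d v)) - pair d (form_act d (madj m) f) (vpoly d v) = (\<Sum>i\<le>d. v i * \<Delta> i)" for v
    unfolding vpoly_def form_act_sum form_act_smult pair_sum_right \<Delta>_def by (simp add: right_diff_distrib sum_subtractf)
  have pw: "pair d f (form_act d m ([:- z, 1:] ^ d)) = pair d (form_act d (madj m) f) ([:- z, 1:] ^ d)" for z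
  proof -
    have "form_act d m ([:- z, 1:] ^ d) = [:b - z * e, a - z * c:] ^ d"
      using form_act_prod_roots[OF det[unfolded m], of d "\<lambda>_. z"] by (simp add: m)
    then have "pair d f (form_act d m ([:- z, 1:] ^ d)) = heval d f (- (b - z * e)) (a - z * c)"
      by (simp only: pair_linear_power_general)
    also have "\<dots> = poly (form_act d (madj m) f) z"
      by (simp add: m poly_form_act mult.commute)
    finally show ?thesis by (simp add: pair_linear_power degree_form_act)
  qed
  \<comment> \<open>The defect on \<open>[:- z, 1:] ^ d\<close> as a polynomial in \<open>z\<close>;
    its coefficients are nonzero multiples of the defects \<open>\<Delta> i\<close> on
    monomials.\<close>
  define P where "P = (\<Sum>i\<le>d. monom (of_nat (d choose i) * (-1) ^ (d - i) * \<Delta> i) (d - i))"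
  have "poly P z = 0" for z
  proof -
    have dz: "degree ([:- z, 1:] ^ d) \<le> d" by (simp add: degree_power_eq)
    have "(\<Sum>i\<le>d. coeff ([:- z, 1:] ^ d) i * \<Delta> i) = 0"
      using lin[of "coeff ([:- z, 1:] ^ d)"] pw[of z] unfolding vpoly_coeff[OF dz] by simp
    moreover have "poly P z = (\<Sum>i\<le>d. coeff ([:- z, 1:] ^ d) i * \<Delta> i)"
      unfolding P_def poly_sum poly_monom
      by (intro sum.cong refl) (simp add: coeff_linear_poly_power power_minus[of z] mult_ac)
    ultimately show ?thesis by simp
  qed
  then have P0: "P = 0" using poly_all_0_iff_0 by blast
  have "\<Delta> i = 0" if "i \<le> d" for i
  proof -
    have "coeff P (d - i) = (\<Sum>j\<le>d. if j = i then of_nat (d choose i) * (-1) ^ (d - i) * \<Delta> i else 0)"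
      unfolding P_def coeff_sum coeff_monom by (intro sum.cong refl) (use that in auto)
    also have "\<dots> = of_nat (d choose i) * (-1) ^ (d - i) * \<Delta> i" using that by simp
    finally show ?thesis using P0 that by (simp add: binomial_eq_0_iff)
  qed
  then have "(\<Sum>i\<le>d. coeff g i * \<Delta> i) = 0" by (intro sum.neutral) simp
  then show ?thesis using lin[of "coeff g"] unfolding vpoly_coeff[OF g] by simp
qed

text \<open>In the space of dimension \<open>d + 1\<close> the sum is proper iff some nonzero
  \<open>f\<close> annihilates both summands. By invariance this means that
  \<open>form_act d (madj m) f\<close> annihilates the \<open>F j\<close>, and \<open>m\<close>
  carries that form back to a multiple of \<open>f\<close>.\<close>

lemma sols_ann_iff:
  assumes det: "mdet m \<noteq> 0" and E: "\<And>i. i \<le> a \<Longrightarrow> degree (E i) \<le> d" and F: "\<And>j. j \<le> b \<Longrightarrow> degree (F j) \<le> d"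
  shows "pdim (subspace_sum (lin a E) (subspace_act d m (lin b F))) \<le> d \<longleftrightarrow>
    m \<in> sols d (ann d (Suc a) E) (ann d (Suc b) F)"
proof -
  let ?G = "concat_fam a E (\<lambda>j. form_act d m (F j))"
  have dG: "degree (?G c) \<le> d" if "c \<le> a + b + 1" for c
    unfolding concat_fam_def using that E degree_form_act by simp
  have spl: "(\<forall>c\<le>a + b + 1. pair d f (?G c) = 0) \<longleftrightarrow>
    (\<forall>i<Suc a. pair d f (E i) = 0) \<and> (\<forall>j<Suc b. pair d f (form_act d m (F j)) = 0)" for f
  proof (intro iffI conjI allI impI)
    assume q: "\<forall>c\<le>a + b + 1. pair d f (?G c) = 0"
    show "pair d f (E i) = 0" if "i < Suc a" for i
      using q[rule_format, of i] that by (simp add: concat_fam_def)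
    show "pair d f (form_act d m (F j)) = 0" if "j < Suc b" for j
      using q[rule_format, of "a + 1 + j"] that by (simp add: concat_fam_def)
  next
    fix c assume q: "(\<forall>i<Suc a. pair d f (E i) = 0) \<and> (\<forall>j<Suc b. pair d f (form_act d m (F j)) = 0)"
      and c: "c \<le> a + b + 1"
    show "pair d f (?G c) = 0"
    proof (cases "c \<le> a")
      case True
      then show ?thesis using conjunct1[OF q] by (simp add: concat_fam_def)
    next
      case False
      then have "c - (a + 1) < Suc b" using c by simp
      then show ?thesis using conjunct2[OF q] False by (simp add: concat_fam_def)
    qed
  qed
  have "pdim (subspace_sum (lin a E) (subspace_act d m (lin b F))) \<le> d \<longleftrightarrow>
    (\<exists>f. f \<noteq> 0 \<and> degree f \<le> d \<and> (\<forall>c\<le>a + b + 1. pair d f (?G c) = 0))"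
    unfolding pdim_eq sum_act_eq_lin by (rule dim_lin_le_iff_pair[OF dG])
  also have "\<dots> \<longleftrightarrow> m \<in> sols d (ann d (Suc a) E) (ann d (Suc b) F)"
  proof
    assume "\<exists>f. f \<noteq> 0 \<and> degree f \<le> d \<and> (\<forall>c\<le>a + b + 1. pair d f (?G c) = 0)"
    then obtain f where f0: "f \<noteq> 0" "degree f \<le> d" "\<forall>c\<le>a + b + 1. pair d f (?G c) = 0" by (elim exE conjE)
    note f = f0(1,2) conjunct1[OF f0(3)[unfolded spl]] conjunct2[OF f0(3)[unfolded spl]]
    define g where "g = form_act d (madj m) f"
    have "g \<noteq> 0" unfolding g_def using form_act_eq_0_iff[of "madj m" f d] det f by simp
    moreover have "g \<in> ann d (Suc b) F"
      unfolding ann_def g_def using f(4) pair_form_act[OF det f(2) F] by (simp add: degree_form_act less_Suc_eq_le)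
    moreover have "form_act d m g = smult (mdet m ^ d) f"
      unfolding g_def form_act_mmul[OF det f(2)] mmul_madj form_act_mscale form_act_id[OF f(2)] ..
    then have "form_act d m g \<in> ann d (Suc a) E"
      unfolding ann_def using f(2,3) degree_smult_le[of "mdet m ^ d" f] by (simp add: pair_smult_left)
    ultimately show "m \<in> sols d (ann d (Suc a) E) (ann d (Suc b) F)" unfolding sols_def using det by blast
  next
    assume "m \<in> sols d (ann d (Suc a) E) (ann d (Suc b) F)"
    then obtain g where g: "g \<in> ann d (Suc b) F" "g \<noteq> 0" "form_act d m g \<in> ann d (Suc a) E" unfolding sols_def by blast
    have dg: "degree g \<le> d" using g(1) by (simp add: ann_def)
    define f where "f = form_act d m g"
    have f0: "f \<noteq> 0" unfolding f_def using form_act_eq_0_iff[OF det dg] g(2) by simp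
    have df: "degree f \<le> d" unfolding f_def by (rule degree_form_act)
    have "pair d f (form_act d m (F j)) = 0" if "j < Suc b" for j
    proof -
      have "pair d f (form_act d m (F j)) = pair d (form_act d (madj m) f) (F j)"
        using that by (intro pair_form_act[OF det df F]) simp
      also have "\<dots> = mdet m ^ d * pair d g (F j)"
        unfolding f_def form_act_madj[OF det dg] by (rule pair_smult_left)
      finally show ?thesis using g(1) that by (simp add: ann_def)
    qed
    moreover have "\<forall>i<Suc a. pair d f (E i) = 0" using g(3) unfolding f_def ann_def by blast
    ultimately have "\<forall>c\<le>a + b + 1. pair d f (?G c) = 0" unfolding spl by simp
    then show "\<exists>f. f \<noteq> 0 \<and> degree f \<le> d \<and> (\<forall>c\<le>a + b + 1. pair d f (?G c) = 0)"
      using f0 df by (intro exI[of _ f] conjI)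
  qed
  finally show ?thesis .
qed

section \<open>The generic count\<close>

text \<open>A lower bound for the number of classes, stated through finitely many representatives
  with polynomial inequations, hence accessible to quantifier elimination.\<close>

definition classes_ge :: "nat \<Rightarrow> mat2 set \<Rightarrow> bool" where
  "classes_ge N T \<longleftrightarrow> (\<exists>ms. (\<forall>k<N. ms k \<in> T) \<and> (\<forall>k<N. \<forall>l<N. k \<noteq> l \<longrightarrow> \<not> mprop (ms k) (ms l)))"

lemma classes_ge_iff:
  assumes T: "\<And>m. m \<in> T \<Longrightarrow> mdet m \<noteq> 0"
  shows "classes_ge N T \<longleftrightarrow> (\<exists>C. C \<subseteq> pgl_class ` T \<and> finite C \<and> card C = N)"
proof
  assume "classes_ge N T"
  then obtain ms where ms: "\<And>k. k < N \<Longrightarrow> ms k \<in> T" "\<And>k l. k < N \<Longrightarrow> l < N \<Longrightarrow> k \<noteq> l \<Longrightarrow> \<not> mprop (ms k) (ms l)"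
    unfolding classes_ge_def by blast
  have "inj_on (\<lambda>k. pgl_class (ms k)) {..<N}"
  proof (rule inj_onI, rule ccontr)
    fix k l assume "k \<in> {..<N}" "l \<in> {..<N}" "pgl_class (ms k) = pgl_class (ms l)" "k \<noteq> l"
    then show False using ms(2)[of k l] mprop_iff[OF T T, OF ms(1) ms(1), of k l] by simp
  qed
  then have "card ((\<lambda>k. pgl_class (ms k)) ` {..<N}) = N" by (simp add: card_image)
  then show "\<exists>C. C \<subseteq> pgl_class ` T \<and> finite C \<and> card C = N"
    using ms(1) by (intro exI[of _ "(\<lambda>k. pgl_class (ms k)) ` {..<N}"]) auto
next
  assume "\<exists>C. C \<subseteq> pgl_class ` T \<and> finite C \<and> card C = N"
  then obtain C where C: "C \<subseteq> pgl_class ` T" "finite C" "card C = N" by blast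
  obtain b where b: "bij_betw b {0..<N} C" using ex_bij_betw_nat_finite[OF C(2)] C(3) by blast
  have "\<forall>k\<in>{0..<N}. \<exists>m. m \<in> T \<and> pgl_class m = b k"
  proof
    fix k assume "k \<in> {0..<N}"
    then have "b k \<in> C" using bij_betw_imp_surj_on[OF b] by blast
    then have "b k \<in> pgl_class ` T" using C(1) by blast
    then obtain m where "b k = pgl_class m" "m \<in> T" by (rule imageE)
    then show "\<exists>m. m \<in> T \<and> pgl_class m = b k" by (intro exI[of _ m]) simp
  qed
  from bchoice[OF this] obtain ms where ms: "\<forall>k\<in>{0..<N}. ms k \<in> T \<and> pgl_class (ms k) = b k" by blast
  have "\<not> mprop (ms k) (ms l)" if kl: "k < N" "l < N" "k \<noteq> l" for k l
  proof -
    have "b k \<noteq> b l" using bij_betw_imp_inj_on[OF b] kl unfolding inj_on_def by auto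
    moreover have "ms k \<in> T" "pgl_class (ms k) = b k" "ms l \<in> T" "pgl_class (ms l) = b l" using ms kl by auto
    ultimately show ?thesis using mprop_iff[OF T T, of "ms k" "ms l"] by simp
  qed
  then show "classes_ge N T" unfolding classes_ge_def using ms by (intro exI[of _ ms]) auto
qed

text \<open>Having at least \<open>N\<close> but not \<open>N + 1\<close> classes also encodes
  finiteness, so the exact count is a Boolean combination of constructible conditions.\<close>

lemma card_classes_iff:
  assumes T: "\<And>m. m \<in> T \<Longrightarrow> mdet m \<noteq> 0"
  shows "finite (pgl_class ` T) \<and> card (pgl_class ` T) = N \<longleftrightarrow> classes_ge N T \<and> \<not> classes_ge (Suc N) T"
proof -
  have iff: "classes_ge N T \<longleftrightarrow> (\<exists>C. C \<subseteq> pgl_class ` T \<and> finite C \<and> card C = N)" for N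
    by (rule classes_ge_iff) (rule T)
  show ?thesis
  proof
    assume f: "finite (pgl_class ` T) \<and> card (pgl_class ` T) = N"
    have "classes_ge N T" unfolding iff
      by (rule exI[of _ "pgl_class ` T"]) (use f in simp)
    moreover have "\<not> classes_ge (Suc N) T"
    proof
      assume "classes_ge (Suc N) T"
      then obtain C where C: "C \<subseteq> pgl_class ` T" "card C = Suc N" unfolding iff by (elim exE conjE)
      have "card C \<le> card (pgl_class ` T)" by (rule card_mono) (use f C in simp_all)
      then show False using f C by simp
    qed
    ultimately show "classes_ge N T \<and> \<not> classes_ge (Suc N) T" ..
  next
    assume g: "classes_ge N T \<and> \<not> classes_ge (Suc N) T"
    have fin: "finite (pgl_class ` T)"
    proof (rule ccontr)
      assume "infinite (pgl_class ` T)"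
      from infinite_arbitrarily_large[OF this, of "Suc N"] obtain C where
        C: "finite C \<and> card C = Suc N \<and> C \<subseteq> pgl_class ` T" by (elim exE)
      then have "classes_ge (Suc N) T" unfolding iff by (intro exI[of _ C]) simp
      then show False using g by simp
    qed
    obtain C where C: "C \<subseteq> pgl_class ` T" "card C = N"
      using conjunct1[OF g] unfolding iff by (elim exE conjE)
    have "N \<le> card (pgl_class ` T)" using card_mono[OF fin C(1)] C(2) by simp
    moreover have "\<not> Suc N \<le> card (pgl_class ` T)"
    proof
      assume "Suc N \<le> card (pgl_class ` T)"
      then obtain C where C: "C \<subseteq> pgl_class ` T" "card C = Suc N" "finite C" by (rule obtain_subset_with_card_n)
      then have "classes_ge (Suc N) T" unfolding iff by (intro exI[of _ C]) simp
      then show False using g by simp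
    qed
    ultimately show "finite (pgl_class ` T) \<and> card (pgl_class ` T) = N" using fin by simp
  qed
qed

text \<open>Variables of the quantifier elimination: coordinates of the spanning matrices, entries of finitely many
  elements of GL(2), and auxiliary coefficients.\<close>

datatype var = X "bool \<times> nat \<times> nat" | Mv nat nat | Uv nat

definition vmat :: "(var \<Rightarrow> complex) \<Rightarrow> nat \<Rightarrow> mat2" where
  "vmat z k = (z (Mv k 0), z (Mv k 1), z (Mv k 2), z (Mv k 3))"

lemma polyfunp_vpoly: "(\<And>i. i \<le> d \<Longrightarrow> polyfun (\<lambda>x. v i x)) \<Longrightarrow> polyfunp (\<lambda>x. vpoly d (\<lambda>i. v i x))"
  unfolding vpoly_def by (intro polyfunp_sum polyfunp_smult polyfunp_const) auto

text \<open>The weights of a linear relation are the block of variables \<open>Uv c\<close> to be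
  eliminated; \<open>ind\<close> records that \<open>G\<close> does not depend on them.\<close>

lemma constr_not_indep:
  assumes pG: "\<And>c. c \<le> N \<Longrightarrow> polyfunp (G c)" and dG: "\<And>c z. c \<le> N \<Longrightarrow> degree (G c z) \<le> D"
    and ind: "\<And>c z y. G c (\<lambda>i. if i \<in> Uv ` {..N} then y i else z i) = G c z"
  shows "constr (\<lambda>z. \<not> indep N (\<lambda>c. G c z))"
proof -
  let ?S = "\<lambda>z. \<Sum>c\<le>N. smult (z (Uv c)) (G c z)"
  have "polyfunp ?S" by (intro polyfunp_sum polyfunp_smult polyfun.var pG) simp
  moreover have "degree (?S z) \<le> D" for z
    by (intro degree_sum_le order_trans[OF degree_smult_le dG]) simp_all
  ultimately have "constr (\<lambda>z. ?S z = 0)" by (rule constr_eq_zero_poly)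
  moreover have "constr (\<lambda>z. \<exists>c\<in>{..N}. \<not> z (Uv c) = 0)"
    by (intro constr_bex constr.neg constr.zero polyfun.var finite_atMost)
  ultimately have "constr (\<lambda>z. (\<exists>c\<in>{..N}. \<not> z (Uv c) = 0) \<and> ?S z = 0)" by (intro constr.conj)
  from constr_ex_block[OF _ this, of "Uv ` {..N}"]
  have "constr (\<lambda>z. \<exists>y. (\<exists>c\<in>{..N}. \<not> y (Uv c) = 0) \<and> (\<Sum>c\<le>N. smult (y (Uv c)) (G c z)) = 0)"
    unfolding ind by simp
  moreover have "(\<exists>y. (\<exists>c\<in>{..N}. \<not> y (Uv c) = 0) \<and> (\<Sum>c\<le>N. smult (y (Uv c)) (G c z)) = 0) \<longleftrightarrow> \<not> indep N (\<lambda>c. G c z)"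
    (is "?l \<longleftrightarrow> ?r") for z
  proof
    assume ?l
    then obtain y c where y: "c \<le> N" "y (Uv c) \<noteq> 0" "(\<Sum>c\<le>N. smult (y (Uv c)) (G c z)) = 0" by auto
    show ?r
    proof
      assume "indep N (\<lambda>c. G c z)"
      from this[unfolded indep_def, THEN spec, of "\<lambda>c. y (Uv c)"] show False using y by simp
    qed
  next
    assume ?r
    then obtain u c where u: "(\<Sum>c\<le>N. smult (u c) (G c z)) = 0" "c \<le> N" "u c \<noteq> 0" unfolding indep_def by blast
    define y where "y i = (case i of Uv c \<Rightarrow> u c | _ \<Rightarrow> 0)" for i
    have yu: "y (Uv c) = u c" for c by (simp add: y_def)
    show ?l by (rule exI[of _ y]) (use u in \<open>auto simp: yu\<close>)
  qed
  ultimately show ?thesis by simp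
qed

text \<open>Here the eliminated variables \<open>Uv c\<close> are the coefficients of the
  annihilating form.\<close>

lemma constr_annihilated:
  fixes G :: "nat \<Rightarrow> (var \<Rightarrow> complex) \<Rightarrow> complex poly"
  assumes pG: "\<And>c. c \<le> N \<Longrightarrow> polyfunp (G c)"
    and ind: "\<And>c z y. G c (\<lambda>i. if i \<in> Uv ` {..d} then y i else z i) = G c z"
  shows "constr (\<lambda>z. \<exists>f. f \<noteq> 0 \<and> degree f \<le> d \<and> (\<forall>c\<le>N. pair d f (G c z) = 0))"
proof -
  have pv: "polyfunp (\<lambda>z. vpoly d (\<lambda>c. z (Uv c)))" by (intro polyfunp_vpoly polyfun.var)
  have "constr (\<lambda>z. \<exists>c\<in>{..d}. \<not> z (Uv c) = 0)"
    by (intro constr_bex constr.neg constr.zero polyfun.var finite_atMost)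
  moreover have "constr (\<lambda>z. \<forall>c\<in>{..N}. pair d (vpoly d (\<lambda>c. z (Uv c))) (G c z) = 0)"
    by (intro constr_ball constr.zero polyfun_pair pv pG finite_atMost) simp_all
  ultimately have "constr (\<lambda>z. (\<exists>c\<in>{..d}. \<not> z (Uv c) = 0) \<and> (\<forall>c\<in>{..N}. pair d (vpoly d (\<lambda>c. z (Uv c))) (G c z) = 0))"
    by (rule constr.conj)
  from constr_ex_block[OF _ this, of "Uv ` {..d}"]
  have "constr (\<lambda>z. \<exists>y. (\<exists>c\<in>{..d}. \<not> y (Uv c) = 0) \<and>
    (\<forall>c\<in>{..N}. pair d (vpoly d (\<lambda>c. if c \<le> d then y (Uv c) else z (Uv c))) (G c z) = 0))"
    unfolding ind by (simp add: image_iff)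
  moreover have "vpoly d (\<lambda>c. if c \<le> d then y (Uv c) else z (Uv c)) = vpoly d (\<lambda>c. y (Uv c))" for y z :: "var \<Rightarrow> complex"
    by (rule poly_eqI) (simp add: coeff_vpoly)
  ultimately have "constr (\<lambda>z. \<exists>y. (\<exists>c\<in>{..d}. \<not> y (Uv c) = 0) \<and>
    (\<forall>c\<in>{..N}. pair d (vpoly d (\<lambda>c. y (Uv c))) (G c z) = 0))" by simp
  moreover have "(\<exists>y. (\<exists>c\<in>{..d}. \<not> y (Uv c) = 0) \<and> (\<forall>c\<in>{..N}. pair d (vpoly d (\<lambda>c. y (Uv c))) (G c z) = 0)) \<longleftrightarrow>
    (\<exists>f. f \<noteq> 0 \<and> degree f \<le> d \<and> (\<forall>c\<le>N. pair d f (G c z) = 0))" (is "?l \<longleftrightarrow> ?r") for z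
  proof
    assume ?l
    then obtain y where y: "\<exists>c\<in>{..d}. \<not> y (Uv c) = 0" "\<forall>c\<in>{..N}. pair d (vpoly d (\<lambda>c. y (Uv c))) (G c z) = 0" by blast
    then show ?r by (intro exI[of _ "vpoly d (\<lambda>c. y (Uv c))"] conjI degree_vpoly) (auto simp: vpoly_eq_0)
  next
    assume ?r
    then obtain f where f: "f \<noteq> 0" "degree f \<le> d" "\<forall>c\<le>N. pair d f (G c z) = 0" by blast
    define y where "y i = (case i of Uv c \<Rightarrow> coeff f c | _ \<Rightarrow> 0)" for i
    have v: "vpoly d (\<lambda>c. y (Uv c)) = f" using vpoly_coeff[OF f(2)] by (simp add: y_def)
    have "\<exists>c\<in>{..d}. \<not> y (Uv c) = 0" using f(1) vpoly_eq_0[of d "\<lambda>c. y (Uv c)"] unfolding v by auto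
    then show ?l using f(3) by (intro exI[of _ y]) (auto simp: v)
  qed
  ultimately show ?thesis by simp
qed

definition rankdef :: "nat \<Rightarrow> nat \<Rightarrow> nat \<Rightarrow> nat \<Rightarrow> (bool \<times> nat \<times> nat \<Rightarrow> complex) \<Rightarrow> mat2 \<Rightarrow> bool" where
  "rankdef d a b c x m \<longleftrightarrow> pdim (subspace_sum (row_span d a (\<lambda>i j. x (False, i, j)))
    (subspace_act d m (row_span d b (\<lambda>i j. x (True, i, j))))) \<le> c + 1"

definition dsols :: "nat \<Rightarrow> nat \<Rightarrow> nat \<Rightarrow> nat \<Rightarrow> (bool \<times> nat \<times> nat \<Rightarrow> complex) \<Rightarrow> mat2 set" where
  "dsols d a b c x = {m. mdet m \<noteq> 0 \<and> rankdef d a b c x m}"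

text \<open>For \<open>c = a + b\<close> the rank bound means dependence of the
  \<open>a + b + 2\<close> generators; for \<open>Suc c = d\<close> it means that the sum is proper,
  which is witnessed by an annihilating form.\<close>

lemma constr_rankdef:
  assumes c: "c = a + b \<or> Suc c = d"
  shows "constr (\<lambda>z. rankdef d a b c (\<lambda>i. z (X i)) (vmat z k))"
proof -
  define G where "G l z = concat_fam a (rowp d (\<lambda>i j. z (X (False, i, j))))
    (\<lambda>i. form_act d (vmat z k) (rowp d (\<lambda>i j. z (X (True, i, j))) i)) l" for l z
  have pr: "polyfunp (\<lambda>z. rowp d (\<lambda>i j. z (X (e, i, j))) i)" for e i
    unfolding rowp_def by (intro polyfunp_vpoly polyfun.var)
  have pG: "polyfunp (G l)" for l
  proof (cases "l \<le> a")
    case True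
    then have "G l = (\<lambda>z. rowp d (\<lambda>i j. z (X (False, i, j))) l)" by (auto simp: G_def concat_fam_def)
    then show ?thesis using pr by simp
  next
    case False
    then have e: "G l = (\<lambda>z. form_act d (vmat z k) (rowp d (\<lambda>i j. z (X (True, i, j))) (l - (a + 1))))"
      by (auto simp: G_def concat_fam_def)
    show ?thesis unfolding e vmat_def
      by (intro polyfunp_form_act polyfun.var polyfunp_coeff pr)
  qed
  have dG: "degree (G l z) \<le> d" for l z
    unfolding G_def concat_fam_def using degree_rowp degree_form_act by simp
  have inv: "G l (\<lambda>i. if i \<in> Uv ` J then y i else z i) = G l z" for l y z J
  proof -
    have "X v \<notin> Uv ` J" "Mv i j \<notin> Uv ` J" for v i j by auto
    then show ?thesis by (simp add: G_def vmat_def)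
  qed
  have eq: "rankdef d a b c (\<lambda>i. z (X i)) (vmat z k) \<longleftrightarrow> pvs.dim (lin (a + b + 1) (\<lambda>l. G l z)) \<le> c + 1" for z
    unfolding rankdef_def pdim_eq row_span_eq_lin sum_act_eq_lin G_def ..
  from c show ?thesis
  proof
    assume "c = a + b"
    then have "rankdef d a b c (\<lambda>i. z (X i)) (vmat z k) \<longleftrightarrow> \<not> indep (a + b + 1) (\<lambda>l. G l z)" for z
      unfolding eq using dim_lin_le_iff[of "a + b + 1"] by simp
    then show ?thesis using constr_not_indep[OF pG dG inv] by simp
  next
    assume "Suc c = d"
    then have "rankdef d a b c (\<lambda>i. z (X i)) (vmat z k) \<longleftrightarrow>
      (\<exists>f. f \<noteq> 0 \<and> degree f \<le> d \<and> (\<forall>l\<le>a + b + 1. pair d f (G l z) = 0))" for z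
      unfolding eq using dim_lin_le_iff_pair[OF dG, of "a + b + 1"] by simp
    then show ?thesis using constr_annihilated[OF pG inv] by simp
  qed
qed

lemma polyfun_vmat_det: "polyfun (\<lambda>z. mdet (vmat z k))"
  unfolding vmat_def mdet_simp by (intro polyfun_diff polyfun.mult polyfun.var)

lemma constr_mprop: "constr (\<lambda>z. mprop (vmat z k) (vmat z l))"
  unfolding vmat_def mprop_def prod.case
  by (intro constr.conj constr_eq polyfun.mult polyfun.var)

lemma constr_classes_ge:
  assumes c: "c = a + b \<or> Suc c = d"
  shows "constr (\<lambda>z. classes_ge N (dsols d a b c (\<lambda>i. z (X i))))"
proof -
  define J where "J = (\<lambda>(k, r). Mv k r) ` ({..<N} \<times> {..<4})"
  have fJ: "finite J" unfolding J_def by simp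
  have inJ: "Mv k r \<in> J" if "k < N" "r < 4" for k r unfolding J_def using that by force
  have XJ: "X v \<notin> J" for v unfolding J_def by auto
  let ?Q = "\<lambda>z. (\<forall>k\<in>{..<N}. (\<not> mdet (vmat z k) = 0) \<and> rankdef d a b c (\<lambda>i. z (X i)) (vmat z k)) \<and>
    (\<forall>k\<in>{..<N}. \<forall>l\<in>{..<N} - {k}. \<not> mprop (vmat z k) (vmat z l))"
  have "constr ?Q"
    by (intro constr.conj constr_ball constr.neg constr.zero polyfun_vmat_det constr_rankdef[OF c] constr_mprop) auto
  from constr_ex_block[OF fJ this]
  have "constr (\<lambda>z. \<exists>y. ?Q (\<lambda>i. if i \<in> J then y i else z i))" .
  moreover have "(\<exists>y. ?Q (\<lambda>i. if i \<in> J then y i else z i)) \<longleftrightarrow> classes_ge N (dsols d a b c (\<lambda>i. z (X i)))" (is "?l \<longleftrightarrow> ?r") for z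
  proof -
    have vm: "vmat (\<lambda>i. if i \<in> J then y i else z i) k = vmat y k" if "k < N" for y k
      unfolding vmat_def using inJ[OF that] by simp
    have "?l \<longleftrightarrow> (\<exists>y. (\<forall>k\<in>{..<N}. vmat y k \<in> dsols d a b c (\<lambda>i. z (X i))) \<and>
      (\<forall>k\<in>{..<N}. \<forall>l\<in>{..<N} - {k}. \<not> mprop (vmat y k) (vmat y l)))"
      by (simp add: vm XJ dsols_def)
    also have "\<dots> \<longleftrightarrow> ?r"
    proof
      assume "\<exists>y. (\<forall>k\<in>{..<N}. vmat y k \<in> dsols d a b c (\<lambda>i. z (X i))) \<and>
        (\<forall>k\<in>{..<N}. \<forall>l\<in>{..<N} - {k}. \<not> mprop (vmat y k) (vmat y l))"
      then obtain y where y: "\<forall>k\<in>{..<N}. vmat y k \<in> dsols d a b c (\<lambda>i. z (X i))"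
        "\<forall>k\<in>{..<N}. \<forall>l\<in>{..<N} - {k}. \<not> mprop (vmat y k) (vmat y l)" by (elim exE conjE)
      show ?r unfolding classes_ge_def
      proof (intro exI[of _ "vmat y"] conjI allI impI)
        show "vmat y k \<in> dsols d a b c (\<lambda>i. z (X i))" if "k < N" for k using y(1) that by simp
        show "\<not> mprop (vmat y k) (vmat y l)" if "k < N" "l < N" "k \<noteq> l" for k l using y(2) that by simp
      qed
    next
      assume ?r
      then obtain ms where ms: "\<forall>k<N. ms k \<in> dsols d a b c (\<lambda>i. z (X i))"
        "\<forall>k<N. \<forall>l<N. k \<noteq> l \<longrightarrow> \<not> mprop (ms k) (ms l)" unfolding classes_ge_def by (elim exE conjE)
      define y where "y i = (case i of Mv k r \<Rightarrow> (if r = 0 then fst (ms k) else if r = 1 then fst (snd (ms k))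
        else if r = 2 then fst (snd (snd (ms k))) else snd (snd (snd (ms k)))) | _ \<Rightarrow> 0)" for i
      have vy: "vmat y k = ms k" for k unfolding vmat_def y_def by simp
      show "\<exists>y. (\<forall>k\<in>{..<N}. vmat y k \<in> dsols d a b c (\<lambda>i. z (X i))) \<and>
        (\<forall>k\<in>{..<N}. \<forall>l\<in>{..<N} - {k}. \<not> mprop (vmat y k) (vmat y l))"
      proof (intro exI[of _ y] conjI ballI)
        show "vmat y k \<in> dsols d a b c (\<lambda>i. z (X i))" if "k \<in> {..<N}" for k using ms(1) that by (simp add: vy)
        show "\<not> mprop (vmat y k) (vmat y l)" if "k \<in> {..<N}" "l \<in> {..<N} - {k}" for k l using ms(2) that by (simp add: vy)
      qed
    qed
    finally show ?thesis .
  qed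
  ultimately show ?thesis by simp
qed

text \<open>The count is a constructible condition, so it holds generically as soon as it holds near one point on every
  complex line through it.\<close>

lemma generic_count:
  fixes x0 :: "bool \<times> nat \<times> nat \<Rightarrow> complex"
  assumes c: "c = a + b \<or> Suc c = d"
    and near: "\<And>x. \<exists>\<delta>>0. \<forall>t. cmod t < \<delta> \<longrightarrow> finite (pgl_class ` dsols d a b c (\<lambda>i. x0 i + t * x i)) \<and>
      card (pgl_class ` dsols d a b c (\<lambda>i. x0 i + t * x i)) = N"
  shows "\<exists>F. polyfun F \<and> (\<exists>x. F x \<noteq> 0) \<and> (\<forall>x. F x \<noteq> 0 \<longrightarrow>
    finite (pgl_class ` dsols d a b c x) \<and> card (pgl_class ` dsols d a b c x) = N)"
proof -
  define good where "good x \<longleftrightarrow> finite (pgl_class ` dsols d a b c x) \<and> card (pgl_class ` dsols d a b c x) = N" for x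
  have gd: "good x \<longleftrightarrow> classes_ge N (dsols d a b c x) \<and> \<not> classes_ge (Suc N) (dsols d a b c x)" for x
    unfolding good_def by (rule card_classes_iff) (simp add: dsols_def)
  have "constr (\<lambda>z :: var \<Rightarrow> complex. good (\<lambda>i. z (X i)))"
    unfolding gd by (intro constr.conj constr.neg constr_classes_ge c)
  from constr_generic_dichotomy[OF this] obtain F z where F: "polyfun F" "F z \<noteq> 0"
    "(\<forall>z. F z \<noteq> 0 \<longrightarrow> good (\<lambda>i. z (X i))) \<or> (\<forall>z. F z \<noteq> 0 \<longrightarrow> \<not> good (\<lambda>i. z (X i)))" by blast
  \<comment> \<open>The base point agrees with \<open>z\<close> in the auxiliary variables, so only
    the coordinates of the two spaces move along the line from \<open>z0\<close> to
    \<open>z\<close>.\<close>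
  define z0 where "z0 i = (case i of X v \<Rightarrow> x0 v | _ \<Rightarrow> z i)" for i
  obtain P where P: "\<And>t. F (\<lambda>i. z0 i + t * (z i - z0 i)) = poly P t"
    using polyfun_on_line[OF F(1), of z0 "\<lambda>i. z i - z0 i"] by blast
  have "poly P 1 \<noteq> 0" using P[of 1] F(2) by simp
  then have "P \<noteq> 0" by auto
  then have fr: "finite {t. poly P t = 0}" by (rule poly_roots_finite)
  obtain \<delta> where \<delta>: "\<delta> > 0" "\<And>t. cmod t < \<delta> \<Longrightarrow> good (\<lambda>i. x0 i + t * (z (X i) - x0 i))"
    using near[of "\<lambda>i. z (X i) - x0 i"] unfolding good_def by blast
  have "infinite (ball (0::complex) \<delta>)" using uncountable_ball[OF \<delta>(1)] countable_finite by blast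
  then have "\<not> ball 0 \<delta> \<subseteq> {t. poly P t = 0}" using fr finite_subset by blast
  then obtain t where "t \<in> ball 0 \<delta>" "poly P t \<noteq> 0" by blast
  then have t: "cmod t < \<delta>" "poly P t \<noteq> 0" by simp_all
  have gt: "good (\<lambda>i. z0 (X i) + t * (z (X i) - z0 (X i)))" using \<delta>(2)[OF t(1)] by (simp add: z0_def)
  have nz: "F (\<lambda>i. z0 i + t * (z i - z0 i)) \<noteq> 0" unfolding P by (rule t(2))
  have Fg: "good (\<lambda>i. z (X i))" if "F z \<noteq> 0" for z
    using F(3)
  proof (elim disjE)
    assume "\<forall>z. F z \<noteq> 0 \<longrightarrow> \<not> good (\<lambda>i. z (X i))"
    from this[rule_format, OF nz] show ?thesis using gt by simp
  qed (use that in simp)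
  \<comment> \<open>Freezing the auxiliary variables at their values in \<open>z\<close> turns
    \<open>F\<close> into a nonzero polynomial in the coordinates of the spaces alone.\<close>
  define h where "h x i = (case i of X v \<Rightarrow> x v | _ \<Rightarrow> z i)" for x :: "bool \<times> nat \<times> nat \<Rightarrow> complex" and i
  have hX: "(\<lambda>i. h x (X i)) = x" for x by (auto simp: h_def)
  have "polyfun (\<lambda>x. h x i)" for i
    unfolding h_def by (cases i) (auto intro: polyfun.var polyfun.const)
  then have "polyfun (\<lambda>x. F (h x))" using polyfun_subst[OF F(1), of "\<lambda>i x. h x i"] by simp
  moreover have "h (\<lambda>i. z (X i)) = z" by (rule ext) (simp add: h_def split: var.split)
  then have "F (h (\<lambda>i. z (X i))) \<noteq> 0" using F(2) by simp
  moreover have "good x" if "F (h x) \<noteq> 0" for x using Fg[OF that] unfolding hX .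
  ultimately show ?thesis unfolding good_def by (intro exI[of _ "\<lambda>x. F (h x)"] conjI allI impI) auto
qed

lemma rowp_line: "rowp d (\<lambda>i j. A i j + t * C i j) i = rowp d A i + smult t (rowp d C i)"
  unfolding rowp_def by (rule poly_eqI) (simp add: coeff_vpoly)

lemma rowp_coeff: "degree (E i) \<le> d \<Longrightarrow> rowp d (\<lambda>i j. coeff (E i) j) i = E i"
  unfolding rowp_def by (rule vpoly_coeff)

lemma lin_cong:
  assumes "\<And>i. i \<le> n \<Longrightarrow> E i = E' i"
  shows "lin n E = lin n E'"
proof -
  have "(\<Sum>i\<le>n. smult (u i) (E i)) = (\<Sum>i\<le>n. smult (u i) (E' i))" for u
    using assms by (intro sum.cong) auto
  then show ?thesis unfolding lin_def by simp
qed

text \<open>The base point consists of the multiples of \<open>hpoly (b + 3)\<close> and of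
  \<open>kpoly (a + 3)\<close>, spanned by monomial multiples.\<close>

lemma generic_count_intersecting:
  "\<exists>F. polyfun F \<and> (\<exists>x. F x \<noteq> 0) \<and> (\<forall>x. F x \<noteq> 0 \<longrightarrow>
    finite (pgl_class ` dsols (a + b + 3) a b (a + b) x) \<and>
    card (pgl_class ` dsols (a + b + 3) a b (a + b) x) = 6 * ((a + 3) choose 3) * ((b + 3) choose 3))"
proof -
  let ?d = "a + b + 3"
  define E where "E i = monom 1 i * hpoly (b + 3)" for i
  define K where "K i = monom 1 i * kpoly (a + 3)" for i
  define x0 where "x0 = (\<lambda>(e, i, j). if e then coeff (K i) j else coeff (E i) j)"
  have dE: "degree (E i) \<le> ?d" if "i \<le> a" for i
    unfolding E_def using degree_mult_le[of "monom 1 i" "hpoly (b + 3)"] that by (simp add: degree_monom_eq)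
  have dK: "degree (K i) \<le> ?d" if "i \<le> b" for i
    unfolding K_def using degree_mult_le[of "monom 1 i" "kpoly (a + 3)"] that by (simp add: degree_monom_eq)
  show ?thesis
  proof (rule generic_count[where ?x0.0 = x0])
    fix x :: "bool \<times> nat \<times> nat \<Rightarrow> complex"
    define C where "C = rowp ?d (\<lambda>i j. x (False, i, j))"
    define D where "D = rowp ?d (\<lambda>i j. x (True, i, j))"
    have dC: "degree (C i) \<le> ?d" and dD: "degree (D i) \<le> ?d" for i
      unfolding C_def D_def by (rule degree_rowp)+
    obtain \<delta>1 where \<delta>1: "\<delta>1 > 0" "\<And>t. cmod t < \<delta>1 \<Longrightarrow> indep a (\<lambda>i. E i + smult t (C i))"
      using indep_eventually[OF indep_monom_mult[OF hpoly_nz]] unfolding E_def by blast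
    obtain \<delta>2 where \<delta>2: "\<delta>2 > 0" "\<And>t. cmod t < \<delta>2 \<Longrightarrow> indep b (\<lambda>i. K i + smult t (D i))"
      using indep_eventually[OF indep_monom_mult[OF kpoly_nz]] unfolding K_def by blast
    let ?S = "\<lambda>t. pgl_class ` sols ?d (lin a (\<lambda>i. E i + smult t (C i))) (lin b (\<lambda>i. K i + smult t (D i)))"
    obtain \<delta>3 where \<delta>3: "\<delta>3 > 0" "\<And>t. cmod t < \<delta>3 \<Longrightarrow> finite (?S t) \<and> card (?S t) = card (matchings b a)"
      using card_sols_lin[where C = C and D = D and p = a and q = b, OF dC dD] unfolding Let_def E_def K_def by blast
    show "\<exists>\<delta>>0. \<forall>t. cmod t < \<delta> \<longrightarrow> finite (pgl_class ` dsols ?d a b (a + b) (\<lambda>i. x0 i + t * x i)) \<and>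
      card (pgl_class ` dsols ?d a b (a + b) (\<lambda>i. x0 i + t * x i)) = 6 * ((a + 3) choose 3) * ((b + 3) choose 3)"
    proof (rule exI[of _ "min \<delta>1 (min \<delta>2 \<delta>3)"], intro conjI allI impI)
      fix t assume t: "cmod t < min \<delta>1 (min \<delta>2 \<delta>3)"
      have r1: "row_span ?d a (\<lambda>i j. x0 (False, i, j) + t * x (False, i, j)) = lin a (\<lambda>i. E i + smult t (C i))"
        unfolding row_span_eq_lin by (rule lin_cong) (simp add: rowp_line x0_def rowp_coeff dE C_def)
      have r2: "row_span ?d b (\<lambda>i j. x0 (True, i, j) + t * x (True, i, j)) = lin b (\<lambda>i. K i + smult t (D i))"
        unfolding row_span_eq_lin by (rule lin_cong) (simp add: rowp_line x0_def rowp_coeff dK D_def)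
      have "dsols ?d a b (a + b) (\<lambda>i. x0 i + t * x i) = sols ?d (lin a (\<lambda>i. E i + smult t (C i))) (lin b (\<lambda>i. K i + smult t (D i)))"
      proof (rule Set.set_eqI)
        fix m
        show "m \<in> dsols ?d a b (a + b) (\<lambda>i. x0 i + t * x i) \<longleftrightarrow>
          m \<in> sols ?d (lin a (\<lambda>i. E i + smult t (C i))) (lin b (\<lambda>i. K i + smult t (D i)))"
        proof (cases "mdet m = 0")
          case True
          then show ?thesis by (simp add: dsols_def sols_def)
        next
          case False
          from sols_lin_iff[OF \<delta>1(2) \<delta>2(2) False, of t t ?d] t
          show ?thesis using False unfolding dsols_def rankdef_def r1 r2 by simp
        qed
      qed
      then show "finite (pgl_class ` dsols ?d a b (a + b) (\<lambda>i. x0 i + t * x i))"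
        "card (pgl_class ` dsols ?d a b (a + b) (\<lambda>i. x0 i + t * x i)) = 6 * ((a + 3) choose 3) * ((b + 3) choose 3)"
        using \<delta>3(2)[of t] t by (simp_all add: card_matchings)
    qed (use \<delta>1 \<delta>2 \<delta>3 in auto)
  qed simp
qed

text \<open>The base point consists of spans of \<open>q + 3\<close> and \<open>p + 3\<close> powers
  of linear forms, whose annihilators are the multiples of \<open>hpoly (q + 3)\<close> and of
  \<open>kpoly (p + 3)\<close>.\<close>

lemma generic_count_spanning:
  "\<exists>F. polyfun F \<and> (\<exists>x. F x \<noteq> 0) \<and> (\<forall>x. F x \<noteq> 0 \<longrightarrow>
    finite (pgl_class ` dsols (p + q + 3) (q + 2) (p + 2) (p + q + 2) x) \<and>
    card (pgl_class ` dsols (p + q + 3) (q + 2) (p + 2) (p + q + 2) x) = 6 * ((q + 3) choose 3) * ((p + 3) choose 3))"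
proof -
  let ?d = "p + q + 3"
  define E where "E i = [:- zp i, 1:] ^ ?d" for i
  define K where "K i = [:- wp i, 1:] ^ ?d" for i
  define x0 where "x0 = (\<lambda>(e, i, j). if e then coeff (K i) j else coeff (E i) j)"
  have dE: "degree (E i) \<le> ?d" and dK: "degree (K i) \<le> ?d" for i
    unfolding E_def K_def by (simp_all add: degree_power_eq)
  show ?thesis
  proof (rule generic_count[where ?x0.0 = x0])
    fix x :: "bool \<times> nat \<times> nat \<Rightarrow> complex"
    define C where "C = rowp ?d (\<lambda>i j. x (False, i, j))"
    define D where "D = rowp ?d (\<lambda>i j. x (True, i, j))"
    let ?S = "\<lambda>t. pgl_class ` sols ?d (ann ?d (q + 3) (\<lambda>i. E i + smult t (C i))) (ann ?d (p + 3) (\<lambda>i. K i + smult t (D i)))"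
    obtain \<delta> where \<delta>: "\<delta> > 0" "\<And>t. cmod t < \<delta> \<Longrightarrow> finite (?S t) \<and> card (?S t) = card (matchings q p)"
      using card_sols_ann[of p q C D] unfolding Let_def E_def K_def by blast
    have r1: "row_span ?d (q + 2) (\<lambda>i j. x0 (False, i, j) + t * x (False, i, j)) = lin (q + 2) (\<lambda>i. E i + smult t (C i))" for t
      unfolding row_span_eq_lin by (rule lin_cong) (simp add: rowp_line x0_def rowp_coeff dE C_def)
    have r2: "row_span ?d (p + 2) (\<lambda>i j. x0 (True, i, j) + t * x (True, i, j)) = lin (p + 2) (\<lambda>i. K i + smult t (D i))" for t
      unfolding row_span_eq_lin by (rule lin_cong) (simp add: rowp_line x0_def rowp_coeff dK D_def)
    have dEt: "degree (E i + smult t (C i)) \<le> ?d" and dKt: "degree (K i + smult t (D i)) \<le> ?d" for i t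
      using dE[of i] dK[of i] degree_smult_le[of t "C i"] degree_smult_le[of t "D i"]
        degree_rowp[of ?d _ i] unfolding C_def D_def by (intro degree_add_le; (simp | blast intro: order_trans))+
    have "dsols ?d (q + 2) (p + 2) (p + q + 2) (\<lambda>i. x0 i + t * x i) =
      sols ?d (ann ?d (q + 3) (\<lambda>i. E i + smult t (C i))) (ann ?d (p + 3) (\<lambda>i. K i + smult t (D i)))" for t
    proof (rule Set.set_eqI)
      fix m
      show "m \<in> dsols ?d (q + 2) (p + 2) (p + q + 2) (\<lambda>i. x0 i + t * x i) \<longleftrightarrow>
        m \<in> sols ?d (ann ?d (q + 3) (\<lambda>i. E i + smult t (C i))) (ann ?d (p + 3) (\<lambda>i. K i + smult t (D i)))"
      proof (cases "mdet m = 0")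
        case True
        then show ?thesis by (simp add: dsols_def sols_def)
      next
        case False
        have s: "Suc (q + 2) = q + 3" "Suc (p + 2) = p + 3" "p + q + 2 + 1 = ?d" by simp_all
        from sols_ann_iff[where a = "q + 2" and b = "p + 2" and E = "\<lambda>i. E i + smult t (C i)"
          and F = "\<lambda>i. K i + smult t (D i)", OF False dEt dKt, unfolded s]
        show ?thesis using False unfolding dsols_def rankdef_def r1 r2 s by simp
      qed
    qed
    then show "\<exists>\<delta>>0. \<forall>t. cmod t < \<delta> \<longrightarrow> finite (pgl_class ` dsols ?d (q + 2) (p + 2) (p + q + 2) (\<lambda>i. x0 i + t * x i)) \<and>
      card (pgl_class ` dsols ?d (q + 2) (p + 2) (p + q + 2) (\<lambda>i. x0 i + t * x i)) = 6 * ((q + 3) choose 3) * ((p + 3) choose 3)"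
      using \<delta> by (auto simp: card_matchings)
  qed simp
qed

section \<open>Small dimensions and the final case distinction\<close>

text \<open>If the sum were proper, both spaces would have a nonzero annihilator, so
  \<open>a + 1 \<le> d\<close> and \<open>b + 1 \<le> d\<close>; with \<open>a + b = d + 1\<close>
  both \<open>a\<close> and \<open>b\<close> would then be at least 2.\<close>

lemma sum_full_of_small:
  assumes ab: "a + b = d + 1" "a \<le> 1 \<or> b \<le> 1" and det: "mdet m \<noteq> 0"
    and dA: "pdim (row_span d a A) = a + 1" and dB: "pdim (row_span d b B) = b + 1"
  shows "\<not> pdim (subspace_sum (row_span d a A) (subspace_act d m (row_span d b B))) \<le> d"
proof
  let ?E = "rowp d A" and ?F = "rowp d B"
  assume "pdim (subspace_sum (row_span d a A) (subspace_act d m (row_span d b B))) \<le> d"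
  then have "m \<in> sols d (ann d (Suc a) ?E) (ann d (Suc b) ?F)"
    using sols_ann_iff[where a = a and b = b and d = d and E = ?E and F = ?F, OF det degree_rowp degree_rowp]
    unfolding row_span_eq_lin by blast
  then obtain g where g: "g \<in> ann d (Suc b) ?F" "g \<noteq> 0" "form_act d m g \<in> ann d (Suc a) ?E" unfolding sols_def by blast
  have dg: "degree g \<le> d" using g(1) by (simp add: ann_def)
  have "form_act d m g \<noteq> 0" using form_act_eq_0_iff[OF det dg] g(2) by simp
  then have "\<exists>f. f \<noteq> 0 \<and> degree f \<le> d \<and> (\<forall>i\<le>a. pair d f (?E i) = 0)"
    using g(3) unfolding ann_def by (intro exI[of _ "form_act d m g"]) (auto simp: less_Suc_eq_le)
  then have "pvs.dim (lin a ?E) \<le> d" using dim_lin_le_iff_pair[of a ?E d] degree_rowp by blast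
  then have 1: "a + 1 \<le> d" using dA unfolding row_span_eq_lin pdim_eq by simp
  have "\<exists>f. f \<noteq> 0 \<and> degree f \<le> d \<and> (\<forall>i\<le>b. pair d f (?F i) = 0)"
    using g(1,2) unfolding ann_def by (intro exI[of _ g]) (auto simp: less_Suc_eq_le)
  then have "pvs.dim (lin b ?F) \<le> d" using dim_lin_le_iff_pair[of b ?F d] degree_rowp by blast
  then have "b + 1 \<le> d" using dB unfolding row_span_eq_lin pdim_eq by simp
  then show False using 1 ab by linarith
qed

lemma PGL2_solutions: "{\<sigma> \<in> PGL2. \<exists>m\<in>\<sigma>. P m} = pgl_class ` {m. mdet m \<noteq> 0 \<and> P m}"
proof (rule equalityI; rule subsetI)
  fix \<sigma> assume "\<sigma> \<in> {\<sigma> \<in> PGL2. \<exists>m\<in>\<sigma>. P m}"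
  then obtain m where "\<sigma> \<in> PGL2" "m \<in> \<sigma>" "P m" by blast
  then show "\<sigma> \<in> pgl_class ` {m. mdet m \<noteq> 0 \<and> P m}" using PGL2_memD by blast
next
  fix \<sigma> assume "\<sigma> \<in> pgl_class ` {m. mdet m \<noteq> 0 \<and> P m}"
  then obtain m where "mdet m \<noteq> 0" "P m" "\<sigma> = pgl_class m" by blast
  then show "\<sigma> \<in> {\<sigma> \<in> PGL2. \<exists>m\<in>\<sigma>. P m}" using pgl_class_self[of m] by (auto simp: PGL2_def)
qed

lemma dsols_classes: "{\<sigma> \<in> PGL2. \<exists>m\<in>\<sigma>. pdim (subspace_sum (row_span d a (\<lambda>i j. x (False, i, j)))
    (subspace_act d m (row_span d b (\<lambda>i j. x (True, i, j))))) \<le> c + 1} = pgl_class ` dsols d a b c x"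
  unfolding PGL2_solutions dsols_def rankdef_def ..

lemma general_pairI:
  assumes "polyfun F" "\<exists>x. F x \<noteq> 0"
    and "\<And>x. F x \<noteq> 0 \<Longrightarrow> pdim (row_span d n (\<lambda>i j. x (False, i, j))) = n + 1 \<Longrightarrow>
      pdim (row_span d m (\<lambda>i j. x (True, i, j))) = m + 1 \<Longrightarrow>
      P (row_span d n (\<lambda>i j. x (False, i, j))) (row_span d m (\<lambda>i j. x (True, i, j)))"
  shows "general_pair d n m P"
  unfolding general_pair_def Let_def using assms by (intro exI[of _ F]) simp

lemma six_choose_three: "6 * real ((p + 3) choose 3) = real (p + 3) * real (p + 2) * real (p + 1)"
proof (induction p)
  case (Suc p)
  have "(Suc p + 3) choose 3 = ((p + 3) choose 2) + ((p + 3) choose 3)"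
    by (simp add: numeral_3_eq_3 numeral_2_eq_2)
  moreover have "2 * ((p + 3) choose 2) = (p + 3) * (p + 2)" by (simp add: choose_two)
  then have "2 * real ((p + 3) choose 2) = real (p + 3) * real (p + 2)" by (metis of_nat_mult of_nat_numeral)
  ultimately show ?case using Suc by (simp add: algebra_simps)
qed simp

theorem theorem3p23:
  fixes a b c d :: nat
  assumes "c \<le> d"
    and "(int a + int b - int c + 1) * (int d - int c) = 3"
  shows "general_pair d a b (\<lambda>Va Vb.
           let S = {\<sigma> \<in> PGL2. \<exists>m \<in> \<sigma>.
                      pdim (subspace_sum Va (subspace_act d m Vb)) \<le> c + 1}
           in finite S \<and>
              (int a + int b + 1 - int c = 3 \<and> int d - int c = 1 \<longrightarrow>
                 real (card S) = (1 / 6) * real a * real b * (real a ^ 2 - 1) * (real b ^ 2 - 1)) \<and>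
              (int a + int b + 1 - int c = 1 \<and> int d - int c = 3 \<longrightarrow>
                 card S = 6 * ((a + 3) choose 3) * ((b + 3) choose 3)))"
proof -
  \<comment> \<open>Two integers with product 3, the second nonnegative and hence positive, leave
    only the pairs (3, 1) and (1, 3).\<close>
  define u v where "u = int a + int b - int c + 1" and "v = int d - int c"
  have uv: "u * v = 3" "v \<ge> 0" using assms by (auto simp: u_def v_def)
  then have "v > 0" by (cases "v = 0") auto
  moreover have "u > 0" using uv \<open>v > 0\<close> by (metis zero_less_mult_pos2 zero_less_numeral)
  moreover have "v \<le> 3" using uv(1) \<open>u > 0\<close> \<open>v > 0\<close> mult_right_mono[of 1 u v] by simp
  ultimately have "v = 1 \<or> v = 2 \<or> v = 3" by linarith
  then have "(u = 3 \<and> v = 1) \<or> (u = 1 \<and> v = 3)" 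
  proof (elim disjE)
    assume "v = 2"
    then have "2 * u = 3" using uv(1) by simp
    then show ?thesis by presburger
  qed (use uv(1) in simp_all)
  then show ?thesis
  proof
    assume "u = 1 \<and> v = 3"
    then have c: "c = a + b" "d = a + b + 3" unfolding u_def v_def by linarith+
    from generic_count_intersecting[of a b] obtain F where F: "polyfun F" "\<exists>x. F x \<noteq> 0"
      "\<And>x. F x \<noteq> 0 \<Longrightarrow> finite (pgl_class ` dsols d a b c x) \<and> card (pgl_class ` dsols d a b c x) = 6 * ((a + 3) choose 3) * ((b + 3) choose 3)"
      unfolding c by blast
    show ?thesis
      by (rule general_pairI[OF F(1,2)], unfold Let_def dsols_classes) (use F(3) c in simp)
  next
    assume "u = 3 \<and> v = 1"
    then have c: "a + b = d + 1" "d = c + 1" unfolding u_def v_def by linarith+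
    have "\<exists>F. polyfun F \<and> (\<exists>x. F x \<noteq> 0) \<and> (\<forall>x. F x \<noteq> 0 \<longrightarrow> pdim (row_span d a (\<lambda>i j. x (False, i, j))) = a + 1 \<longrightarrow>
      pdim (row_span d b (\<lambda>i j. x (True, i, j))) = b + 1 \<longrightarrow> finite (pgl_class ` dsols d a b c x) \<and>
      real (card (pgl_class ` dsols d a b c x)) = (1 / 6) * real a * real b * (real a ^ 2 - 1) * (real b ^ 2 - 1))"
    proof (cases "a \<le> 1 \<or> b \<le> 1")
      case True
      \<comment> \<open>Each of the values 0 and 1 of \<open>a\<close> or \<open>b\<close>
        annihilates a factor of the formula, in accordance with the empty solution set.\<close>
      then have z: "real a * real b * (real a ^ 2 - 1) * (real b ^ 2 - 1) = 0" by (auto simp: le_Suc_eq)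
      have "dsols d a b c x = {}" if "pdim (row_span d a (\<lambda>i j. x (False, i, j))) = a + 1"
        "pdim (row_span d b (\<lambda>i j. x (True, i, j))) = b + 1" for x
        using sum_full_of_small[OF c(1) True _ that] c(2) unfolding dsols_def rankdef_def by auto
      then show ?thesis using z by (intro exI[of _ "\<lambda>_. 1"]) (auto intro: polyfun.const)
    next
      case False
      \<comment> \<open>The shift by 2 makes \<open>a + 1 = q + 3\<close> and
        \<open>b + 1 = p + 3\<close> the numbers of spanning powers, so the binomials are those of
        \<open>a + 1\<close> and \<open>b + 1\<close> over 3.\<close>
      define q p where "q = a - 2" and "p = b - 2"
      have ab: "a = q + 2" "b = p + 2" using False by (auto simp: q_def p_def)
      have dc: "d = p + q + 3" "c = p + q + 2" using c ab by auto
      have "real (6 * ((q + 3) choose 3) * ((p + 3) choose 3)) =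
        (1 / 6) * (6 * real ((q + 3) choose 3)) * (6 * real ((p + 3) choose 3))" by simp
      also have "\<dots> = (1 / 6) * real a * real b * (real a ^ 2 - 1) * (real b ^ 2 - 1)"
        unfolding six_choose_three ab by (simp add: power2_eq_square algebra_simps)
      finally show ?thesis using generic_count_spanning[of p q] unfolding dc ab by (elim exE conjE) (intro exI conjI, assumption, auto)
    qed
    then obtain F where F: "polyfun F" "\<exists>x. F x \<noteq> 0" "\<And>x. F x \<noteq> 0 \<Longrightarrow> pdim (row_span d a (\<lambda>i j. x (False, i, j))) = a + 1 \<Longrightarrow>
      pdim (row_span d b (\<lambda>i j. x (True, i, j))) = b + 1 \<Longrightarrow> finite (pgl_class ` dsols d a b c x) \<and>
      real (card (pgl_class ` dsols d a b c x)) = (1 / 6) * real a * real b * (real a ^ 2 - 1) * (real b ^ 2 - 1)" by blast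
    show ?thesis
      by (rule general_pairI[OF F(1,2)], unfold Let_def dsols_classes) (use F(3) c in simp)
  qed
qed

end
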